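(* Let $G$ be a countable ICC group and assume that there exists an ICC subgroup $H$ of $G$ of index $[G:H]=N$ (with $N\in\mathbb N$). Let $\lambda$ be the left regular representation of $G$ on $l^2(G)$. Then: (i) If $p'\in L(G)'$ is any projection such that $\mathrm{tr}_{L(G)'}(p')\ge\frac1N$, then there exists a Parseval frame vector $\eta$ for the subrepresentation $\pi:=\lambda|_{p'l^2(G)}$ such that $\{\pi(g)\eta\,|\,g\in G\}$ is a finite union of Riesz sequences. (ii) For any ONB vector $\psi$ for the left regular representation $\lambda$ and any $\alpha$ such that $1>\alpha\ge\frac1N$, there exists a projection $p'\in L(G)'$ such that $\mathrm{tr}_{L(G)'}(p')=\alpha$ and $\{p'\lambda(g)\psi\,|\,g\in G\}$ is a finite union of Riesz sequences.
   Context: A group $G$ is ICC if for every $g\ne e$ in $G$ the conjugacy class of $g$ is infinite. The left regular representation is $\lambda(g)\delta_h=\delta_{gh}$ on $l^2(G)$, where $\{\delta_h\}_{h\in G}$ is the canonical orthonormal basis; $L(G)$ is the von Neumann algebra generated by $\lambda(G)$ and $L(G)'$ its commutant, a finite factor with unique normalized trace $\mathrm{tr}_{L(G)'}(T)=\langle T\delta_e,\delta_e\rangle$. Given a unitary representation $\pi$ of $G$ on $\mathcal K$, a vector $\xi\in\mathcal K$ is a Parseval frame vector (resp. ONB vector) for $\pi$ if the family $\{\pi(g)\xi\,|\,g\in G\}$, indexed by $G$, is a Parseval frame for $\mathcal K$, i.e. $\|f\|^2=\sum_{g\in G}|\langle f,\pi(g)\xi\rangle|^2$ for all $f\in\mathcal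 K$ (resp. an orthonormal basis of $\mathcal K$). A Riesz sequence is a family $\{x_i\}_{i\in J}$ for which there are constants $A,B>0$ with $A\sum|c_i|^2\le\|\sum c_ix_i\|^2\le B\sum|c_i|^2$ for all finitely supported scalar families $(c_i)$ (i.e. a Riesz basis for its closed linear span). A family indexed by $G$ is a finite union of Riesz sequences if $G$ can be partitioned into finitely many subsets such that the subfamily indexed by each of them is a Riesz sequence. "Projection" means orthogonal projection. *)

theory Defs
  imports "HOL-Analysis.Analysis" "HOL-Algebra.Coset" "HOL-Library.Disjoint_Sets"
begin

section \<open>Groups\<close>

text \<open>The trivial group counts as ICC.\<close>

definition icc_group :: "('a, 'b) monoid_scheme \<Rightarrow> bool" where
  "icc_group G \<longleftrightarrow> group G \<and>
     (\<forall>g\<in>carrier G. g \<noteq> \<one>\<^bsub>G\<^esub> \<longrightarrow>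
        infinite {x \<otimes>\<^bsub>G\<^esub> g \<otimes>\<^bsub>G\<^esub> inv\<^bsub>G\<^esub> x | x. x \<in> carrier G})"

section \<open>The Hilbert space of square-summable functions on a set\<close>

text \<open>
  The space is carried by a set \<open>I\<close> rather than by a type, so that \<open>I\<close> can be the carrier of a
  group. Its elements are functions on the whole type that vanish off \<open>I\<close>; this is why
  the inner product and the norm, which sum over the whole type, do not mention \<open>I\<close>.
  The inner product is linear in its first argument.
\<close>

definition ell2 :: "'a set \<Rightarrow> ('a \<Rightarrow> complex) set" where
  "ell2 I = {f. (\<lambda>x. (cmod (f x))\<^sup>2) summable_on UNIV \<and> (\<forall>x. x \<notin> I \<longrightarrow> f x = 0)}"

definition ell2_inner :: "('a \<Rightarrow> complex) \<Rightarrow> ('a \<Rightarrow> complex) \<Rightarrow> complex" where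
  "ell2_inner f g = (\<Sum>\<^sub>\<infinity>x. f x * cnj (g x))"

definition ell2_norm :: "('a \<Rightarrow> complex) \<Rightarrow> real" where
  "ell2_norm f = sqrt (\<Sum>\<^sub>\<infinity>x. (cmod (f x))\<^sup>2)"

definition ell2_delta :: "'a \<Rightarrow> 'a \<Rightarrow> complex" where
  "ell2_delta h = (\<lambda>x. if x = h then 1 else 0)"

section \<open>Bounded operators and von Neumann algebras\<close>

text \<open>
  Operators are extensional functions (\<open>undefined\<close> off \<open>ell2 I\<close>), so that equality in HOL is
  equality of operators.
\<close>

definition bounded_ops :: "'a set \<Rightarrow> (('a \<Rightarrow> complex) \<Rightarrow> ('a \<Rightarrow> complex)) set" where
  "bounded_ops I = {T \<in> ell2 I \<rightarrow>\<^sub>E ell2 I.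
     (\<forall>f\<in>ell2 I. \<forall>g\<in>ell2 I. \<forall>a b.
        T (\<lambda>x. a * f x + b * g x) = (\<lambda>x. a * T f x + b * T g x)) \<and>
     (\<exists>C. \<forall>f\<in>ell2 I. ell2_norm (T f) \<le> C * ell2_norm f)}"

definition is_adjoint ::
  "'a set \<Rightarrow> (('a \<Rightarrow> complex) \<Rightarrow> ('a \<Rightarrow> complex)) \<Rightarrow> (('a \<Rightarrow> complex) \<Rightarrow> ('a \<Rightarrow> complex)) \<Rightarrow> bool"
where
  "is_adjoint I T S \<longleftrightarrow>
     (\<forall>f\<in>ell2 I. \<forall>g\<in>ell2 I. ell2_inner (T f) g = ell2_inner f (S g))"

text \<open>The coarsest topology making all the functionals \<open>T \<mapsto> \<langle>T f, g\<rangle>\<close> continuous.\<close>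

definition weak_operator_topology ::
  "'a set \<Rightarrow> (('a \<Rightarrow> complex) \<Rightarrow> ('a \<Rightarrow> complex)) topology" where
  "weak_operator_topology I = topology_generated_by
     {{T \<in> bounded_ops I. ell2_inner (T f) g \<in> U} | f g U.
        f \<in> ell2 I \<and> g \<in> ell2 I \<and> open U}"

definition von_neumann_algebra ::
  "'a set \<Rightarrow> (('a \<Rightarrow> complex) \<Rightarrow> ('a \<Rightarrow> complex)) set \<Rightarrow> bool" where
  "von_neumann_algebra I M \<longleftrightarrow>
     M \<subseteq> bounded_ops I \<and>
     (\<lambda>f\<in>ell2 I. f) \<in> M \<and>
     (\<forall>S\<in>M. \<forall>T\<in>M. \<forall>a b. (\<lambda>f\<in>ell2 I. \<lambda>x. a * S f x + b * T f x) \<in> M) \<and>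
     (\<forall>S\<in>M. \<forall>T\<in>M. compose (ell2 I) S T \<in> M) \<and>
     (\<forall>T\<in>M. \<forall>S\<in>bounded_ops I. is_adjoint I T S \<longrightarrow> S \<in> M) \<and>
     closedin (weak_operator_topology I) M"

definition vn_generated ::
  "'a set \<Rightarrow> (('a \<Rightarrow> complex) \<Rightarrow> ('a \<Rightarrow> complex)) set
   \<Rightarrow> (('a \<Rightarrow> complex) \<Rightarrow> ('a \<Rightarrow> complex)) set" where
  "vn_generated I X = \<Inter>{M. von_neumann_algebra I M \<and> X \<subseteq> M}"

definition commutant ::
  "'a set \<Rightarrow> (('a \<Rightarrow> complex) \<Rightarrow> ('a \<Rightarrow> complex)) set
   \<Rightarrow> (('a \<Rightarrow> complex) \<Rightarrow> ('a \<Rightarrow> complex)) set" where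
  "commutant I M =
     {T \<in> bounded_ops I. \<forall>S\<in>M. compose (ell2 I) T S = compose (ell2 I) S T}"

definition is_projection ::
  "'a set \<Rightarrow> (('a \<Rightarrow> complex) \<Rightarrow> ('a \<Rightarrow> complex)) \<Rightarrow> bool" where
  "is_projection I p \<longleftrightarrow>
     p \<in> bounded_ops I \<and> compose (ell2 I) p p = p \<and> is_adjoint I p p"

section \<open>The left regular representation and its von Neumann algebra\<close>

definition left_regular ::
  "('a, 'b) monoid_scheme \<Rightarrow> 'a \<Rightarrow> ('a \<Rightarrow> complex) \<Rightarrow> ('a \<Rightarrow> complex)" where
  "left_regular G g =
     (\<lambda>f\<in>ell2 (carrier G). \<lambda>x. if x \<in> carrier G then f (inv\<^bsub>G\<^esub> g \<otimes>\<^bsub>G\<^esub> x) else 0)"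

definition group_vna ::
  "('a, 'b) monoid_scheme \<Rightarrow> (('a \<Rightarrow> complex) \<Rightarrow> ('a \<Rightarrow> complex)) set" where
  "group_vna G = vn_generated (carrier G) (left_regular G ` carrier G)"

definition group_vna_commutant ::
  "('a, 'b) monoid_scheme \<Rightarrow> (('a \<Rightarrow> complex) \<Rightarrow> ('a \<Rightarrow> complex)) set" where
  "group_vna_commutant G = commutant (carrier G) (group_vna G)"

definition commutant_trace ::
  "('a, 'b) monoid_scheme \<Rightarrow> (('a \<Rightarrow> complex) \<Rightarrow> ('a \<Rightarrow> complex)) \<Rightarrow> complex" where
  "commutant_trace G T = ell2_inner (T (ell2_delta \<one>\<^bsub>G\<^esub>)) (ell2_delta \<one>\<^bsub>G\<^esub>)"

definition subrepresentation ::
  "('g \<Rightarrow> ('a \<Rightarrow> complex) \<Rightarrow> ('a \<Rightarrow> complex)) \<Rightarrow> ('a \<Rightarrow> complex) set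
   \<Rightarrow> 'g \<Rightarrow> ('a \<Rightarrow> complex) \<Rightarrow> ('a \<Rightarrow> complex)" where
  "subrepresentation \<pi> K = (\<lambda>g. restrict (\<pi> g) K)"

lemma ell2_delta_mem: "h \<in> I \<Longrightarrow> ell2_delta h \<in> ell2 I"
  unfolding ell2_def ell2_delta_def
  by (auto intro!: finite_nonzero_values_imp_summable_on intro: finite_subset[of _ "{h}"])

lemma left_regular_delta:
  assumes "group G" "g \<in> carrier G" "h \<in> carrier G"
  shows "left_regular G g (ell2_delta h) = ell2_delta (g \<otimes>\<^bsub>G\<^esub> h)"
proof -
  interpret group G by fact
  have "inv\<^bsub>G\<^esub> g \<otimes>\<^bsub>G\<^esub> x = h \<longleftrightarrow> x = g \<otimes>\<^bsub>G\<^esub> h" if "x \<in> carrier G" for x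
    using assms that inv_solve_left'[of h g x] by auto
  with assms show ?thesis
    using ell2_delta_mem[OF assms(3)]
    by (auto simp: left_regular_def ell2_delta_def fun_eq_iff)
qed

section \<open>Frames, orthonormal bases and Riesz sequences\<close>

text \<open>In the following, \<open>K\<close> is a closed subspace of some \<open>ell2 I\<close>, and \<open>v\<close> is a family indexed by \<open>J\<close>.\<close>

definition parseval_frame ::
  "('a \<Rightarrow> complex) set \<Rightarrow> 'i set \<Rightarrow> ('i \<Rightarrow> 'a \<Rightarrow> complex) \<Rightarrow> bool" where
  "parseval_frame K J v \<longleftrightarrow> (\<forall>i\<in>J. v i \<in> K) \<and>
     (\<forall>f\<in>K. ((\<lambda>i. (cmod (ell2_inner f (v i)))\<^sup>2) has_sum (ell2_norm f)\<^sup>2) J)"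

definition orthonormal_basis ::
  "('a \<Rightarrow> complex) set \<Rightarrow> 'i set \<Rightarrow> ('i \<Rightarrow> 'a \<Rightarrow> complex) \<Rightarrow> bool" where
  "orthonormal_basis K J v \<longleftrightarrow> (\<forall>i\<in>J. v i \<in> K) \<and>
     (\<forall>i\<in>J. \<forall>j\<in>J. ell2_inner (v i) (v j) = (if i = j then 1 else 0)) \<and>
     (\<forall>f\<in>K. \<forall>\<epsilon>>0. \<exists>F c. finite F \<and> F \<subseteq> J \<and>
        ell2_norm (\<lambda>x. f x - (\<Sum>i\<in>F. c i * v i x)) < \<epsilon>)"

definition parseval_frame_vector ::
  "('g, 'b) monoid_scheme \<Rightarrow> ('g \<Rightarrow> ('a \<Rightarrow> complex) \<Rightarrow> ('a \<Rightarrow> complex))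
   \<Rightarrow> ('a \<Rightarrow> complex) set \<Rightarrow> ('a \<Rightarrow> complex) \<Rightarrow> bool" where
  "parseval_frame_vector G \<pi> K \<xi> \<longleftrightarrow>
     \<xi> \<in> K \<and> parseval_frame K (carrier G) (\<lambda>g. \<pi> g \<xi>)"

definition onb_vector ::
  "('g, 'b) monoid_scheme \<Rightarrow> ('g \<Rightarrow> ('a \<Rightarrow> complex) \<Rightarrow> ('a \<Rightarrow> complex))
   \<Rightarrow> ('a \<Rightarrow> complex) set \<Rightarrow> ('a \<Rightarrow> complex) \<Rightarrow> bool" where
  "onb_vector G \<pi> K \<xi> \<longleftrightarrow>
     \<xi> \<in> K \<and> orthonormal_basis K (carrier G) (\<lambda>g. \<pi> g \<xi>)"

definition riesz_sequence :: "'i set \<Rightarrow> ('i \<Rightarrow> 'a \<Rightarrow> complex) \<Rightarrow> bool" where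
  "riesz_sequence J v \<longleftrightarrow> (\<exists>A>0. \<exists>B>0. \<forall>F c. finite F \<and> F \<subseteq> J \<longrightarrow>
     A * (\<Sum>i\<in>F. (cmod (c i))\<^sup>2) \<le> (ell2_norm (\<lambda>x. \<Sum>i\<in>F. c i * v i x))\<^sup>2 \<and>
     (ell2_norm (\<lambda>x. \<Sum>i\<in>F. c i * v i x))\<^sup>2 \<le> B * (\<Sum>i\<in>F. (cmod (c i))\<^sup>2))"

definition finite_union_of_riesz_sequences ::
  "'i set \<Rightarrow> ('i \<Rightarrow> 'a \<Rightarrow> complex) \<Rightarrow> bool" where
  "finite_union_of_riesz_sequences J v \<longleftrightarrow>
     (\<exists>P. finite P \<and> partition_on J P \<and> (\<forall>S\<in>P. riesz_sequence S v))"

end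

theory Submission
  imports Defs
begin


text \<open>
  Write \<open>M = L(G)'\<close> and \<open>P = \<lambda>(H)' \<supseteq> M\<close>. The restriction of \<open>\<lambda>\<close> to \<open>H\<close> is a direct sum of \<open>N\<close> copies of
  the regular representation of \<open>H\<close>, so with respect to \<open>H\<close> the space \<open>p' l\<^sup>2(G)\<close> has dimension
  \<open>N tr(p') \<ge> 1\<close>. As \<open>H\<close> is ICC, \<open>P\<close> is a factor, and comparison of projections in \<open>P\<close>
  (\<open>comparison\<close>) turns this into an isometry \<open>V : l\<^sup>2(H) \<rightarrow> p' l\<^sup>2(G)\<close> that commutes with \<open>\<lambda>(H)\<close>.
  Summing its translates over the finitely many cosets gives \<open>T \<in> M\<close> with
  \<open>T \<delta>\<^sub>g = \<lambda>(g) V \<delta>\<^sub>e\<close> that agrees with \<open>V\<close> on \<open>l\<^sup>2(H)\<close>. The partial isometry \<open>U\<close> in the polar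
  decomposition of \<open>T\<close> satisfies \<open>\<parallel>T f\<parallel> \<le> \<parallel>T\<parallel> \<parallel>U f\<parallel>\<close>, so \<open>U\<close> is bounded below on \<open>l\<^sup>2(H)\<close>.
  The range of \<open>U\<close> can be smaller than \<open>p' l\<^sup>2(G)\<close>; since \<open>M\<close> is a factor with a finite trace,
  the missing part of \<open>p'\<close> is equivalent to a subprojection of \<open>1 - U\<^sup>*U\<close>. Adding the partial
  isometry of this equivalence produces \<open>W \<in> M\<close> with \<open>W W\<^sup>* = p'\<close>, and
  \<open>\<parallel>W f\<parallel> \<ge> \<parallel>U f\<parallel>\<close> (\<open>frame_operator_exists\<close>).

  This \<open>W\<close> proves (i) with \<open>\<eta> = W \<delta>\<^sub>e\<close>: the orbit is \<open>W \<delta>\<^sub>g\<close>, it is a Parseval frame because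
  \<open>W\<^sup>*\<close> is isometric on \<open>p' l\<^sup>2(G)\<close>, and on each left coset \<open>g H\<close> it is a Riesz sequence because,
  up to the unitary \<open>\<lambda>(g)\<close>, it is the image of an orthonormal basis of \<open>l\<^sup>2(H)\<close> under \<open>W\<close>
  (\<open>riesz_cosets\<close>).

  For (ii) take a projection in \<open>M\<close> of trace \<open>\<alpha>\<close> and the corresponding \<open>W\<close>. Then \<open>r = W\<^sup>*W\<close> has
  trace \<open>\<alpha>\<close> and \<open>\<parallel>r f\<parallel> = \<parallel>W f\<parallel>\<close>, so the vectors \<open>r \<delta>\<^sub>g\<close> are a finite union of Riesz
  sequences. If \<open>u \<in> M\<close> is the isometry \<open>\<delta>\<^sub>g \<mapsto> \<lambda>(g) \<psi>\<close>, then \<open>p' = u r u\<^sup>*\<close> has the same trace,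
  and \<open>p' \<lambda>(g) \<psi> = u r \<delta>\<^sub>g\<close>.

  Three facts about the algebras \<open>M\<close> and \<open>P\<close> carry the argument.
  \<^item> \<open>equivariant_ergodic\<close>: two nonzero projections of \<open>P\<close> are never separated by all of \<open>P\<close>.
    This is the only use of the ICC property of \<open>H\<close>. A central projection, applied to \<open>\<delta>\<^sub>e\<close>,
    is a square-summable function on \<open>H\<close> that is constant on conjugacy classes, hence a
    multiple of \<open>\<delta>\<^sub>e\<close>.
  \<^item> \<open>comparison\<close>: among the partial isometries between two projections there is a maximal one,
    and by ergodicity it uses up one of the two sides.
  \<^item> \<open>projection_of_trace\<close>: if \<open>G\<close> is infinite, \<open>M\<close> has no minimal projection, hence projections
    of every trace in \<open>[0, 1]\<close>. For a minimal \<open>e\<close> of trace \<open>t\<close> the operators \<open>e \<rho>(g) e\<close>, with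
    \<open>\<rho>\<close> the right regular representation, would be scalar multiples of \<open>e\<close>, with coefficients
    that are square-summable in \<open>g\<close>. So many of the vectors \<open>\<rho>(g) e \<rho>(g)\<^sup>* \<delta>\<^sub>e\<close> would be nearly
    orthogonal to each other, although each has inner product \<open>t\<close> with \<open>\<delta>\<^sub>e\<close>.

  The operator theory is done over the reals: a complex Hilbert space is a real one on which
  multiplication by \<open>\<i>\<close> acts, and being complex linear means commuting with this operator. Both
  \<open>M\<close> and \<open>P\<close> are then commutants of sets of real operators that are closed under adjoints.
\<close>

section \<open>Orthogonal projections and adjoints\<close>

text \<open>
  A minimizing sequence for the distance to \<open>x\<close> is Cauchy by the parallelogram law, and its
  limit is the foot of the perpendicular.
\<close>

lemma orth_proj_exists:
  fixes S :: "'h::{real_inner,banach} set"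
  assumes S: "subspace S" "closed S"
  shows "\<exists>y\<in>S. \<forall>z\<in>S. (x - y) \<bullet> z = 0"
proof -
  define d where "d = infdist x S"
  have ne: "S \<noteq> {}" using S(1) subspace_0 by auto
  have dle: "d \<le> norm (x - z)" if "z \<in> S" for z
    using infdist_le[OF that, of x] by (simp add: d_def dist_norm)
  have d0: "d \<ge> 0" by (simp add: d_def infdist_nonneg)
  have "\<exists>z\<in>S. (norm (x - z))\<^sup>2 < d\<^sup>2 + 1 / real (Suc n)" for n
  proof -
    have "d < sqrt (d\<^sup>2 + 1 / real (Suc n))"
      by (rule real_less_rsqrt) simp
    then obtain z where z: "z \<in> S" "dist x z < sqrt (d\<^sup>2 + 1 / real (Suc n))"
      using cInf_lessD[of "(\<lambda>a. dist x a) ` S"] ne by (auto simp: d_def infdist_def)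
    then have "(norm (x - z))\<^sup>2 < (sqrt (d\<^sup>2 + 1 / real (Suc n)))\<^sup>2"
      by (intro power_strict_mono) (auto simp: dist_norm)
    moreover have "(sqrt (d\<^sup>2 + 1 / real (Suc n)))\<^sup>2 = d\<^sup>2 + 1 / real (Suc n)"
      by (rule real_sqrt_pow2) simp
    ultimately show ?thesis using z by auto
  qed
  then obtain Y where Y: "\<And>n. Y n \<in> S" "\<And>n. (norm (x - Y n))\<^sup>2 < d\<^sup>2 + 1 / real (Suc n)"
    by metis
  have par: "(norm (Y m - Y n))\<^sup>2 \<le> 2 / real (Suc m) + 2 / real (Suc n)" for m n
  proof -
    have "(1/2) *\<^sub>R (Y m + Y n) \<in> S"
      using S(1) Y(1) by (auto intro: subspace_scale subspace_add)
    from dle[OF this] have "d\<^sup>2 \<le> (norm (x - (1/2) *\<^sub>R (Y m + Y n)))\<^sup>2"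
      using d0 by (rule power_mono)
    moreover have "(norm (Y m - Y n))\<^sup>2 =
       2 * (norm (x - Y m))\<^sup>2 + 2 * (norm (x - Y n))\<^sup>2 - 4 * (norm (x - (1/2) *\<^sub>R (Y m + Y n)))\<^sup>2"
      unfolding power2_norm_eq_inner by (simp add: algebra_simps inner_simps inner_commute)
    ultimately show ?thesis using Y(2)[of m] Y(2)[of n] by simp
  qed
  have "Cauchy Y"
  proof (rule metric_CauchyI)
    fix e :: real assume e: "e > 0"
    obtain M where M: "1 / real (Suc M) < e\<^sup>2 / 4"
      using reals_Archimedean[of "e\<^sup>2 / 4"] e by (auto simp: field_simps)
    have "dist (Y m) (Y n) < e" if "m \<ge> M" "n \<ge> M" for m n
    proof -
      have "2 / real (Suc m) + 2 / real (Suc n) \<le> 2 / real (Suc M) + 2 / real (Suc M)"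
        using that by (intro add_mono divide_left_mono) auto
      with par[of m n] M have "(norm (Y m - Y n))\<^sup>2 < e\<^sup>2" by simp
      then show ?thesis using e by (auto simp: dist_norm intro: power_less_imp_less_base)
    qed
    then show "\<exists>M. \<forall>m\<ge>M. \<forall>n\<ge>M. dist (Y m) (Y n) < e" by blast
  qed
  then obtain y where y: "Y \<longlonglongrightarrow> y" by (auto simp: Cauchy_convergent_iff convergent_def)
  have yS: "y \<in> S" using S(2) Y(1) y by (auto simp: closed_sequential_limits)
  have "(norm (x - y))\<^sup>2 \<le> d\<^sup>2"
  proof (rule LIMSEQ_le)
    show "(\<lambda>n. (norm (x - Y n))\<^sup>2) \<longlonglongrightarrow> (norm (x - y))\<^sup>2"
      by (intro tendsto_intros y)
    show "(\<lambda>n. d\<^sup>2 + 1 / real (Suc n)) \<longlonglongrightarrow> d\<^sup>2"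
      using tendsto_add[OF tendsto_const[of "d\<^sup>2"] LIMSEQ_inverse_real_of_nat]
      by (simp add: inverse_eq_divide)
    show "\<exists>N. \<forall>n\<ge>N. (norm (x - Y n))\<^sup>2 \<le> d\<^sup>2 + 1 / real (Suc n)"
      using Y(2) less_imp_le by blast
  qed
  then have min: "(norm (x - y))\<^sup>2 \<le> (norm (x - z))\<^sup>2" if "z \<in> S" for z
    using dle[OF that] d0 by (meson order_trans power_mono)
  \<comment> \<open>The competitor \<open>y + t z\<close> with the best \<open>t\<close> would be closer to \<open>x\<close> than \<open>y\<close>.\<close>
  have "(x - y) \<bullet> z = 0" if z: "z \<in> S" for z
  proof (cases "z = 0")
    case False
    define t where "t = ((x - y) \<bullet> z) / (z \<bullet> z)"
    have "y + t *\<^sub>R z \<in> S" using S(1) yS z by (auto intro: subspace_scale subspace_add)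
    from min[OF this] have "2 * t * ((x - y) \<bullet> z) \<le> t\<^sup>2 * (z \<bullet> z)"
      unfolding power2_norm_eq_inner
      by (simp add: algebra_simps inner_simps inner_commute power2_eq_square)
    moreover have "t * (z \<bullet> z) = (x - y) \<bullet> z" using False by (simp add: t_def)
    then have "t\<^sup>2 * (z \<bullet> z) = t * ((x - y) \<bullet> z)" by (simp add: power2_eq_square)
    ultimately have "t * ((x - y) \<bullet> z) \<le> 0" by simp
    then have "((x - y) \<bullet> z)\<^sup>2 / (z \<bullet> z) \<le> 0" by (simp add: t_def power2_eq_square)
    then show ?thesis using False
      by (metis divide_le_0_iff inner_eq_zero_iff inner_ge_zero le_less
          not_less power_zero_numeral zero_eq_power2 zero_less_power2 zero_le_power2)
  qed simp
  with yS show ?thesis by blast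
qed

definition orth_proj :: "'h::{real_inner,banach} set \<Rightarrow> ('h \<Rightarrow>\<^sub>L 'h)" where
  "orth_proj S = Blinfun (\<lambda>x. SOME y. y \<in> S \<and> (\<forall>z\<in>S. (x - y) \<bullet> z = 0))"

lemma orth_proj_unique_aux:
  assumes "subspace S" "y \<in> S" "\<forall>z\<in>S. (x - y) \<bullet> z = 0" "y' \<in> S" "\<forall>z\<in>S. (x - y') \<bullet> z = 0"
  shows "y = y'"
proof -
  have "y - y' \<in> S" using assms by (simp add: subspace_diff)
  then have "(x - y) \<bullet> (y - y') = 0" "(x - y') \<bullet> (y - y') = 0" using assms by auto
  then have "(y - y') \<bullet> (y - y') = 0" by (simp add: algebra_simps inner_simps)
  then show ?thesis by simp
qed

lemma orth_proj:
  fixes S :: "'h::{real_inner,banach} set"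
  assumes S: "subspace S" "closed S"
  shows orth_proj_in: "orth_proj S x \<in> S"
    and orth_proj_orth: "z \<in> S \<Longrightarrow> (x - orth_proj S x) \<bullet> z = 0"
proof -
  define p where "p = (\<lambda>x. SOME y. y \<in> S \<and> (\<forall>z\<in>S. (x - y) \<bullet> z = 0))"
  have p: "p x \<in> S \<and> (\<forall>z\<in>S. (x - p x) \<bullet> z = 0)" for x
    unfolding p_def by (rule someI_ex) (use orth_proj_exists[OF S] in blast)
  have "bounded_linear p"
  proof (rule bounded_linear_intro[where K = 1])
    show "p (x + y) = p x + p y" for x y
    proof (rule orth_proj_unique_aux[OF S(1), of _ "x + y"])
      have "(x + y) - (p x + p y) = (x - p x) + (y - p y)" by simp
      then show "\<forall>z\<in>S. (x + y - (p x + p y)) \<bullet> z = 0" using p by (simp only: inner_add_left) simp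
    qed (use p S in \<open>auto intro: subspace_add\<close>)
    show "p (r *\<^sub>R x) = r *\<^sub>R p x" for r x
    proof (rule orth_proj_unique_aux[OF S(1), of _ "r *\<^sub>R x"])
      have "r *\<^sub>R x - r *\<^sub>R p x = r *\<^sub>R (x - p x)" by (simp add: scaleR_diff_right)
      then show "\<forall>z\<in>S. (r *\<^sub>R x - r *\<^sub>R p x) \<bullet> z = 0" using p by (simp only: inner_scaleR_left) simp
    qed (use p S in \<open>auto intro: subspace_scale\<close>)
    show "norm (p x) \<le> norm x * 1" for x
    proof -
      have "(x - p x) \<bullet> p x = 0" using p by blast
      then have "(norm (p x))\<^sup>2 + (norm (x - p x))\<^sup>2 = (norm x)\<^sup>2"
        unfolding power2_norm_eq_inner by (simp add: algebra_simps inner_simps inner_commute)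
      then have "(norm (p x))\<^sup>2 \<le> (norm x)\<^sup>2" by (smt (verit) zero_le_power2)
      then show ?thesis by (auto intro: power2_le_imp_le)
    qed
  qed
  then have "blinfun_apply (orth_proj S) = p"
    unfolding orth_proj_def p_def[symmetric] by (rule bounded_linear_Blinfun_apply)
  then show "orth_proj S x \<in> S" "z \<in> S \<Longrightarrow> (x - orth_proj S x) \<bullet> z = 0" using p by auto
qed

lemma orth_proj_eqI:
  assumes "subspace S" "closed S" "y \<in> S" "\<And>z. z \<in> S \<Longrightarrow> (x - y) \<bullet> z = 0"
  shows "orth_proj S x = y"
  using orth_proj_unique_aux[of S "orth_proj S x" x y] orth_proj[of S] assms by blast

text \<open>
  A functional is determined up to a factor by its kernel, and the factor is read off on a vector
  perpendicular to the kernel.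
\<close>

lemma riesz_representation:
  fixes \<phi> :: "'h::{real_inner,banach} \<Rightarrow> real"
  assumes "bounded_linear \<phi>"
  shows "\<exists>y. \<forall>x. \<phi> x = x \<bullet> y"
proof (cases "\<forall>x. \<phi> x = 0")
  case True
  then show ?thesis by (auto intro: exI[of _ 0])
next
  case False
  then obtain u where u: "\<phi> u \<noteq> 0" by auto
  interpret bounded_linear \<phi> by fact
  define S where "S = {x. \<phi> x = 0}"
  have S: "subspace S" "closed S"
    by (auto simp: S_def subspace_def zero add scaleR
        intro!: closed_Collect_eq continuous_intros linear_continuous_on assms)
  define w where "w = u - orth_proj S u"
  have "orth_proj S u \<in> S" by (rule orth_proj_in[OF S])
  then have fw: "\<phi> w \<noteq> 0" using u by (simp add: w_def diff S_def)
  then have w0: "w \<noteq> 0" by (auto simp: zero)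
  have "\<phi> x = x \<bullet> ((\<phi> w / (w \<bullet> w)) *\<^sub>R w)" for x
  proof -
    have "x - (\<phi> x / \<phi> w) *\<^sub>R w \<in> S" using fw by (simp add: S_def diff scaleR)
    then have "w \<bullet> (x - (\<phi> x / \<phi> w) *\<^sub>R w) = 0"
      unfolding w_def by (rule orth_proj_orth[OF S])
    then have "w \<bullet> x = (\<phi> x / \<phi> w) * (w \<bullet> w)" by (simp add: inner_simps)
    then show ?thesis using fw w0 by (simp add: inner_commute field_simps)
  qed
  then show ?thesis by blast
qed

definition adj :: "('h::{real_inner,banach} \<Rightarrow>\<^sub>L 'h) \<Rightarrow> ('h \<Rightarrow>\<^sub>L 'h)" where
  "adj T = Blinfun (\<lambda>y. SOME z. \<forall>x. T x \<bullet> y = x \<bullet> z)"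

lemma adj_right:
  fixes T :: "'h::{real_inner,banach} \<Rightarrow>\<^sub>L 'h"
  shows "x \<bullet> adj T y = T x \<bullet> y"
proof -
  define s where "s = (\<lambda>y. SOME z. \<forall>x. T x \<bullet> y = x \<bullet> z)"
  have s: "T x \<bullet> y = x \<bullet> s y" for x y
  proof -
    have "bounded_linear (\<lambda>x. T x \<bullet> y)"
      by (intro bounded_linear_intros)
    then have "\<forall>x. T x \<bullet> y = x \<bullet> s y"
      unfolding s_def by (rule someI_ex[OF riesz_representation])
    then show ?thesis by blast
  qed
  have ext: "a = b" if "\<And>x. x \<bullet> a = x \<bullet> b" for a b :: 'h
    using that[of "a - b"] by (metis inner_diff_right inner_eq_zero_iff right_minus_eq)
  have "bounded_linear s"
  proof (rule bounded_linear_intro[where K = "norm T"])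
    show "s (y + z) = s y + s z" for y z
      by (rule ext) (simp add: inner_simps flip: s)
    show "s (r *\<^sub>R y) = r *\<^sub>R s y" for r y
      by (rule ext) (simp add: inner_simps flip: s)
    show "norm (s y) \<le> norm y * norm T" for y
    proof (cases "s y = 0")
      case False
      have "norm (s y) * norm (s y) = T (s y) \<bullet> y"
        using s[of "s y" y] by (simp add: norm_eq_sqrt_inner)
      also have "\<dots> \<le> norm (T (s y)) * norm y" by (rule norm_cauchy_schwarz)
      also have "\<dots> \<le> norm T * norm (s y) * norm y"
        by (intro mult_right_mono norm_blinfun) auto
      finally show ?thesis using False by (simp add: mult_ac)
    qed simp
  qed
  then have "blinfun_apply (adj T) = s"
    unfolding adj_def s_def[symmetric] by (rule bounded_linear_Blinfun_apply)
  then show ?thesis using s by simp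
qed

lemma adj_left:
  fixes T :: "'h::{real_inner,banach} \<Rightarrow>\<^sub>L 'h"
  shows "adj T x \<bullet> y = x \<bullet> T y"
  using adj_right[of y T x] by (simp add: inner_commute)

lemma adj_eqI:
  fixes T S :: "'h::{real_inner,banach} \<Rightarrow>\<^sub>L 'h"
  assumes "\<And>x y. T x \<bullet> y = x \<bullet> S y"
  shows "adj T = S"
proof (rule blinfun_eqI)
  fix y
  have "(adj T y - S y) \<bullet> (adj T y - S y) = 0"
    by (simp add: inner_diff_right adj_right assms)
  then show "adj T y = S y" by simp
qed

lemma adj_adj [simp]: "adj (adj T) = T"
  by (rule adj_eqI) (simp add: adj_left)

lemma adj_comp [simp]: "adj (S o\<^sub>L T) = adj T o\<^sub>L adj S"
  by (rule adj_eqI) (simp add: adj_right)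

lemma adj_add [simp]: "adj (S + T) = adj S + adj T"
  by (rule adj_eqI) (simp add: adj_right blinfun.bilinear_simps inner_simps)

lemma adj_diff [simp]: "adj (S - T) = adj S - adj T"
  by (rule adj_eqI) (simp add: adj_right blinfun.bilinear_simps inner_simps)

lemma adj_minus [simp]: "adj (- T) = - adj T"
  by (rule adj_eqI) (simp add: adj_right blinfun.bilinear_simps inner_simps)

lemma adj_scaleR [simp]: "adj (r *\<^sub>R T) = r *\<^sub>R adj T"
  by (rule adj_eqI) (simp add: adj_right blinfun.bilinear_simps inner_simps)

lemma adj_zero [simp]: "adj 0 = 0"
  by (rule adj_eqI) simp

lemma adj_id [simp]: "adj id_blinfun = id_blinfun"
  by (rule adj_eqI) simp

lemmas comp_algebra =
  bounded_bilinear.add_left[OF bounded_bilinear_blinfun_compose]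
  bounded_bilinear.add_right[OF bounded_bilinear_blinfun_compose]
  bounded_bilinear.diff_left[OF bounded_bilinear_blinfun_compose]
  bounded_bilinear.diff_right[OF bounded_bilinear_blinfun_compose]
  bounded_bilinear.scaleR_left[OF bounded_bilinear_blinfun_compose]
  bounded_bilinear.scaleR_right[OF bounded_bilinear_blinfun_compose]
  bounded_bilinear.minus_left[OF bounded_bilinear_blinfun_compose]
  bounded_bilinear.minus_right[OF bounded_bilinear_blinfun_compose]
  bounded_bilinear.zero_left[OF bounded_bilinear_blinfun_compose]
  bounded_bilinear.zero_right[OF bounded_bilinear_blinfun_compose]

lemma comp_id [simp]: "T o\<^sub>L id_blinfun = T" "id_blinfun o\<^sub>L T = T"
  by (auto intro: blinfun_eqI)

lemma comp_apply: "(S :: _ \<Rightarrow>\<^sub>L _) o\<^sub>L T = R \<Longrightarrow> S (T x) = R x"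
  by (metis blinfun_apply_blinfun_compose)

lemma comp_assoc: "(R o\<^sub>L S) o\<^sub>L T = R o\<^sub>L (S o\<^sub>L T)"
  by (auto intro: blinfun_eqI)

text \<open>
  For self-adjoint \<open>C\<close> with vanishing quadratic form, the form at \<open>x + C x\<close> equals
  \<open>2 \<parallel>C x\<parallel>\<^sup>2\<close>.
\<close>

lemma sa_eqI:
  fixes A B :: "'h::{real_inner,banach} \<Rightarrow>\<^sub>L 'h"
  assumes "adj A = A" "adj B = B" "\<And>x. A x \<bullet> x = B x \<bullet> x"
  shows "A = B"
proof (rule blinfun_eqI)
  fix x
  define C where "C = A - B"
  have q: "C z \<bullet> z = 0" for z using assms(3) by (simp add: C_def blinfun.bilinear_simps inner_simps)
  have s: "C u \<bullet> v = u \<bullet> C v" for u v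
    using adj_right[of u C v] assms by (simp add: C_def)
  have "C (x + C x) \<bullet> (x + C x) = C x \<bullet> x + C x \<bullet> C x + C (C x) \<bullet> x + C (C x) \<bullet> C x"
    by (simp add: blinfun.bilinear_simps inner_simps)
  then have "C x \<bullet> C x = 0" using q s[of "C x" x] by simp
  then show "A x = B x" by (simp add: C_def blinfun.bilinear_simps)
qed

definition proj_op :: "('h::{real_inner,banach} \<Rightarrow>\<^sub>L 'h) \<Rightarrow> bool" where
  "proj_op P \<longleftrightarrow> P o\<^sub>L P = P \<and> adj P = P"

lemma proj_op_inner:
  fixes P :: "'h::{real_inner,banach} \<Rightarrow>\<^sub>L 'h"
  assumes "proj_op P"
  shows "P x \<bullet> y = x \<bullet> P y" "P x \<bullet> x = (norm (P x))\<^sup>2" "P (P x) = P x"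
proof -
  show *: "P x \<bullet> y = x \<bullet> P y" for x y using assms adj_right[of x P y] by (simp add: proj_op_def)
  show **: "P (P x) = P x" for x using assms by (simp add: comp_apply proj_op_def)
  show "P x \<bullet> x = (norm (P x))\<^sup>2" using *[of "P x" x] by (simp add: power2_norm_eq_inner **)
qed

lemma proj_op_orth_proj:
  assumes S: "subspace S" "closed S"
  shows "proj_op (orth_proj S)"
proof -
  have 1: "orth_proj S (orth_proj S x) = orth_proj S x" for x
    by (rule orth_proj_eqI[OF S]) (auto simp: orth_proj_in[OF S])
  have "orth_proj S x \<bullet> y = x \<bullet> orth_proj S y" for x y
    using orth_proj_orth[OF S orth_proj_in[OF S], of x y]
      orth_proj_orth[OF S orth_proj_in[OF S], of y x]
    by (simp add: inner_simps inner_commute)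
  then have "adj (orth_proj S) = orth_proj S" by (rule adj_eqI)
  with 1 show ?thesis by (auto simp: proj_op_def intro: blinfun_eqI)
qed

lemma proj_op_norm_le:
  fixes P :: "'h::{real_inner,banach} \<Rightarrow>\<^sub>L 'h"
  assumes "proj_op P" shows "norm (P x) \<le> norm x"
proof (cases "P x = 0")
  case False
  have "norm (P x) * norm (P x) \<le> norm (P x) * norm x"
    using proj_op_inner(2)[OF assms, of x] norm_cauchy_schwarz[of "P x" x]
    by (simp add: power2_eq_square)
  then show ?thesis using False by simp
qed simp

lemma proj_op_diff:
  fixes P Q :: "'h::{real_inner,banach} \<Rightarrow>\<^sub>L 'h"
  assumes "proj_op P" "proj_op Q" "Q o\<^sub>L P = P"
  shows "proj_op (Q - P)" "P o\<^sub>L Q = P" "P o\<^sub>L (Q - P) = 0" "(Q - P) o\<^sub>L P = 0"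
    "Q o\<^sub>L (Q - P) = Q - P"
proof -
  have "adj (Q o\<^sub>L P) = adj P" using assms(3) by (rule arg_cong)
  then show PQ: "P o\<^sub>L Q = P" using assms(1,2) by (simp add: proj_op_def)
  with assms show "proj_op (Q - P)" "P o\<^sub>L (Q - P) = 0" "(Q - P) o\<^sub>L P = 0"
    "Q o\<^sub>L (Q - P) = Q - P"
    by (auto simp: proj_op_def comp_algebra)
qed

section \<open>The absolute value of an operator\<close>

text \<open>
  The square root of \<open>T\<^sup>*T\<close>. It commutes with everything that commutes with \<open>T\<^sup>*T\<close>, which
  keeps it inside the commutants used below.
\<close>

lemma abs_op_exists:
  fixes T :: "'h::{real_inner,banach} \<Rightarrow>\<^sub>L 'h"
  shows "\<exists>B. adj B = B \<and> (\<forall>x. B x \<bullet> x \<ge> 0) \<and> B o\<^sub>L B = adj T o\<^sub>L T \<and>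
    (\<forall>S. S o\<^sub>L (adj T o\<^sub>L T) = (adj T o\<^sub>L T) o\<^sub>L S \<longrightarrow> S o\<^sub>L B = B o\<^sub>L S)"
proof -
  \<comment> \<open>With this \<open>c\<close>, the operator \<open>A / c\<close> lies between \<open>0\<close> and \<open>1\<close>, so \<open>D = 1 - A / c\<close> is a contraction.\<close>
  define c where "c = (norm (adj T))\<^sup>2 + 1"
  have c: "c > 0" by (simp add: c_def add_nonneg_pos)
  define A where "A = adj T o\<^sub>L T"
  define D where "D = id_blinfun - (1/c) *\<^sub>R A"
  have saD: "adj D = D" by (simp add: D_def A_def)
  have "norm (D x) \<le> 1 * norm x" for x
  proof -
    have Axx: "A x \<bullet> x = (norm (T x))\<^sup>2"
      by (simp add: A_def adj_left power2_norm_eq_inner)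
    have "(norm (A x))\<^sup>2 \<le> (norm (adj T) * norm (T x))\<^sup>2"
      by (rule power_mono) (auto simp: A_def norm_blinfun)
    also have "\<dots> \<le> c * (A x \<bullet> x)"
      unfolding power_mult_distrib Axx by (rule mult_right_mono) (auto simp: c_def)
    finally have n: "(norm (A x))\<^sup>2 \<le> c * (A x \<bullet> x)" .
    have "(norm (D x))\<^sup>2 = (norm x)\<^sup>2 - (2/c) * (A x \<bullet> x) + (norm (A x))\<^sup>2 / c\<^sup>2"
      unfolding power2_norm_eq_inner D_def
      by (simp add: blinfun.bilinear_simps inner_simps inner_commute power2_eq_square)
    also have "(norm (A x))\<^sup>2 / c\<^sup>2 \<le> (c * (A x \<bullet> x)) / c\<^sup>2"
      using n by (rule divide_right_mono) simp
    also have "(c * (A x \<bullet> x)) / c\<^sup>2 = (1/c) * (A x \<bullet> x)" using c by (simp add: power2_eq_square)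
    finally have "(norm (D x))\<^sup>2 \<le> (norm x)\<^sup>2 - (1/c) * (A x \<bullet> x)" by (simp add: algebra_simps)
    also have "\<dots> \<le> (norm x)\<^sup>2" using c by (simp add: Axx)
    finally show ?thesis by (auto intro: power2_le_imp_le)
  qed
  then have nD: "norm D \<le> 1" by (intro norm_blinfun_bound) auto
  \<comment> \<open>If \<open>Z = (D + Z\<^sup>2) / 2\<close> then \<open>(1 - Z)\<^sup>2 = 1 - D\<close>. The fixed point iteration from \<open>0\<close> consists of
    polynomials in \<open>D\<close> with nonnegative coefficients, hence its increments are dominated in norm
    by those of the same iteration for the number \<open>1\<close>, which increases and is bounded by \<open>1\<close>.\<close>
  define Y where "Y = rec_nat 0 (\<lambda>_ Z. (1/2) *\<^sub>R (D + (Z o\<^sub>L Z)))"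
  define y :: "nat \<Rightarrow> real" where "y = rec_nat 0 (\<lambda>_ z. (1/2) * (1 + z * z))"
  have Y: "Y 0 = 0" "\<And>n. Y (Suc n) = (1/2) *\<^sub>R (D + (Y n o\<^sub>L Y n))" by (auto simp: Y_def)
  have y: "y 0 = 0" "\<And>n. y (Suc n) = (1/2) * (1 + y n * y n)" by (auto simp: y_def)
  have y01: "0 \<le> y n \<and> y n \<le> 1" for n
    by (induction n) (auto simp: y intro: mult_le_one)
  have nY: "norm (Y n) \<le> y n" for n
  proof (induction n)
    case (Suc n)
    have "norm (D + (Y n o\<^sub>L Y n)) \<le> 1 + y n * y n"
      using nD norm_blinfun_compose[of "Y n" "Y n"] mult_mono[OF Suc Suc] y01[of n]
        norm_triangle_ineq[of D "Y n o\<^sub>L Y n"] by auto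
    then show ?case by (simp add: Y y)
  qed (simp add: Y y)
  have commS: "S o\<^sub>L Y n = Y n o\<^sub>L S" if "S o\<^sub>L D = D o\<^sub>L S" for S n
  proof (induction n)
    case (Suc n)
    have "S o\<^sub>L (Y n o\<^sub>L Y n) = (Y n o\<^sub>L Y n) o\<^sub>L S"
      by (metis Suc comp_assoc)
    with that show ?case by (simp add: Y comp_algebra)
  qed (simp add: Y)
  have commYY: "Y m o\<^sub>L Y n = Y n o\<^sub>L Y m" for m n
    using commS[of D n] commS[of "Y m" n] commS[of D m] by metis
  \<comment> \<open>All \<open>Y n\<close> commute, so the difference of two squares factors.\<close>
  have step: "norm (Y (Suc n) - Y n) \<le> y (Suc n) - y n" for n
  proof (induction n)
    case 0
    then show ?case using nD by (simp add: Y y)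
  next
    case (Suc n)
    have "Y (Suc (Suc n)) - Y (Suc n)
        = (1/2) *\<^sub>R ((Y (Suc n) o\<^sub>L Y (Suc n)) - (Y n o\<^sub>L Y n))"
      by (subst (1 2) Y(2)) (simp add: algebra_simps)
    also have "\<dots> = (1/2) *\<^sub>R ((Y (Suc n) - Y n) o\<^sub>L (Y (Suc n) + Y n))"
      using commYY[of n "Suc n"] by (simp add: comp_algebra)
    also have "norm \<dots> \<le> (1/2) * (norm (Y (Suc n) - Y n) * norm (Y (Suc n) + Y n))"
      by (simp add: norm_blinfun_compose)
    also have "\<dots> \<le> (1/2) * ((y (Suc n) - y n) * (y (Suc n) + y n))"
      using Suc norm_ge_zero[of "Y (Suc n) - Y n"]
        norm_triangle_ineq[of "Y (Suc n)" "Y n"] nY[of n] nY[of "Suc n"]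
      by (intro mult_left_mono mult_mono) (linarith | simp)+
    also have "\<dots> = y (Suc (Suc n)) - y (Suc n)"
      by (subst (3 4) y(2)) (simp add: algebra_simps)
    finally show ?case .
  qed
  have inc: "incseq y"
  proof (rule incseq_SucI)
    show "y n \<le> y (Suc n)" for n
      using step[of n] norm_ge_zero[of "Y (Suc n) - Y n"] by linarith
  qed
  have dif: "norm (Y (n + k) - Y n) \<le> y (n + k) - y n" for n k
  proof (induction k)
    case (Suc k)
    have "norm (Y (n + Suc k) - Y n) \<le> norm (Y (Suc (n + k)) - Y (n + k)) + norm (Y (n + k) - Y n)"
      by (rule order_trans[OF _ norm_triangle_ineq]) simp
    then show ?case using Suc step[of "n + k"] by simp
  qed simp
  have "Cauchy y"
    using inc y01 by (intro convergent_Cauchy Bseq_mono_convergent BseqI'[where K = 1])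
      (auto simp: incseq_def)
  have "Cauchy Y"
  proof (rule CauchyI')
    fix e :: real assume e: "e > 0"
    obtain M where M: "\<And>m n. m \<ge> M \<Longrightarrow> n \<ge> M \<Longrightarrow> dist (y m) (y n) < e"
      using metric_CauchyD[OF \<open>Cauchy y\<close> e] by blast
    have "dist (Y m) (Y n) < e" if "m \<ge> M" "n > m" for m n
      using dif[of m "n - m"] M[of n m] that by (auto simp: dist_norm norm_minus_commute)
    then show "\<exists>M. \<forall>m\<ge>M. \<forall>n>m. dist (Y m) (Y n) < e" by blast
  qed
  then obtain Z where Z: "Y \<longlonglongrightarrow> Z" by (auto simp: Cauchy_convergent_iff convergent_def)
  have "(\<lambda>n. Y (Suc n)) \<longlonglongrightarrow> (1/2) *\<^sub>R (D + (Z o\<^sub>L Z))"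
    unfolding Y by (intro tendsto_intros Z bounded_bilinear.tendsto[OF bounded_bilinear_blinfun_compose])
  then have ZZ: "Z = (1/2) *\<^sub>R (D + (Z o\<^sub>L Z))"
    using LIMSEQ_Suc[OF Z] LIMSEQ_unique by blast
  have nZ: "norm Z \<le> 1"
    by (rule LIMSEQ_le_const2[OF tendsto_norm[OF Z]]) (use nY y01 order_trans in blast)
  have saY: "adj (Y n) = Y n" for n
    by (induction n) (simp_all add: Y saD)
  have saZ: "adj Z = Z"
  proof (rule adj_eqI)
    fix u v
    have "Y n u \<bullet> v = u \<bullet> Y n v" for n using adj_right[of u "Y n" v] saY by simp
    moreover have "(\<lambda>n. Y n u \<bullet> v) \<longlonglongrightarrow> Z u \<bullet> v" "(\<lambda>n. u \<bullet> Y n v) \<longlonglongrightarrow> u \<bullet> Z v"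
      by (intro tendsto_intros Z)+
    ultimately show "Z u \<bullet> v = u \<bullet> Z v" using LIMSEQ_unique by simp
  qed
  define B where "B = sqrt c *\<^sub>R (id_blinfun - Z)"
  have "adj B = B" by (simp add: B_def saZ)
  moreover have "B x \<bullet> x \<ge> 0" for x
  proof -
    have "Z x \<bullet> x \<le> norm (Z x) * norm x" by (rule norm_cauchy_schwarz)
    also have "\<dots> \<le> norm Z * norm x * norm x" by (intro mult_right_mono norm_blinfun) auto
    also have "\<dots> \<le> 1 * norm x * norm x" using nZ by (intro mult_right_mono) auto
    finally show ?thesis using c
      by (simp add: B_def blinfun.bilinear_simps inner_simps power2_norm_eq_inner[symmetric] power2_eq_square)
  qed
  moreover have "B o\<^sub>L B = A"
  proof -
    have "Z o\<^sub>L Z = 2 *\<^sub>R Z - D"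
      using arg_cong[OF ZZ, of "\<lambda>X. 2 *\<^sub>R X - D"] by simp
    then have "(id_blinfun - Z) o\<^sub>L (id_blinfun - Z) = id_blinfun - D"
      by (simp add: comp_algebra algebra_simps scaleR_2)
    moreover have "B o\<^sub>L B = c *\<^sub>R ((id_blinfun - Z) o\<^sub>L (id_blinfun - Z))"
      unfolding B_def bounded_bilinear.scaleR_left[OF bounded_bilinear_blinfun_compose]
        bounded_bilinear.scaleR_right[OF bounded_bilinear_blinfun_compose] scaleR_scaleR
      using c by simp
    ultimately show ?thesis using c by (simp add: D_def)
  qed
  moreover have "S o\<^sub>L B = B o\<^sub>L S" if "S o\<^sub>L A = A o\<^sub>L S" for S
  proof -
    have "S o\<^sub>L D = D o\<^sub>L S" using that by (simp add: D_def comp_algebra)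
    from commS[OF this] have "S o\<^sub>L Y n = Y n o\<^sub>L S" for n .
    moreover have "(\<lambda>n. S o\<^sub>L Y n) \<longlonglongrightarrow> (S o\<^sub>L Z)" "(\<lambda>n. Y n o\<^sub>L S) \<longlonglongrightarrow> (Z o\<^sub>L S)"
      by (intro bounded_bilinear.tendsto[OF bounded_bilinear_blinfun_compose] tendsto_const Z)+
    ultimately have "S o\<^sub>L Z = Z o\<^sub>L S" using LIMSEQ_unique by simp
    then show ?thesis by (simp add: B_def comp_algebra)
  qed
  ultimately show ?thesis unfolding A_def by blast
qed

section \<open>Strong limits and greedy exhaustion\<close>

lemma subspace_closure:
  fixes S :: "'h::real_normed_vector set"
  assumes "subspace S"
  shows "subspace (closure S)"
proof (rule subspaceI)
  show "0 \<in> closure S" using subspace_0[OF assms] closure_subset by blast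
  show "x + y \<in> closure S" if xy: "x \<in> closure S" "y \<in> closure S" for x y
  proof -
    obtain f g where "\<And>n. f n \<in> S" "f \<longlonglongrightarrow> x" "\<And>n. g n \<in> S" "g \<longlonglongrightarrow> y"
      using xy unfolding closure_sequential by metis
    then show ?thesis unfolding closure_sequential
      by (intro exI[of _ "\<lambda>n. f n + g n"]) (auto intro: tendsto_add subspace_add assms)
  qed
  show "c *\<^sub>R x \<in> closure S" if x: "x \<in> closure S" for c x
  proof -
    obtain f where "\<And>n. f n \<in> S" "f \<longlonglongrightarrow> x" using x unfolding closure_sequential by metis
    then show ?thesis unfolding closure_sequential
      by (intro exI[of _ "\<lambda>n. c *\<^sub>R f n"]) (auto intro: tendsto_scaleR subspace_scale assms)
  qed
qed

lemma strong_limit_exists: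
  fixes V :: "nat \<Rightarrow> 'h::{real_inner,banach} \<Rightarrow>\<^sub>L 'h"
  assumes "\<And>n x. norm (V n x) \<le> norm x" "\<And>x. Cauchy (\<lambda>n. V n x)"
  shows "\<exists>W :: 'h \<Rightarrow>\<^sub>L 'h. \<forall>x. (\<lambda>n. V n x) \<longlonglongrightarrow> W x"
proof -
  from assms(2) obtain w where w: "\<And>x. (\<lambda>n. V n x) \<longlonglongrightarrow> w x"
    unfolding Cauchy_convergent_iff convergent_def by metis
  have "bounded_linear w"
  proof (rule bounded_linear_intro[where K = 1])
    show "w (x + y) = w x + w y" for x y
      using LIMSEQ_unique[OF w[of "x + y"]] tendsto_add[OF w[of x] w[of y]]
      by (simp add: blinfun.bilinear_simps)
    show "w (r *\<^sub>R x) = r *\<^sub>R w x" for r x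
      using LIMSEQ_unique[OF w[of "r *\<^sub>R x"]] tendsto_scaleR[OF tendsto_const w[of x], of r]
      by (simp add: blinfun.bilinear_simps)
    show "norm (w x) \<le> norm x * 1" for x
      using LIMSEQ_le_const2[OF tendsto_norm[OF w[of x]]] assms(1) by auto
  qed
  then show ?thesis using w by (intro exI[of _ "Blinfun w"]) (simp add: bounded_linear_Blinfun_apply)
qed

text \<open>
  A substitute for Zorn's lemma when only increasing sequences are known to have upper bounds.
  In step \<open>n\<close> one moves to an element that comes within \<open>1/(n+1)\<close> of the supremum of \<open>\<phi>\<close>
  over all larger elements; above an upper bound of the resulting sequence, \<open>\<phi>\<close> cannot grow.
\<close>

lemma greedy_maximal:
  fixes \<phi> :: "'x \<Rightarrow> real"
  assumes refl: "\<And>x. x \<in> X \<Longrightarrow> r x x" and trans: "\<And>x y z. r x y \<Longrightarrow> r y z \<Longrightarrow> r x z"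
    and bdd: "\<And>x. x \<in> X \<Longrightarrow> \<phi> x \<le> B" and mono: "\<And>x y. x \<in> X \<Longrightarrow> y \<in> X \<Longrightarrow> r x y \<Longrightarrow> \<phi> x \<le> \<phi> y"
    and chain: "\<And>f :: nat \<Rightarrow> 'x. (\<And>n. f n \<in> X) \<Longrightarrow> (\<And>n. r (f n) (f (Suc n))) \<Longrightarrow> \<exists>u\<in>X. \<forall>n. r (f n) u"
    and ne: "x0 \<in> X"
  shows "\<exists>x\<in>X. \<forall>y\<in>X. r x y \<longrightarrow> \<phi> y = \<phi> x"
proof -
  have ex: "\<exists>y. y \<in> X \<and> r x y \<and> (\<forall>z\<in>X. r x z \<longrightarrow> \<phi> z \<le> \<phi> y + 1 / real (Suc n))" if "x \<in> X" for x n
  proof -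
    define A where "A = \<phi> ` {z\<in>X. r x z}"
    have A: "A \<noteq> {}" "bdd_above A" using refl[OF that] that bdd by (auto simp: A_def bdd_above_def)
    have "Sup A - 1 / real (Suc n) < Sup A" by simp
    then obtain y where "y \<in> X" "r x y" "Sup A - 1 / real (Suc n) < \<phi> y"
      using less_cSup_iff[OF A] unfolding A_def by blast
    moreover have "\<phi> z \<le> Sup A" if "z \<in> X" "r x z" for z
      using cSup_upper[OF _ A(2)] that by (auto simp: A_def)
    ultimately show ?thesis by (intro exI[of _ y]) force
  qed
  define nxt where "nxt = (\<lambda>n x. SOME y. y \<in> X \<and> r x y \<and> (\<forall>z\<in>X. r x z \<longrightarrow> \<phi> z \<le> \<phi> y + 1 / real (Suc n)))"
  have nxt: "nxt n x \<in> X \<and> r x (nxt n x) \<and> (\<forall>z\<in>X. r x z \<longrightarrow> \<phi> z \<le> \<phi> (nxt n x) + 1 / real (Suc n))"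
    if "x \<in> X" for n x
    unfolding nxt_def by (rule someI_ex[OF ex[OF that]])
  define f where "f = rec_nat x0 nxt"
  have fX: "f n \<in> X" for n by (induction n) (use ne nxt in \<open>auto simp: f_def\<close>)
  have fS: "f (Suc n) = nxt n (f n)" for n by (simp add: f_def)
  from chain[of f] fX nxt fS obtain u where u: "u \<in> X" "\<And>n. r (f n) u" by metis
  have "\<phi> y = \<phi> u" if y: "y \<in> X" "r u y" for y
  proof (rule antisym)
    have "\<phi> y \<le> \<phi> u + 1 / real (Suc n)" for n
    proof -
      have "\<phi> y \<le> \<phi> (f (Suc n)) + 1 / real (Suc n)"
        using nxt[OF fX] y trans[OF u(2) y(2)] by (simp add: fS)
      also have "\<phi> (f (Suc n)) \<le> \<phi> u" using mono fX u by blast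
      finally show ?thesis by simp
    qed
    moreover have "(\<lambda>n. \<phi> u + 1 / real (Suc n)) \<longlonglongrightarrow> \<phi> u"
      using tendsto_add[OF tendsto_const[of "\<phi> u"] LIMSEQ_inverse_real_of_nat]
      by (simp add: inverse_eq_divide)
    ultimately show "\<phi> y \<le> \<phi> u" by (meson LIMSEQ_le_const)
    show "\<phi> u \<le> \<phi> y" using mono u y by blast
  qed
  with u show ?thesis by blast
qed

section \<open>Partial isometries\<close>

definition partial_isometry :: "('h::{real_inner,banach} \<Rightarrow>\<^sub>L 'h) \<Rightarrow> bool" where
  "partial_isometry V \<longleftrightarrow> proj_op (adj V o\<^sub>L V)"

lemma norm_adj_comp:
  fixes V :: "'h::{real_inner,banach} \<Rightarrow>\<^sub>L 'h"
  shows "(adj V o\<^sub>L V) x \<bullet> x = (norm (V x))\<^sup>2"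
  by (simp add: adj_left power2_norm_eq_inner)

lemma partial_isometry:
  fixes V :: "'h::{real_inner,banach} \<Rightarrow>\<^sub>L 'h"
  assumes "partial_isometry V"
  shows partial_isometry_comp: "V o\<^sub>L (adj V o\<^sub>L V) = V"
    and partial_isometry_norm: "norm (V x) = norm ((adj V o\<^sub>L V) x)"
    and partial_isometry_norm_le: "norm (V x) \<le> norm x"
    and partial_isometry_adj: "partial_isometry (adj V)"
    and partial_isometry_final_proj: "proj_op (V o\<^sub>L adj V)"
    and partial_isometry_final: "(V o\<^sub>L adj V) o\<^sub>L V = V"
proof -
  define E where "E = adj V o\<^sub>L V"
  have E: "proj_op E" using assms by (simp add: partial_isometry_def E_def)
  have n: "norm (V x) = norm (E x)" for x
    using norm_adj_comp[of V x] proj_op_inner(2)[OF E, of x] by (simp add: E_def)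
  then show "norm (V x) = norm ((adj V o\<^sub>L V) x)" by (simp add: E_def)
  show "norm (V x) \<le> norm x" using n proj_op_norm_le[OF E] by simp
  have "V (E x) = V x" for x
  proof -
    have "norm (V (E x - x)) = norm (E (E x - x))" by (rule n)
    also have "\<dots> = 0" using proj_op_inner(3)[OF E] by (simp add: blinfun.bilinear_simps)
    finally show ?thesis by (simp add: blinfun.bilinear_simps)
  qed
  then show c: "V o\<^sub>L (adj V o\<^sub>L V) = V" by (auto intro: blinfun_eqI simp: E_def)
  then show "(V o\<^sub>L adj V) o\<^sub>L V = V" by (simp add: comp_assoc)
  then have "(V o\<^sub>L adj V) o\<^sub>L (V o\<^sub>L adj V) = V o\<^sub>L adj V"
    by (metis comp_assoc)
  then show "proj_op (V o\<^sub>L adj V)" by (simp add: proj_op_def)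
  then show "partial_isometry (adj V)" by (simp add: partial_isometry_def)
qed

lemma partial_isometry_sum:
  fixes U V :: "'h::{real_inner,banach} \<Rightarrow>\<^sub>L 'h"
  assumes "adj V o\<^sub>L U = 0" "adj U o\<^sub>L V = 0" "V o\<^sub>L adj U = 0" "U o\<^sub>L adj V = 0"
  shows "adj (V + U) o\<^sub>L (V + U) = (adj V o\<^sub>L V) + (adj U o\<^sub>L U)"
    and "(V + U) o\<^sub>L adj (V + U) = (V o\<^sub>L adj V) + (U o\<^sub>L adj U)"
  using assms by (simp_all add: comp_algebra)

lemma proj_op_add:
  fixes P Q :: "'h::{real_inner,banach} \<Rightarrow>\<^sub>L 'h"
  assumes "proj_op P" "proj_op Q" "P o\<^sub>L Q = 0"
  shows "proj_op (P + Q)" "Q o\<^sub>L P = 0"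
proof -
  have "adj (P o\<^sub>L Q) = 0" using assms(3) by simp
  then show "Q o\<^sub>L P = 0" using assms(1,2) by (simp add: proj_op_def)
  then show "proj_op (P + Q)" using assms by (simp add: proj_op_def comp_algebra)
qed

text \<open>
  \<open>V\<close> is the restriction of \<open>W\<close> to the initial space of \<open>V\<close>. On that space \<open>W\<close> preserves norms,
  and a projection that preserves the norm of a vector fixes it.
\<close>

lemma partial_isometry_extends:
  fixes V W :: "'h::{real_inner,banach} \<Rightarrow>\<^sub>L 'h"
  assumes V: "partial_isometry V" and W: "partial_isometry W" and ext: "V = W o\<^sub>L (adj V o\<^sub>L V)"
  shows "(adj W o\<^sub>L W) o\<^sub>L (adj V o\<^sub>L V) = adj V o\<^sub>L V"
proof (rule blinfun_eqI)
  fix x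
  define E F z where "E = adj V o\<^sub>L V" and "F = adj W o\<^sub>L W" and "z = E x"
  have E: "proj_op E" and F: "proj_op F" using V W by (simp_all add: partial_isometry_def E_def F_def)
  have Ez: "E z = z" using proj_op_inner(3)[OF E] by (simp add: z_def)
  have "V z = W z" using comp_apply[OF ext[symmetric], of z] Ez by (simp add: E_def)
  then have "norm (F z) = norm (E z)"
    using partial_isometry_norm[OF V, of z] partial_isometry_norm[OF W, of z] by (simp add: E_def F_def)
  then have "F z \<bullet> z = z \<bullet> z" using Ez proj_op_inner(2)[OF F, of z] by (simp add: power2_norm_eq_inner)
  then have "(F z - z) \<bullet> (F z - z) = 0"
    using proj_op_inner(2)[OF F, of z] by (simp add: inner_simps inner_commute power2_norm_eq_inner)
  then show "((adj W o\<^sub>L W) o\<^sub>L (adj V o\<^sub>L V)) x = (adj V o\<^sub>L V) x" by (simp add: z_def E_def F_def)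
qed

text \<open>
  If each partial isometry extends the previous one, then \<open>\<parallel>V m x - V n x\<parallel>\<^sup>2\<close> is the difference of the
  squared norms of \<open>x\<close> under the two initial projections. These norms are increasing and bounded in
  \<open>n\<close>, so \<open>V n x\<close> is a Cauchy sequence.
\<close>

lemma partial_isometry_chain_limit:
  fixes V :: "nat \<Rightarrow> 'h::{real_inner,banach} \<Rightarrow>\<^sub>L 'h"
  assumes pi: "\<And>n. partial_isometry (V n)"
    and chain: "\<And>n. V n = V (Suc n) o\<^sub>L (adj (V n) o\<^sub>L V n)"
  shows "\<exists>W. partial_isometry W \<and> (\<forall>x. (\<lambda>n. V n x) \<longlonglongrightarrow> W x) \<and>
    (\<forall>n. V n = W o\<^sub>L (adj (V n) o\<^sub>L V n))"
proof -
  define E where "E n = adj (V n) o\<^sub>L V n" for n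
  have E: "proj_op (E n)" for n using pi[of n] by (simp add: E_def partial_isometry_def)
  have VE: "V n = V (Suc n) o\<^sub>L E n" for n using chain by (simp add: E_def)
  have up1: "E (Suc n) o\<^sub>L E n = E n" for n
    using partial_isometry_extends[OF pi pi chain[of n]] by (simp add: E_def)
  have up: "E (n + k) o\<^sub>L E n = E n" for n k
  proof (induction k)
    case (Suc k)
    then show ?case by (metis up1 comp_assoc add_Suc_right)
  qed (use E in \<open>simp add: proj_op_def\<close>)
  have up': "E n o\<^sub>L E (n + k) = E n" for n k
    using proj_op_diff(2)[OF E E up] .
  have VEk: "V n = V (n + k) o\<^sub>L E n" for n k
  proof (induction k)
    case 0
    then show ?case using partial_isometry_comp[OF pi] by (simp add: E_def)
  next
    case (Suc k)
    have "V (n + k) o\<^sub>L E n = V (n + Suc k) o\<^sub>L (E (n + k) o\<^sub>L E n)"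
      by (metis VE comp_assoc add_Suc_right)
    with Suc show ?case by (simp add: up)
  qed
  have pyth: "(norm (V (n + k) x - V n x))\<^sup>2 = (norm (E (n + k) x))\<^sup>2 - (norm (E n x))\<^sup>2" for n k x
  proof -
    have "V (n + k) x - V n x = V (n + k) (x - E n x)"
      by (subst VEk[of n k]) (simp add: blinfun.bilinear_simps)
    then have "norm (V (n + k) x - V n x) = norm (E (n + k) (x - E n x))"
      using partial_isometry_norm[OF pi] by (simp add: E_def)
    also have "E (n + k) (x - E n x) = E (n + k) x - E n x"
      using comp_apply[OF up] by (simp add: blinfun.bilinear_simps)
    finally have "(norm (V (n + k) x - V n x))\<^sup>2 = (norm (E (n + k) x - E n x))\<^sup>2" by simp
    moreover have "E (n + k) x \<bullet> E n x = E n x \<bullet> E n x"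
      using proj_op_inner(1)[OF E, of n "E (n+k) x" "E n x"] proj_op_inner(3)[OF E]
        comp_apply[OF up'[of n k], of x] proj_op_inner(1)[OF E, of n "E (n+k) x" x]
      by (metis proj_op_inner(1)[OF E])
    ultimately show ?thesis
      by (simp add: power2_norm_eq_inner inner_simps inner_commute)
  qed
  have "Cauchy (\<lambda>n. V n x)" for x
  proof -
    define a where "a n = (norm (E n x))\<^sup>2" for n
    have "incseq a"
    proof (rule incseq_SucI)
      show "a n \<le> a (Suc n)" for n
        using pyth[of n 1 x] zero_le_power2[of "norm (V (n + 1) x - V n x)"] by (simp add: a_def)
    qed
    moreover have "norm (a n) \<le> (norm x)\<^sup>2" for n
      using proj_op_norm_le[OF E] by (simp add: a_def power_mono)
    ultimately have "Cauchy a"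
      by (intro convergent_Cauchy Bseq_mono_convergent BseqI') (auto simp: incseq_def)
    show ?thesis
    proof (rule CauchyI')
      fix e :: real assume e: "e > 0"
      then have "e\<^sup>2 > 0" by simp
      then obtain M where M: "\<And>m n. m \<ge> M \<Longrightarrow> n \<ge> M \<Longrightarrow> dist (a m) (a n) < e\<^sup>2"
        using metric_CauchyD[OF \<open>Cauchy a\<close>] by blast
      have "dist (V m x) (V n x) < e" if "m \<ge> M" "n > m" for m n
      proof -
        have "(dist (V m x) (V n x))\<^sup>2 = a n - a m"
          using pyth[of m "n - m" x] that by (simp add: dist_norm norm_minus_commute a_def)
        also have "\<dots> < e\<^sup>2" using M[of n m] that by (simp add: dist_real_def)
        finally show ?thesis using e by (auto intro: power_less_imp_less_base)
      qed
      then show "\<exists>M. \<forall>m\<ge>M. \<forall>n>m. dist (V m x) (V n x) < e" by blast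
    qed
  qed
  then obtain W :: "'h \<Rightarrow>\<^sub>L 'h" where W: "\<And>x. (\<lambda>n. V n x) \<longlonglongrightarrow> W x"
    using strong_limit_exists[of V] partial_isometry_norm_le[OF pi] by blast
  have VW: "V n = W o\<^sub>L E n" for n
  proof (rule blinfun_eqI)
    fix x
    have "(\<lambda>k. V (k + n) (E n x)) \<longlonglongrightarrow> W (E n x)" by (rule LIMSEQ_ignore_initial_segment[OF W])
    moreover have "V (k + n) (E n x) = V n x" for k
      using VEk[of n k] by (metis add.commute blinfun_apply_blinfun_compose)
    ultimately have "(\<lambda>k. V n x) \<longlonglongrightarrow> W (E n x)" by simp
    then show "V n x = (W o\<^sub>L E n) x" using LIMSEQ_unique[OF tendsto_const] by simp
  qed
  \<comment> \<open>The next relations identify the initial projection of \<open>W\<close> as the limit of the projections \<open>E n\<close>.\<close>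
  have nVW: "V n x \<bullet> W y = x \<bullet> E n y" for n x y
  proof -
    have "(\<lambda>k. V n x \<bullet> V (n + k) y) \<longlonglongrightarrow> V n x \<bullet> W y"
      using LIMSEQ_ignore_initial_segment[OF W, of n y]
      by (intro tendsto_inner tendsto_const) (simp add: add.commute)
    moreover have "V n x \<bullet> V (n + k) y = x \<bullet> E n y" for k
    proof -
      have "V n x \<bullet> V (n + k) y = V (n + k) (E n x) \<bullet> V (n + k) y"
        using VEk[of n k] by (metis blinfun_apply_blinfun_compose)
      also have "\<dots> = E n x \<bullet> E (n + k) y" by (simp add: E_def adj_right)
      also have "\<dots> = x \<bullet> E n y"
        using proj_op_inner(1)[OF E] comp_apply[OF up'] by metis
      finally show ?thesis .
    qed
    ultimately have "(\<lambda>k. x \<bullet> E n y) \<longlonglongrightarrow> V n x \<bullet> W y" by simp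
    from LIMSEQ_unique[OF tendsto_const this] show ?thesis by simp
  qed
  have Elim: "(\<lambda>n. x \<bullet> E n y) \<longlonglongrightarrow> W x \<bullet> W y" for x y
    unfolding nVW[symmetric] by (intro tendsto_intros W)
  have "adj W o\<^sub>L W = F \<Longrightarrow> F o\<^sub>L E n = E n" for F n
  proof (rule blinfun_eqI)
    fix x assume F: "adj W o\<^sub>L W = F"
    have "(F (E n x) - E n x) \<bullet> y = 0" for y
    proof -
      have "F (E n x) \<bullet> y = V n x \<bullet> W y"
        using VW[of n] by (simp flip: F add: adj_left)
      also have "\<dots> = E n x \<bullet> y" using nVW proj_op_inner(1)[OF E] by simp
      finally show ?thesis by (simp add: inner_simps)
    qed
    then have "F (E n x) - E n x = 0" by (metis all_zero_iff)
    then show "(F o\<^sub>L E n) x = E n x" by simp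
  qed
  then have FE: "(adj W o\<^sub>L W) o\<^sub>L E n = E n" for n by blast
  have "(adj W o\<^sub>L W) o\<^sub>L (adj W o\<^sub>L W) = adj W o\<^sub>L W"
  proof (rule blinfun_eqI)
    fix y
    let ?F = "adj W o\<^sub>L W"
    have "(?F (?F y) - ?F y) \<bullet> x = 0" for x
    proof -
      have "(\<lambda>n. ?F x \<bullet> E n y) \<longlonglongrightarrow> W (?F x) \<bullet> W y" by (rule Elim)
      moreover have "?F x \<bullet> E n y = x \<bullet> E n y" for n
        using comp_apply[OF FE, of n y] adj_left[of W "W x" "E n y"] adj_right[of x W "W (E n y)"]
        by simp
      ultimately have "W (?F x) \<bullet> W y = W x \<bullet> W y"
        using LIMSEQ_unique[OF _ Elim[of x y]] by simp
      then show ?thesis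
        using adj_left[of W "W (?F y)" x] adj_right[of "?F y" W "W x"] adj_left[of W "W y" "?F x"]
          adj_left[of W "W y" x]
        by (simp add: inner_simps inner_commute)
    qed
    then have "?F (?F y) - ?F y = 0" by (metis all_zero_iff)
    then show "(?F o\<^sub>L ?F) y = ?F y" by simp
  qed
  then have "partial_isometry W" by (simp add: partial_isometry_def proj_op_def)
  then show ?thesis using W VW unfolding E_def by blast
qed

text \<open>
  The map \<open>B x \<mapsto> A x\<close> is well defined and isometric on the range of \<open>B\<close>; \<open>U\<close> extends it to the
  closure by limits and vanishes on the orthogonal complement.
\<close>

lemma isometric_transfer:
  fixes A B :: "'h::{real_inner,banach} \<Rightarrow>\<^sub>L 'h"
  assumes iso: "\<And>x. norm (A x) = norm (B x)"
  shows "\<exists>U :: 'h \<Rightarrow>\<^sub>L 'h. U o\<^sub>L B = A \<and> U = U o\<^sub>L orth_proj (closure (range B)) \<and>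
     adj U o\<^sub>L U = orth_proj (closure (range B))"
proof -
  define M where "M = closure (range B)"
  have "subspace (range B)"
    using linear_subspace_image[OF bounded_linear.linear[OF blinfun.bounded_linear_right] subspace_UNIV] .
  then have M: "subspace M" "closed M" by (auto simp: M_def subspace_closure)
  define P where "P = orth_proj M"
  have P: "proj_op P" using proj_op_orth_proj[OF M] by (simp add: P_def)
  have dif: "norm (A x - A y) = norm (B x - B y)" for x y
    using iso[of "x - y"] by (simp add: blinfun.bilinear_simps)
  have "\<exists>f. (\<lambda>n. B (f n)) \<longlonglongrightarrow> P y" for y
  proof -
    have "P y \<in> closure (range B)" using orth_proj_in[OF M] by (simp add: P_def M_def)
    then obtain g where g: "\<And>n. g n \<in> range B" "g \<longlonglongrightarrow> P y" unfolding closure_sequential by auto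
    then have "\<forall>n. \<exists>x. g n = B x" by blast
    then obtain f where "\<And>n. g n = B (f n)" by metis
    then have "g = (\<lambda>n. B (f n))" by blast
    with g(2) show ?thesis by blast
  qed
  then obtain f where f: "\<And>y. (\<lambda>n. B (f y n)) \<longlonglongrightarrow> P y" by metis
  have "\<exists>u. (\<lambda>n. A (f y n)) \<longlonglongrightarrow> u" for y
  proof -
    have "Cauchy (\<lambda>n. B (f y n))" using f[of y] by (rule LIMSEQ_imp_Cauchy)
    then have "Cauchy (\<lambda>n. A (f y n))" unfolding Cauchy_def dist_norm dif .
    then show ?thesis by (simp add: Cauchy_convergent_iff convergent_def)
  qed
  then obtain u where u: "\<And>y. (\<lambda>n. A (f y n)) \<longlonglongrightarrow> u y" by metis
  have key: "(\<lambda>n. A (h n)) \<longlonglongrightarrow> u y" if "(\<lambda>n. B (h n)) \<longlonglongrightarrow> P y" for h y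
  proof -
    have "(\<lambda>n. B (h n) - B (f y n)) \<longlonglongrightarrow> 0" using tendsto_diff[OF that f[of y]] by simp
    then have "(\<lambda>n. A (h n) - A (f y n)) \<longlonglongrightarrow> 0"
      unfolding tendsto_norm_zero_iff[symmetric, of "\<lambda>n. _ n - _ n"] dif .
    from tendsto_add[OF this u[of y]] show ?thesis by simp
  qed
  have nu: "norm (u y) = norm (P y)" for y
    using LIMSEQ_unique[OF tendsto_norm[OF u[of y]]] tendsto_norm[OF f[of y]] by (simp add: iso)
  have bl: "bounded_linear u"
  proof (rule bounded_linear_intro[where K = 1])
    show "u (x + y) = u x + u y" for x y
    proof -
      have "(\<lambda>n. B (f x n + f y n)) \<longlonglongrightarrow> P (x + y)"
        using tendsto_add[OF f[of x] f[of y]] by (simp add: blinfun.bilinear_simps)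
      from LIMSEQ_unique[OF key[OF this]] show ?thesis
        using tendsto_add[OF u[of x] u[of y]] by (simp add: blinfun.bilinear_simps)
    qed
    show "u (r *\<^sub>R x) = r *\<^sub>R u x" for r x
    proof -
      have "(\<lambda>n. B (r *\<^sub>R f x n)) \<longlonglongrightarrow> P (r *\<^sub>R x)"
        using tendsto_scaleR[OF tendsto_const f[of x]] by (simp add: blinfun.bilinear_simps)
      from LIMSEQ_unique[OF key[OF this]] show ?thesis
        using tendsto_scaleR[OF tendsto_const u[of x], of r] by (simp add: blinfun.bilinear_simps)
    qed
    show "norm (u x) \<le> norm x * 1" for x using proj_op_norm_le[OF P] nu by simp
  qed
  define U where "U = Blinfun u"
  have U: "blinfun_apply U = u" using bl by (simp add: U_def bounded_linear_Blinfun_apply)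
  have UP: "U = U o\<^sub>L P"
  proof (rule blinfun_eqI)
    fix y
    have "norm (U (y - P y)) = norm (P (y - P y))" by (simp add: U nu)
    then show "U y = (U o\<^sub>L P) y" using proj_op_inner(3)[OF P] by (simp add: blinfun.bilinear_simps)
  qed
  moreover have "U o\<^sub>L B = A"
  proof (rule blinfun_eqI)
    fix x
    have "P (B x) = B x" unfolding P_def
      by (rule orth_proj_eqI[OF M]) (auto simp: M_def intro: closure_subset[THEN subsetD])
    then have "(\<lambda>n. A x) \<longlonglongrightarrow> u (B x)" by (intro key) simp
    then show "(U o\<^sub>L B) x = A x" using LIMSEQ_unique[OF tendsto_const, of "A x" "u (B x)"] by (simp add: U)
  qed
  moreover have "adj U o\<^sub>L U = P"
  proof (rule sa_eqI)
    show "(adj U o\<^sub>L U) x \<bullet> x = P x \<bullet> x" for x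
      using proj_op_inner(2)[OF P, of x] nu by (simp add: adj_left U power2_norm_eq_inner[symmetric])
  qed (use P in \<open>auto simp: proj_op_def\<close>)
  ultimately show ?thesis unfolding P_def M_def by blast
qed

section \<open>Commutants and polar decomposition\<close>

definition op_commutant :: "('h::{real_inner,banach} \<Rightarrow>\<^sub>L 'h) set \<Rightarrow> ('h \<Rightarrow>\<^sub>L 'h) set" where
  "op_commutant \<S> = {T. \<forall>S\<in>\<S>. S o\<^sub>L T = T o\<^sub>L S}"

locale adj_closed =
  fixes \<S> :: "('h::{real_inner,banach} \<Rightarrow>\<^sub>L 'h) set"
  assumes adj_mem: "S \<in> \<S> \<Longrightarrow> adj S \<in> \<S>"
begin

abbreviation "\<C> \<equiv> op_commutant \<S>"

lemma commutantD:
  assumes "S \<in> \<S>" "T \<in> \<C>"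
  shows "S (T x) = T (S x)"
proof -
  have "S o\<^sub>L T = T o\<^sub>L S" using assms unfolding op_commutant_def by blast
  from comp_apply[OF this, of x] show ?thesis by simp
qed

lemma commutantI:
  fixes T :: "'h \<Rightarrow>\<^sub>L 'h"
  assumes "\<And>S x. S \<in> \<S> \<Longrightarrow> S (T x) = T (S x)"
  shows "T \<in> \<C>"
proof -
  have "S o\<^sub>L T = T o\<^sub>L S" if "S \<in> \<S>" for S
    by (rule blinfun_eqI) (simp add: assms[OF that])
  then show ?thesis unfolding op_commutant_def by blast
qed

lemma commutant_alg:
  "id_blinfun \<in> \<C>" "0 \<in> \<C>"
  "R \<in> \<C> \<Longrightarrow> T \<in> \<C> \<Longrightarrow> R + T \<in> \<C>"
  "R \<in> \<C> \<Longrightarrow> T \<in> \<C> \<Longrightarrow> R - T \<in> \<C>"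
  "T \<in> \<C> \<Longrightarrow> - T \<in> \<C>"
  "T \<in> \<C> \<Longrightarrow> r *\<^sub>R T \<in> \<C>"
  "R \<in> \<C> \<Longrightarrow> T \<in> \<C> \<Longrightarrow> R o\<^sub>L T \<in> \<C>"
proof -
  show "id_blinfun \<in> \<C>" by (rule commutantI) simp
  show "0 \<in> \<C>" by (rule commutantI) (simp add: blinfun.zero_right)
next
  assume T: "T \<in> \<C>"
  show "- T \<in> \<C>"
    by (rule commutantI) (simp add: blinfun.minus_left blinfun.minus_right commutantD[OF _ T])
  show "r *\<^sub>R T \<in> \<C>"
    by (rule commutantI) (simp add: blinfun.scaleR_left blinfun.scaleR_right commutantD[OF _ T])
next
  assume R: "R \<in> \<C>" and T: "T \<in> \<C>"
  show "R + T \<in> \<C>"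
    by (rule commutantI) (simp add: blinfun.add_left blinfun.add_right commutantD[OF _ T] commutantD[OF _ R])
  show "R - T \<in> \<C>"
    by (rule commutantI) (simp add: blinfun.diff_left blinfun.diff_right commutantD[OF _ T] commutantD[OF _ R])
  show "R o\<^sub>L T \<in> \<C>"
    by (rule commutantI) (simp add: commutantD[OF _ T] commutantD[OF _ R])
qed

lemma commutant_adj: assumes "T \<in> \<C>" shows "adj T \<in> \<C>"
proof -
  have "S o\<^sub>L adj T = adj T o\<^sub>L S" if "S \<in> \<S>" for S
  proof -
    have "adj S o\<^sub>L T = T o\<^sub>L adj S"
      using assms adj_mem[OF that] unfolding op_commutant_def by blast
    then have "adj (adj S o\<^sub>L T) = adj (T o\<^sub>L adj S)" by (rule arg_cong)
    then show ?thesis by simp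
  qed
  then show ?thesis unfolding op_commutant_def by blast
qed

text \<open>
  A closed subspace that is invariant under a set of operators closed under adjoints has an
  invariant orthogonal complement.
\<close>

lemma commutant_orth_proj:
  assumes M: "subspace M" "closed M" and inv: "\<And>S x. S \<in> \<S> \<Longrightarrow> x \<in> M \<Longrightarrow> S x \<in> M"
  shows "orth_proj M \<in> \<C>"
proof -
  have "orth_proj M (S x) = S (orth_proj M x)" if S: "S \<in> \<S>" for S x
  proof (rule orth_proj_eqI[OF M])
    show "S (orth_proj M x) \<in> M" using inv[OF S] orth_proj_in[OF M] by blast
    fix z assume "z \<in> M"
    then have "(x - orth_proj M x) \<bullet> adj S z = 0"
      using orth_proj_orth[OF M] inv adj_mem[OF S] by blast
    then show "(S x - S (orth_proj M x)) \<bullet> z = 0"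
      by (simp add: adj_right blinfun.bilinear_simps)
  qed
  then show ?thesis by (intro commutantI) simp
qed

lemma commutant_strong_limit:
  fixes V :: "nat \<Rightarrow> 'h \<Rightarrow>\<^sub>L 'h" and W :: "'h \<Rightarrow>\<^sub>L 'h"
  assumes "\<And>n. V n \<in> \<C>" "\<And>x. (\<lambda>n. V n x) \<longlonglongrightarrow> W x"
  shows "W \<in> \<C>"
proof -
  have "S (W x) = W (S x)" if S: "S \<in> \<S>" for S x
  proof -
    have "(\<lambda>n. S (V n x)) \<longlonglongrightarrow> S (W x)"
      by (intro bounded_linear.tendsto[OF blinfun.bounded_linear_right] assms(2))
    moreover have "S (V n x) = V n (S x)" for n
      using commutantD[OF S assms(1)] .
    ultimately have "(\<lambda>n. V n (S x)) \<longlonglongrightarrow> S (W x)" by simp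
    then show ?thesis by (rule LIMSEQ_unique[OF _ assms(2)])
  qed
  then show ?thesis by (intro commutantI) simp
qed

lemma range_closure_subspace:
  fixes B :: "'h \<Rightarrow>\<^sub>L 'h"
  shows "subspace (closure (range B))"
proof (rule subspace_closure)
  have "linear (blinfun_apply B)" by (rule bounded_linear.linear[OF blinfun.bounded_linear_right])
  then show "subspace (range B)" using linear_subspace_image subspace_UNIV by blast
qed

lemma commutant_range_proj:
  fixes B :: "'h \<Rightarrow>\<^sub>L 'h"
  assumes "B \<in> \<C>"
  shows "orth_proj (closure (range B)) \<in> \<C>"
proof (rule commutant_orth_proj[OF range_closure_subspace closed_closure])
  fix S x assume S: "S \<in> \<S>" and x: "x \<in> closure (range B)"
  have "S (B y) = B (S y)" for y
    using commutantD[OF S assms] .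
  then have "S ` range B \<subseteq> range B" by auto
  then have "S ` closure (range B) \<subseteq> closure (range B)"
    by (intro image_closure_subset linear_continuous_on blinfun.bounded_linear_right
        subset_trans[OF _ closure_subset] closed_closure)
  then show "S x \<in> closure (range B)" using x by blast
qed

lemma orth_proj_range_comp:
  fixes B :: "'h \<Rightarrow>\<^sub>L 'h"
  shows "orth_proj (closure (range B)) o\<^sub>L B = B"
  by (intro blinfun_eqI, simp)
    (rule orth_proj_eqI[OF range_closure_subspace closed_closure],
     auto intro: closure_subset[THEN subsetD])

lemma comp_orth_proj_zero:
  fixes B :: "'h \<Rightarrow>\<^sub>L 'h"
  assumes "A o\<^sub>L B = 0"
  shows "A o\<^sub>L orth_proj (closure (range B)) = 0"
proof -
  have "closure (range B) \<subseteq> {x. A x = 0}"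
    using comp_apply[OF assms]
    by (intro closure_minimal closed_Collect_eq linear_continuous_on blinfun.bounded_linear_right
        continuous_on_const) auto
  then show ?thesis
    using orth_proj_in[OF range_closure_subspace closed_closure, of B] by (intro blinfun_eqI) auto
qed

text \<open>
  \<open>U\<close> sends \<open>|T| x\<close> to \<open>T x\<close> and vanishes on the orthogonal complement of the range of \<open>|T|\<close>. The
  two annihilation properties say that the initial and final spaces of \<open>U\<close> are contained in every
  projection in which those of \<open>T\<close> are contained. In the last estimate the factor \<open>\<parallel>T\<parallel>\<close> can be taken
  because \<open>\<parallel>T x\<parallel> = \<parallel>T U\<^sup>*U x\<parallel>\<close>.
\<close>

lemma polar_decomposition:
  assumes T: "T \<in> \<C>"
  shows "\<exists>U\<in>\<C>. partial_isometry U \<and> (\<forall>A :: 'h \<Rightarrow>\<^sub>L 'h. T o\<^sub>L A = 0 \<longrightarrow> U o\<^sub>L A = 0) \<and>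
    (\<forall>A :: 'h \<Rightarrow>\<^sub>L 'h. A o\<^sub>L T = 0 \<longrightarrow> A o\<^sub>L U = 0) \<and> (\<forall>x. norm (T x) \<le> norm T * norm (U x))"
proof -
  obtain B where B: "adj B = B" "B o\<^sub>L B = adj T o\<^sub>L T"
    and Bc: "\<And>S. S o\<^sub>L (adj T o\<^sub>L T) = (adj T o\<^sub>L T) o\<^sub>L S \<Longrightarrow> S o\<^sub>L B = B o\<^sub>L S"
    using abs_op_exists[of T] by blast
  have BC: "B \<in> \<C>"
    using Bc commutant_alg(7)[OF commutant_adj[OF T] T] unfolding op_commutant_def by blast
  have nTB: "norm (T x) = norm (B x)" for x
  proof -
    have "(norm (T x))\<^sup>2 = (B o\<^sub>L B) x \<bullet> x" using norm_adj_comp[of T x] B by simp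
    also have "\<dots> = (norm (B x))\<^sup>2" using norm_adj_comp[of B x] B by simp
    finally show ?thesis by simp
  qed
  define P where "P = orth_proj (closure (range B))"
  have P: "proj_op P" "P \<in> \<C>" "P o\<^sub>L B = B"
    using proj_op_orth_proj[OF range_closure_subspace closed_closure] commutant_range_proj[OF BC]
      orth_proj_range_comp by (auto simp: P_def)
  have "adj (P o\<^sub>L B) = B" using P(3) B by simp
  then have BP: "B o\<^sub>L P = B" using P(1) B by (simp add: proj_op_def)
  obtain U where U: "U o\<^sub>L B = T" "U o\<^sub>L P = U" "adj U o\<^sub>L U = P"
    using isometric_transfer[OF nTB] unfolding P_def by metis
  have pi: "partial_isometry U" using U(3) P(1) by (simp add: partial_isometry_def)
  have nUP: "norm (U x) = norm (P x)" for x using partial_isometry_norm[OF pi] U(3) by simp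
  have "U \<in> \<C>"
  proof -
    have "S o\<^sub>L U = U o\<^sub>L S" if S: "S \<in> \<S>" for S
    proof -
      have c: "S o\<^sub>L T = T o\<^sub>L S" "S o\<^sub>L B = B o\<^sub>L S" "S o\<^sub>L P = P o\<^sub>L S"
        using S T BC P(2) unfolding op_commutant_def by blast+
      have "((S o\<^sub>L U) - (U o\<^sub>L S)) o\<^sub>L B = 0"
        using c(1,2) U(1) comp_assoc[of U B S] by (simp add: comp_algebra comp_assoc)
      then have "((S o\<^sub>L U) - (U o\<^sub>L S)) o\<^sub>L P = 0" unfolding P_def by (rule comp_orth_proj_zero)
      then have "S o\<^sub>L (U o\<^sub>L P) = U o\<^sub>L (S o\<^sub>L P)" by (simp add: comp_algebra comp_assoc)
      then have "S o\<^sub>L (U o\<^sub>L P) = (U o\<^sub>L P) o\<^sub>L S" using c(3) by (simp add: comp_assoc)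
      then show ?thesis by (simp only: U(2))
    qed
    then show ?thesis unfolding op_commutant_def by blast
  qed
  moreover have "U o\<^sub>L A = 0" if "T o\<^sub>L A = 0" for A :: "'h \<Rightarrow>\<^sub>L 'h"
  proof (rule blinfun_eqI)
    fix x
    have "B (A x) = 0" using comp_apply[OF that, of x] nTB[of "A x"] by simp
    have "P (A x) = 0" unfolding P_def
    proof (rule orth_proj_eqI[OF range_closure_subspace closed_closure])
      show "0 \<in> closure (range B)" using range_closure_subspace subspace_0 by blast
      have "closure (range B) \<subseteq> {z. A x \<bullet> z = 0}"
      proof (rule closure_minimal)
        show "range B \<subseteq> {z. A x \<bullet> z = 0}"
          using adj_left[of B "A x"] B(1) \<open>B (A x) = 0\<close> by auto
        show "closed {z. A x \<bullet> z = 0}"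
          by (intro closed_Collect_eq continuous_intros)
      qed
      then show "z \<in> closure (range B) \<Longrightarrow> (A x - 0) \<bullet> z = 0" for z by auto
    qed
    then show "(U o\<^sub>L A) x = blinfun_apply 0 x" using nUP[of "A x"] by simp
  qed
  moreover have "A o\<^sub>L U = 0" if "A o\<^sub>L T = 0" for A :: "'h \<Rightarrow>\<^sub>L 'h"
  proof -
    have "(A o\<^sub>L U) o\<^sub>L B = 0" using that U(1) by (simp add: comp_assoc)
    then have "(A o\<^sub>L U) o\<^sub>L P = 0" unfolding P_def by (rule comp_orth_proj_zero)
    then show ?thesis using U(2) by (simp add: comp_assoc)
  qed
  moreover have "norm (T x) \<le> norm T * norm (U x)" for x
  proof -
    have "norm (T x) = norm (T (P x))" using nTB BP by (metis blinfun_apply_blinfun_compose)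
    also have "\<dots> \<le> norm T * norm (P x)" by (rule norm_blinfun)
    finally show ?thesis by (simp add: nUP)
  qed
  ultimately show ?thesis using pi by blast
qed

text \<open>
  For each real \<open>t\<close> the positive and negative parts of \<open>x - t e\<close> have orthogonal ranges
  inside \<open>e\<close>. By minimality one of them vanishes, so \<open>x\<close> is comparable with every \<open>t e\<close>, and
  \<open>x = t e\<close> for the value \<open>t\<close> of the quadratic form of \<open>x\<close> at a unit vector of \<open>e\<close>.
\<close>

lemma minimal_projection_scalar:
  assumes e: "e \<in> \<C>" "proj_op e" "e \<noteq> 0"
    and min: "\<And>P. P \<in> \<C> \<Longrightarrow> proj_op P \<Longrightarrow> e o\<^sub>L P = P \<Longrightarrow> P \<noteq> 0 \<Longrightarrow> P = e"
    and x: "x \<in> \<C>" "adj x = x" "e o\<^sub>L x = x"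
  shows "\<exists>t. x = t *\<^sub>R e"
proof -
  have ee: "e o\<^sub>L e = e" "adj e = e" using e by (auto simp: proj_op_def)
  have dich: "(\<forall>f. x f \<bullet> f \<ge> t * (e f \<bullet> f)) \<or> (\<forall>f. x f \<bullet> f \<le> t * (e f \<bullet> f))" for t
  proof -
    define y where "y = x - t *\<^sub>R e"
    have y: "y \<in> \<C>" "adj y = y" "e o\<^sub>L y = y"
      using x e ee by (auto simp: y_def commutant_alg comp_algebra)
    obtain B where B: "adj B = B" "\<And>f. B f \<bullet> f \<ge> 0" "B o\<^sub>L B = y o\<^sub>L y"
      and Bc: "\<And>S. S o\<^sub>L (y o\<^sub>L y) = (y o\<^sub>L y) o\<^sub>L S \<Longrightarrow> S o\<^sub>L B = B o\<^sub>L S"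
      using abs_op_exists[of y] unfolding y(2) by blast
    have BC: "B \<in> \<C>"
      using Bc commutant_alg(7)[OF y(1) y(1)] unfolding op_commutant_def by blast
    have By: "y o\<^sub>L B = B o\<^sub>L y" by (rule Bc) (simp add: comp_assoc)
    have "adj (e o\<^sub>L y) = adj y" using y(3) by (rule arg_cong)
    then have ye: "y o\<^sub>L e = y" by (simp add: ee(2) y(2))
    have "B (f - e f) = 0" for f
    proof -
      have "(norm (B (f - e f)))\<^sup>2 = (y o\<^sub>L y) (f - e f) \<bullet> (f - e f)"
        using norm_adj_comp[of B "f - e f"] B by simp
      also have "y (f - e f) = 0" using comp_apply[OF ye] by (simp add: blinfun.bilinear_simps)
      then have "(y o\<^sub>L y) (f - e f) \<bullet> (f - e f) = 0" by simp
      finally show ?thesis by simp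
    qed
    then have Be: "B o\<^sub>L e = B" by (intro blinfun_eqI) (simp add: blinfun.bilinear_simps)
    have "adj (B o\<^sub>L e) = adj B" using Be by (rule arg_cong)
    then have eB: "e o\<^sub>L B = B" by (simp add: B(1) ee(2))
    \<comment> \<open>\<open>B = |y|\<close>, so \<open>B + y\<close> and \<open>B - y\<close> are twice the positive and the negative part of \<open>y\<close>.\<close>
    have prod: "(B - y) o\<^sub>L (B + y) = 0" using By B(3) by (simp add: comp_algebra)
    show ?thesis
    proof (cases "B + y = 0")
      case True
      have "y f \<bullet> f \<le> 0" for f
        using B(2)[of f] arg_cong[OF True, of "\<lambda>T. T f \<bullet> f"]
        by (simp add: blinfun.bilinear_simps inner_simps)
      then show ?thesis by (simp add: y_def blinfun.bilinear_simps inner_simps)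
    next
      case False
      define P where "P = orth_proj (closure (range (B + y)))"
      have "e o\<^sub>L P = P"
      proof -
        have "(id_blinfun - e) o\<^sub>L (B + y) = 0" using eB y by (simp add: comp_algebra)
        from comp_orth_proj_zero[OF this] show ?thesis by (simp add: P_def comp_algebra)
      qed
      moreover have "P \<noteq> 0" using orth_proj_range_comp[of "B + y"] False by (auto simp: P_def)
      moreover have "P \<in> \<C>" unfolding P_def by (intro commutant_range_proj commutant_alg BC y)
      moreover have "proj_op P" unfolding P_def
        by (rule proj_op_orth_proj[OF range_closure_subspace closed_closure])
      ultimately have "P = e" using min by blast
      then have "(B - y) o\<^sub>L e = 0" using comp_orth_proj_zero[OF prod] by (simp add: P_def)
      then have "B = y" using Be ye by (simp add: comp_algebra)
      then show ?thesis using B(2) by (simp add: y_def blinfun.bilinear_simps inner_simps)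
    qed
  qed
  obtain f where f: "e f \<noteq> 0" using e(3) by (metis blinfun_eqI zero_blinfun.rep_eq)
  define g where "g = e f /\<^sub>R norm (e f)"
  have "norm g = 1" using f by (simp add: g_def)
  have "e g = g" using proj_op_inner(3)[OF e(2)] by (simp add: g_def blinfun.bilinear_simps)
  then have g: "e g \<bullet> g = 1" using \<open>norm g = 1\<close> by (simp add: power2_norm_eq_inner[symmetric])
  define t where "t = x g \<bullet> g"
  have pos: "e h \<bullet> h \<ge> 0" for h using proj_op_inner(2)[OF e(2)] by simp
  have "x h \<bullet> h = t * (e h \<bullet> h)" for h
  proof (rule antisym)
    have "x h \<bullet> h \<le> s * (e h \<bullet> h)" if "s > t" for s
    proof -
      have "\<not> (x g \<bullet> g \<ge> s * (e g \<bullet> g))" using that g by (simp add: t_def)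
      then show ?thesis using dich[of s] by blast
    qed
    then have *: "x h \<bullet> h \<le> (t + d) * (e h \<bullet> h)" if "d > 0" for d using that by simp
    show "x h \<bullet> h \<le> t * (e h \<bullet> h)"
    proof (rule field_le_epsilon)
      fix d :: real assume d: "d > 0"
      have "d / (e h \<bullet> h + 1) > 0" using d pos[of h] by simp
      from *[OF this] have "x h \<bullet> h \<le> t * (e h \<bullet> h) + d * (e h \<bullet> h / (e h \<bullet> h + 1))"
        by (simp add: algebra_simps)
      also have "d * (e h \<bullet> h / (e h \<bullet> h + 1)) \<le> d * 1"
        using d pos[of h] by (intro mult_left_mono) auto
      finally show "x h \<bullet> h \<le> t * (e h \<bullet> h) + d" by simp
    qed
    have "x h \<bullet> h \<ge> s * (e h \<bullet> h)" if "s < t" for s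
    proof -
      have "\<not> (x g \<bullet> g \<le> s * (e g \<bullet> g))" using that g by (simp add: t_def)
      then show ?thesis using dich[of s] by blast
    qed
    then have *: "x h \<bullet> h \<ge> (t - d) * (e h \<bullet> h)" if "d > 0" for d using that by simp
    show "t * (e h \<bullet> h) \<le> x h \<bullet> h"
    proof (rule field_le_epsilon)
      fix d :: real assume d: "d > 0"
      have "d / (e h \<bullet> h + 1) > 0" using d pos[of h] by simp
      from *[OF this] have "t * (e h \<bullet> h) \<le> x h \<bullet> h + d * (e h \<bullet> h / (e h \<bullet> h + 1))"
        by (simp add: algebra_simps)
      also have "d * (e h \<bullet> h / (e h \<bullet> h + 1)) \<le> d * 1"
        using d pos[of h] by (intro mult_left_mono) auto
      finally show "t * (e h \<bullet> h) \<le> x h \<bullet> h + d" by simp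
    qed
  qed
  then have q: "x h \<bullet> h = (t *\<^sub>R e) h \<bullet> h" for h by (simp add: blinfun.scaleR_left)
  have "adj (t *\<^sub>R e) = t *\<^sub>R e" using ee(2) by simp
  with x(2) have "x = t *\<^sub>R e" using q by (rule sa_eqI)
  then show ?thesis by blast
qed

end

section \<open>Square-summable functions as a Hilbert space\<close>

lemma ell2_add:
  assumes "f \<in> ell2 I" "g \<in> ell2 I"
  shows "(\<lambda>x. f x + g x) \<in> ell2 I"
proof -
  have "(\<lambda>x. 2 * (cmod (f x))\<^sup>2 + 2 * (cmod (g x))\<^sup>2) summable_on UNIV"
    using assms by (intro summable_on_add summable_on_cmult_right) (auto simp: ell2_def)
  moreover have "(cmod (f x + g x))\<^sup>2 \<le> 2 * (cmod (f x))\<^sup>2 + 2 * (cmod (g x))\<^sup>2" for x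
  proof -
    have "(cmod (f x + g x))\<^sup>2 \<le> (cmod (f x) + cmod (g x))\<^sup>2"
      by (intro power_mono norm_triangle_ineq) auto
    also have "\<dots> \<le> 2 * (cmod (f x))\<^sup>2 + 2 * (cmod (g x))\<^sup>2"
      using sum_squares_bound[of "cmod (f x)" "cmod (g x)"] by (simp add: power2_sum)
    finally show ?thesis by simp
  qed
  ultimately have "(\<lambda>x. (cmod (f x + g x))\<^sup>2) summable_on UNIV"
    by (rule summable_on_comparison_test) auto
  then show ?thesis using assms by (simp add: ell2_def)
qed

lemma ell2_scale:
  assumes "f \<in> ell2 I"
  shows "(\<lambda>x. c * f x) \<in> ell2 I"
  using assms by (auto simp: ell2_def norm_mult power_mult_distrib intro: summable_on_cmult_right)

lemma ell2_zero: "(\<lambda>x. 0) \<in> ell2 I"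
  by (simp add: ell2_def)

lemma ell2_prod_summable:
  assumes "f \<in> ell2 I" "g \<in> ell2 I'"
  shows "(\<lambda>x. f x * cnj (g x)) summable_on UNIV"
proof (rule abs_summable_summable, rule summable_on_comparison_test)
  show "(\<lambda>x. (cmod (f x))\<^sup>2 + (cmod (g x))\<^sup>2) summable_on UNIV"
    using assms by (intro summable_on_add) (auto simp: ell2_def)
  show "norm (f x * cnj (g x)) \<le> (cmod (f x))\<^sup>2 + (cmod (g x))\<^sup>2" for x
  proof -
    have "cmod (f x) * cmod (g x) \<le> 2 * cmod (f x) * cmod (g x)" by simp
    also have "\<dots> \<le> (cmod (f x))\<^sup>2 + (cmod (g x))\<^sup>2" by (rule sum_squares_bound)
    finally show ?thesis by (simp add: norm_mult)
  qed
qed auto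

text \<open>
  The square-summable functions on the whole type; those on a subset appear as the range of a
  projection (see \<open>restr\<close> below).
\<close>

typedef 'a l2 = "ell2 UNIV :: ('a \<Rightarrow> complex) set" morphisms coord Abs_l2
  using ell2_zero by blast

setup_lifting type_definition_l2

lemma coord_ell2 [simp]: "coord f \<in> ell2 UNIV"
  using coord by blast

lemma l2_eqI: "(\<And>x. coord f x = coord g x) \<Longrightarrow> f = g"
  by (simp add: coord_inject[symmetric] ext)

lemma ell2_inner_self:
  assumes "f \<in> ell2 I"
  shows "ell2_inner f f = complex_of_real (\<Sum>\<^sub>\<infinity>x. (cmod (f x))\<^sup>2)"
  unfolding ell2_inner_def complex_norm_square[symmetric]
  using assms by (intro infsumI has_sum_of_real has_sum_infsum) (simp add: ell2_def)

instantiation l2 :: (type) real_vector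
begin

lift_definition zero_l2 :: "'a l2" is "\<lambda>x. 0" by (rule ell2_zero)
lift_definition plus_l2 :: "'a l2 \<Rightarrow> 'a l2 \<Rightarrow> 'a l2" is "\<lambda>f g x. f x + g x" by (rule ell2_add)
lift_definition uminus_l2 :: "'a l2 \<Rightarrow> 'a l2" is "\<lambda>f x. - f x"
  using ell2_scale[of _ UNIV "-1"] by simp
lift_definition minus_l2 :: "'a l2 \<Rightarrow> 'a l2 \<Rightarrow> 'a l2" is "\<lambda>f g x. f x - g x"
  using ell2_add[OF _ ell2_scale[of _ UNIV "-1"]] by simp
lift_definition scaleR_l2 :: "real \<Rightarrow> 'a l2 \<Rightarrow> 'a l2" is "\<lambda>r f x. complex_of_real r * f x"
  by (rule ell2_scale)
instance
proof
  fix f g h :: "'a l2" and r s :: real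
  show "f + g + h = f + (g + h)" "f + g = g + f" "0 + f = f" "- f + f = 0" "f - g = f + - g"
    "r *\<^sub>R (f + g) = r *\<^sub>R f + r *\<^sub>R g" "(r + s) *\<^sub>R f = r *\<^sub>R f + s *\<^sub>R f"
    "r *\<^sub>R s *\<^sub>R f = (r * s) *\<^sub>R f" "1 *\<^sub>R f = f"
    by (transfer; simp add: algebra_simps)+
qed

end

instantiation l2 :: (type) real_inner
begin

definition inner_l2 :: "'a l2 \<Rightarrow> 'a l2 \<Rightarrow> real" where
  "inner_l2 f g = Re (ell2_inner (coord f) (coord g))"
definition norm_l2 :: "'a l2 \<Rightarrow> real" where
  "norm_l2 f = ell2_norm (coord f)"
definition sgn_l2 :: "'a l2 \<Rightarrow> 'a l2" where
  "sgn_l2 f = f /\<^sub>R norm f"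
definition dist_l2 :: "'a l2 \<Rightarrow> 'a l2 \<Rightarrow> real" where
  "dist_l2 f g = norm (f - g)"
definition uniformity_l2 :: "('a l2 \<times> 'a l2) filter" where
  "uniformity_l2 = (INF e\<in>{0<..}. principal {(x, y). dist x y < e})"
definition open_l2 :: "'a l2 set \<Rightarrow> bool" where
  "open_l2 U = (\<forall>x\<in>U. \<forall>\<^sub>F (x', y) in uniformity. x' = x \<longrightarrow> y \<in> U)"

instance
proof
  fix f g h :: "'a l2" and r s :: real
  show "inner f g = inner g f"
  proof -
    have "ell2_inner (coord f) (coord g) = cnj (ell2_inner (coord g) (coord f))"
      by (simp add: ell2_inner_def mult.commute flip: infsum_cnj)
    then show ?thesis by (simp add: inner_l2_def)
  qed
  show "inner (f + g) h = inner f h + inner g h"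
    by (simp add: inner_l2_def ell2_inner_def plus_l2.rep_eq distrib_right
        infsum_add ell2_prod_summable[of _ UNIV _ UNIV])
  show "inner (r *\<^sub>R f) g = r * inner f g"
    by (simp add: inner_l2_def ell2_inner_def scaleR_l2.rep_eq mult.assoc
        infsum_cmult_right ell2_prod_summable[of _ UNIV _ UNIV])
  show "0 \<le> inner f f"
    by (simp add: inner_l2_def ell2_inner_self[OF coord_ell2] infsum_nonneg)
  show "inner f f = 0 \<longleftrightarrow> f = 0"
  proof
    assume "inner f f = 0"
    then have "(\<Sum>\<^sub>\<infinity>x. (cmod (coord f x))\<^sup>2) = 0"
      by (simp add: inner_l2_def ell2_inner_self[OF coord_ell2])
    then have "(cmod (coord f x))\<^sup>2 = 0" for x
      using coord[of f] by (intro nonneg_infsum_le_0D[where A = UNIV and f = "\<lambda>x. (cmod (coord f x))\<^sup>2"])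
        (auto simp: ell2_def)
    then show "f = 0" by (intro l2_eqI) (simp add: zero_l2.rep_eq)
  qed (simp add: inner_l2_def ell2_inner_def zero_l2.rep_eq)
  show "norm f = sqrt (inner f f)"
    by (simp add: inner_l2_def ell2_inner_self[OF coord_ell2] norm_l2_def ell2_norm_def)
qed (rule sgn_l2_def dist_l2_def uniformity_l2_def open_l2_def)+

end

lemma norm_l2_sq: "(norm f)\<^sup>2 = (\<Sum>\<^sub>\<infinity>x. (cmod (coord f x))\<^sup>2)"
  by (simp add: norm_l2_def ell2_norm_def infsum_nonneg)

lemma norm_l2_has_sum: "((\<lambda>x. (cmod (coord f x))\<^sup>2) has_sum (norm f)\<^sup>2) UNIV"
  using coord[of f] by (simp add: norm_l2_sq ell2_def)

lemma norm_l2_finite_sum_le: "finite F \<Longrightarrow> (\<Sum>x\<in>F. (cmod (coord f x))\<^sup>2) \<le> (norm f)\<^sup>2"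
  by (rule finite_sum_le_has_sum[OF norm_l2_has_sum]) auto

lemma norm_coord_le: "cmod (coord f x) \<le> norm f"
  using norm_l2_finite_sum_le[of "{x}" f] by (auto intro: power2_le_imp_le)

lemma ell2_of_bounded_sums:
  assumes "\<And>F. finite F \<Longrightarrow> (\<Sum>x\<in>F. (cmod (f x))\<^sup>2) \<le> B" and "\<And>x. x \<notin> I \<Longrightarrow> f x = 0"
  shows "f \<in> ell2 I" "(ell2_norm f)\<^sup>2 \<le> B"
proof -
  have s: "(\<lambda>x. (cmod (f x))\<^sup>2) summable_on UNIV"
    by (rule nonneg_bdd_above_summable_on) (auto intro!: bdd_aboveI2 assms)
  then show "f \<in> ell2 I" using assms by (simp add: ell2_def)
  have "(\<Sum>\<^sub>\<infinity>x. (cmod (f x))\<^sup>2) \<le> B"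
    by (rule infsum_le_finite_sums[OF s]) (auto intro: assms)
  then show "(ell2_norm f)\<^sup>2 \<le> B" by (simp add: ell2_norm_def infsum_nonneg)
qed

instance l2 :: (type) banach
proof
  fix X :: "nat \<Rightarrow> 'a l2" assume X: "Cauchy X"
  have "Cauchy (\<lambda>n. coord (X n) x)" for x
  proof (rule metric_CauchyI)
    fix e :: real assume e: "e > 0"
    obtain M where M: "\<And>m n. m \<ge> M \<Longrightarrow> n \<ge> M \<Longrightarrow> dist (X m) (X n) < e"
      using metric_CauchyD[OF X e] by blast
    have "dist (coord (X m) x) (coord (X n) x) \<le> dist (X m) (X n)" for m n
      using norm_coord_le[of "X m - X n" x] by (simp add: dist_norm minus_l2.rep_eq)
    with M show "\<exists>M. \<forall>m\<ge>M. \<forall>n\<ge>M. dist (coord (X m) x) (coord (X n) x) < e"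
      by (meson le_less_trans)
  qed
  then obtain w where w: "\<And>x. (\<lambda>n. coord (X n) x) \<longlonglongrightarrow> w x"
    unfolding Cauchy_convergent_iff convergent_def by metis
  have key: "\<exists>M. \<forall>n\<ge>M. (\<lambda>x. coord (X n) x - w x) \<in> ell2 UNIV \<and> (ell2_norm (\<lambda>x. coord (X n) x - w x))\<^sup>2 \<le> e\<^sup>2"
    if e: "e > 0" for e
  proof -
    obtain M where M: "\<And>m n. m \<ge> M \<Longrightarrow> n \<ge> M \<Longrightarrow> dist (X m) (X n) < e"
      using metric_CauchyD[OF X e] by blast
    have "(\<Sum>x\<in>F. (cmod (coord (X n) x - w x))\<^sup>2) \<le> e\<^sup>2" if n: "n \<ge> M" and F: "finite F" for n F
    proof (rule LIMSEQ_le_const2)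
      show "(\<lambda>m. \<Sum>x\<in>F. (cmod (coord (X n) x - coord (X m) x))\<^sup>2) \<longlonglongrightarrow> (\<Sum>x\<in>F. (cmod (coord (X n) x - w x))\<^sup>2)"
        by (intro tendsto_intros w)
      have "(\<Sum>x\<in>F. (cmod (coord (X n) x - coord (X m) x))\<^sup>2) \<le> e\<^sup>2" if "m \<ge> M" for m
      proof -
        have "(\<Sum>x\<in>F. (cmod (coord (X n) x - coord (X m) x))\<^sup>2) \<le> (norm (X n - X m))\<^sup>2"
          using norm_l2_finite_sum_le[OF F, of "X n - X m"] by (simp add: minus_l2.rep_eq)
        also have "\<dots> \<le> e\<^sup>2" using M[OF n that] by (intro power_mono) (auto simp: dist_norm)
        finally show ?thesis .
      qed
      then show "\<exists>N. \<forall>m\<ge>N. (\<Sum>x\<in>F. (cmod (coord (X n) x - coord (X m) x))\<^sup>2) \<le> e\<^sup>2" by blast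
    qed
    then show ?thesis
      using ell2_of_bounded_sums[of "\<lambda>x. coord (X _) x - w x" "e\<^sup>2" UNIV] by blast
  qed
  obtain n0 where n0: "(\<lambda>x. coord (X n0) x - w x) \<in> ell2 UNIV" using key[of 1] by auto
  have "(\<lambda>x. coord (X n0) x + (-1) * (coord (X n0) x - w x)) \<in> ell2 UNIV"
    by (rule ell2_add[OF coord_ell2 ell2_scale[OF n0]])
  then have wl: "w \<in> ell2 UNIV" by simp
  have "X \<longlonglongrightarrow> Abs_l2 w"
  proof (rule metric_LIMSEQ_I)
    fix e :: real assume e: "e > 0"
    obtain M where M: "\<And>n. n \<ge> M \<Longrightarrow> (ell2_norm (\<lambda>x. coord (X n) x - w x))\<^sup>2 \<le> (e/2)\<^sup>2"
      using key[of "e/2"] e by auto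
    have "dist (X n) (Abs_l2 w) < e" if "n \<ge> M" for n
    proof -
      have "dist (X n) (Abs_l2 w) = ell2_norm (\<lambda>x. coord (X n) x - w x)"
        by (simp add: dist_norm norm_l2_def minus_l2.rep_eq Abs_l2_inverse[OF wl])
      also have "\<dots> \<le> e/2" using e by (intro power2_le_imp_le[OF M[OF that]]) simp
      finally show ?thesis using e by simp
    qed
    then show "\<exists>M. \<forall>n\<ge>M. dist (X n) (Abs_l2 w) < e" by blast
  qed
  then show "convergent X" by (auto simp: convergent_def)
qed

section \<open>Complex structure\<close>

lift_definition scaleC :: "complex \<Rightarrow> 'a l2 \<Rightarrow> 'a l2" is "\<lambda>c f x. c * f x" by (rule ell2_scale)

definition cinner :: "'a l2 \<Rightarrow> 'a l2 \<Rightarrow> complex" where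
  "cinner f g = ell2_inner (coord f) (coord g)"

lift_definition basis :: "'a \<Rightarrow> 'a l2" is ell2_delta by (rule ell2_delta_mem) simp

lemma norm_scaleC: "norm (scaleC c f) = cmod c * norm f"
proof -
  have "(\<Sum>\<^sub>\<infinity>x. (cmod c)\<^sup>2 * (cmod (coord f x))\<^sup>2) = (cmod c)\<^sup>2 * (norm f)\<^sup>2"
    unfolding norm_l2_sq by (rule infsum_cmult_right')
  then have "(norm (scaleC c f))\<^sup>2 = (cmod c * norm f)\<^sup>2"
    by (simp add: norm_l2_sq[of "scaleC c f"] scaleC.rep_eq norm_mult power_mult_distrib)
  then show ?thesis by (simp add: power2_eq_iff_nonneg)
qed

lemma bounded_linear_scaleC: "bounded_linear (scaleC c)"
proof (rule bounded_linear_intro[where K = "cmod c"])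
  show "scaleC c (f + g) = scaleC c f + scaleC c g" for f g :: "'a l2"
    by transfer (simp add: algebra_simps)
  show "scaleC c (r *\<^sub>R f) = r *\<^sub>R scaleC c f" for r and f :: "'a l2"
    by transfer (simp add: algebra_simps)
qed (simp add: norm_scaleC mult.commute)

definition mult_i :: "'a l2 \<Rightarrow>\<^sub>L 'a l2" where
  "mult_i = Blinfun (scaleC \<i>)"

lemma mult_i_apply [simp]: "mult_i f = scaleC \<i> f"
  by (simp add: mult_i_def bounded_linear_Blinfun_apply bounded_linear_scaleC)

lemma scaleC_alt: "scaleC c f = Re c *\<^sub>R f + Im c *\<^sub>R scaleC \<i> f"
  by (rule l2_eqI) (simp add: scaleC.rep_eq plus_l2.rep_eq scaleR_l2.rep_eq complex_eq_iff algebra_simps)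

lemma Re_cinner: "Re (cinner f g) = f \<bullet> g"
  by (simp add: cinner_def inner_l2_def)

lemma cinner_scaleC_left: "cinner (scaleC c f) g = c * cinner f g"
  by (simp add: cinner_def ell2_inner_def scaleC.rep_eq mult.assoc infsum_cmult_right')

lemma cinner_cnj: "cinner f g = cnj (cinner g f)"
  by (simp add: cinner_def ell2_inner_def mult.commute flip: infsum_cnj)

lemma cinner_scaleC_right: "cinner f (scaleC c g) = cnj c * cinner f g"
  using cinner_cnj[of f "scaleC c g"] cinner_cnj[of f g] by (simp add: cinner_scaleC_left)

lemma Im_cinner: "Im (cinner f g) = f \<bullet> scaleC \<i> g"
  by (simp add: cinner_scaleC_right flip: Re_cinner)

lemma cinner_add_left: "cinner (f + g) h = cinner f h + cinner g h"
  by (simp add: complex_eq_iff Re_cinner Im_cinner inner_simps)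

lemma cinner_self: "cinner f f = complex_of_real ((norm f)\<^sup>2)"
  by (simp add: cinner_def ell2_inner_self[OF coord_ell2] norm_l2_sq)

lemma cinner_basis_right: "cinner f (basis a) = coord f a"
proof -
  have "(\<Sum>\<^sub>\<infinity>x. coord f x * cnj (if x = a then 1 else 0)) = (\<Sum>\<^sub>\<infinity>x\<in>{a}. coord f x)"
    by (rule infsum_cong_neutral) auto
  then show ?thesis by (simp add: cinner_def ell2_inner_def basis.rep_eq ell2_delta_def)
qed

lemma coord_basis: "coord (basis a) x = (if x = a then 1 else 0)"
  by (simp add: basis.rep_eq ell2_delta_def)

lemma norm_basis [simp]: "norm (basis a) = 1"
proof -
  have "complex_of_real ((norm (basis a))\<^sup>2) = 1"
    using cinner_self[of "basis a"] by (simp only: cinner_basis_right coord_basis) simp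
  then have "(norm (basis a))\<^sup>2 = 1" by (simp only: of_real_eq_1_iff)
  then show ?thesis
    using power2_eq_1_iff[of "norm (basis a)"] norm_ge_zero[of "basis a"] by linarith
qed

lemma inner_basis: "f \<bullet> basis a = Re (coord f a)"
  by (simp only: Re_cinner[symmetric] cinner_basis_right)

lemma adj_mult_i: "adj mult_i = - mult_i"
proof (rule adj_eqI)
  fix f g :: "'a l2"
  have "mult_i f \<bullet> g = Re (\<i> * cinner f g)" by (simp add: Re_cinner[symmetric] cinner_scaleC_left)
  also have "\<dots> = - (f \<bullet> scaleC \<i> g)" by (simp flip: Im_cinner)
  finally show "mult_i f \<bullet> g = f \<bullet> blinfun_apply (- mult_i) g" by (simp add: blinfun.minus_left)
qed

definition clinear_op :: "('a l2 \<Rightarrow>\<^sub>L 'a l2) \<Rightarrow> bool" where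
  "clinear_op T \<longleftrightarrow> (\<forall>f. T (scaleC \<i> f) = scaleC \<i> (T f))"

lemma clinear_op_scaleC:
  assumes "clinear_op T"
  shows "T (scaleC c f) = scaleC c (T f)"
proof -
  have i: "T (scaleC \<i> f) = scaleC \<i> (T f)" using assms by (simp add: clinear_op_def)
  show ?thesis
    unfolding scaleC_alt[of c f] scaleC_alt[of c "T f"] blinfun.add_right blinfun.scaleR_right i ..
qed

lemma cinner_adj_right:
  assumes "clinear_op T"
  shows "cinner (T f) g = cinner f (adj T g)"
proof (rule complex_eqI)
  show "Re (cinner (T f) g) = Re (cinner f (adj T g))"
    unfolding Re_cinner by (rule adj_right[symmetric])
  have "T f \<bullet> scaleC \<i> g = - (scaleC \<i> (T f) \<bullet> g)"
    using adj_right[of "T f" mult_i g] by (simp add: adj_mult_i blinfun.minus_left)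
  also have "\<dots> = - (T (scaleC \<i> f) \<bullet> g)" using assms by (simp add: clinear_op_def)
  also have "\<dots> = - (scaleC \<i> f \<bullet> adj T g)" by (simp add: adj_right)
  also have "\<dots> = f \<bullet> scaleC \<i> (adj T g)"
    using adj_right[of f mult_i "adj T g"] by (simp add: adj_mult_i blinfun.minus_left)
  finally show "Im (cinner (T f) g) = Im (cinner f (adj T g))" by (simp add: Im_cinner)
qed

text \<open>
  The coordinates of \<open>T\<^sup>* g\<close> are the inner products of \<open>g\<close> with the vectors \<open>T \<delta>\<^sub>a\<close>, so \<open>T\<^sup>* = 0\<close>.
\<close>

lemma clinear_op_zeroI:
  assumes "clinear_op T" "\<And>a. T (basis a) = 0"
  shows "T = 0"
proof (rule blinfun_eqI)
  fix f
  have "adj T g = 0" for g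
  proof (rule l2_eqI)
    fix a
    have "coord (adj T g) a = cnj (cinner (basis a) (adj T g))"
      using cinner_cnj[of "basis a" "adj T g"] cinner_basis_right[of "adj T g" a] by simp
    also have "\<dots> = cnj (cinner (T (basis a)) g)" by (simp add: cinner_adj_right[OF assms(1)])
    also have "\<dots> = 0" by (simp add: assms(2) cinner_def ell2_inner_def zero_l2.rep_eq)
    finally show "coord (adj T g) a = coord 0 a" by (simp add: zero_l2.rep_eq)
  qed
  then have "T f \<bullet> T f = 0" using adj_right[of f T "T f"] by simp
  then show "T f = blinfun_apply 0 f" by simp
qed

lemma clinear_op_eqI:
  assumes "clinear_op S" "clinear_op T" "\<And>a. S (basis a) = T (basis a)"
  shows "S = T"
proof -
  have "S - T = 0"
    using assms by (intro clinear_op_zeroI)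
      (auto simp: clinear_op_def blinfun.bilinear_simps linear_diff[OF bounded_linear.linear[OF bounded_linear_scaleC]])
  then show ?thesis by simp
qed

section \<open>Composition operators\<close>

lemma infsum_support:
  assumes "bij_betw \<phi> S T"
  shows "(\<Sum>\<^sub>\<infinity>x. if x \<in> S then k (\<phi> x) else 0) = (\<Sum>\<^sub>\<infinity>y. if y \<in> T then k y else (0::'b::{t2_space,comm_monoid_add}))"
proof -
  have "(\<Sum>\<^sub>\<infinity>x. if x \<in> S then k (\<phi> x) else 0) = (\<Sum>\<^sub>\<infinity>x\<in>S. k (\<phi> x))"
    by (rule infsum_cong_neutral) auto
  also have "\<dots> = (\<Sum>\<^sub>\<infinity>y\<in>T. k y)" by (rule infsum_reindex_bij_betw[OF assms])
  also have "\<dots> = (\<Sum>\<^sub>\<infinity>y. if y \<in> T then k y else 0)"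
    by (rule infsum_cong_neutral) auto
  finally show ?thesis .
qed

lemma comp_ell2:
  assumes "inj_on \<phi> S" "f \<in> ell2 UNIV"
  shows "(\<lambda>x. if x \<in> S then f (\<phi> x) else 0) \<in> ell2 UNIV"
    "(ell2_norm (\<lambda>x. if x \<in> S then f (\<phi> x) else 0))\<^sup>2 \<le> (ell2_norm f)\<^sup>2"
proof -
  define F where "F = Abs_l2 f"
  have F: "coord F = f" using assms(2) by (simp add: F_def Abs_l2_inverse)
  have "(\<Sum>x\<in>A. (cmod (if x \<in> S then f (\<phi> x) else 0))\<^sup>2) \<le> (norm F)\<^sup>2" if A: "finite A" for A
  proof -
    have "(\<Sum>x\<in>A. (cmod (if x \<in> S then f (\<phi> x) else 0))\<^sup>2) = (\<Sum>x\<in>A \<inter> S. (cmod (f (\<phi> x)))\<^sup>2)"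
      using A by (intro sum.mono_neutral_cong_right) auto
    also have "\<dots> = (\<Sum>y\<in>\<phi> ` (A \<inter> S). (cmod (f y))\<^sup>2)"
      using assms(1) by (subst sum.reindex) (auto intro: inj_on_subset)
    also have "\<dots> \<le> (norm F)\<^sup>2"
      using norm_l2_finite_sum_le[of "\<phi> ` (A \<inter> S)" F] A F by simp
    finally show ?thesis .
  qed
  from ell2_of_bounded_sums[OF this, of UNIV]
  show "(\<lambda>x. if x \<in> S then f (\<phi> x) else 0) \<in> ell2 UNIV"
    "(ell2_norm (\<lambda>x. if x \<in> S then f (\<phi> x) else 0))\<^sup>2 \<le> (ell2_norm f)\<^sup>2"
    by (auto simp: norm_l2_def F)
qed

text \<open>
  Composition with an injection \<open>\<phi>\<close> on \<open>S\<close>, cut off outside \<open>S\<close>. Left and right translations and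
  the restrictions to subsets all have this form, so boundedness and adjoints are proved once.
\<close>

definition comp_op :: "'a set \<Rightarrow> ('a \<Rightarrow> 'a) \<Rightarrow> ('a l2 \<Rightarrow>\<^sub>L 'a l2)" where
  "comp_op S \<phi> = Blinfun (\<lambda>f. Abs_l2 (\<lambda>x. if x \<in> S then coord f (\<phi> x) else 0))"

lemma coord_comp_op:
  assumes "inj_on \<phi> S"
  shows "coord (comp_op S \<phi> f) x = (if x \<in> S then coord f (\<phi> x) else 0)"
proof -
  define C where "C = (\<lambda>f. Abs_l2 (\<lambda>x. if x \<in> S then coord f (\<phi> x) else 0))"
  have C: "coord (C f) = (\<lambda>x. if x \<in> S then coord f (\<phi> x) else 0)" for f
    using comp_ell2(1)[OF assms coord_ell2] by (simp add: C_def Abs_l2_inverse)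
  have "bounded_linear C"
  proof (rule bounded_linear_intro[where K = 1])
    show "C (f + g) = C f + C g" for f g by (rule l2_eqI) (simp add: C plus_l2.rep_eq)
    show "C (r *\<^sub>R f) = r *\<^sub>R C f" for r f by (rule l2_eqI) (simp add: C scaleR_l2.rep_eq)
    show "norm (C f) \<le> norm f * 1" for f
      using comp_ell2(2)[OF assms coord_ell2, of f]
      by (auto simp: norm_l2_def C ell2_norm_def infsum_nonneg intro: power2_le_imp_le)
  qed
  then have "blinfun_apply (comp_op S \<phi>) = C"
    unfolding comp_op_def C_def[symmetric] by (rule bounded_linear_Blinfun_apply)
  then show ?thesis by (simp add: C)
qed

lemma clinear_comp_op:
  assumes "inj_on \<phi> S"
  shows "clinear_op (comp_op S \<phi>)"
  unfolding clinear_op_def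
  by (intro allI l2_eqI) (simp add: coord_comp_op[OF assms] scaleC.rep_eq)

lemma cinner_comp_op:
  assumes "bij_betw \<phi> S T" "\<And>x. x \<in> S \<Longrightarrow> \<psi> (\<phi> x) = x" "inj_on \<psi> T"
  shows "cinner (comp_op S \<phi> f) g = cinner f (comp_op T \<psi> g)"
proof -
  have "cinner (comp_op S \<phi> f) g = (\<Sum>\<^sub>\<infinity>x. if x \<in> S then coord f (\<phi> x) * cnj (coord g (\<psi> (\<phi> x))) else 0)"
    unfolding cinner_def ell2_inner_def coord_comp_op[OF bij_betw_imp_inj_on[OF assms(1)]]
    by (rule infsum_cong) (simp add: assms(2))
  also have "\<dots> = (\<Sum>\<^sub>\<infinity>y. if y \<in> T then coord f y * cnj (coord g (\<psi> y)) else 0)"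
    by (rule infsum_support[OF assms(1)])
  also have "\<dots> = cinner f (comp_op T \<psi> g)"
    unfolding cinner_def ell2_inner_def coord_comp_op[OF assms(3)]
    by (rule infsum_cong) simp
  finally show ?thesis .
qed

lemma adj_comp_op:
  assumes "bij_betw \<phi> S T" "\<And>x. x \<in> S \<Longrightarrow> \<psi> (\<phi> x) = x" "inj_on \<psi> T"
  shows "adj (comp_op S \<phi>) = comp_op T \<psi>"
  by (rule adj_eqI) (simp flip: Re_cinner add: cinner_comp_op[OF assms])

section \<open>Regular representations and equivariant operators\<close>

lemma clinear_op_comp: "clinear_op S \<Longrightarrow> clinear_op T \<Longrightarrow> clinear_op (S o\<^sub>L T)"
  by (simp add: clinear_op_def)

lemma basis_eq_scaleC: "coord f = (\<lambda>x. if x = a then c else 0) \<Longrightarrow> f = scaleC c (basis a)"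
  by (rule l2_eqI) (simp add: scaleC.rep_eq coord_basis)

context group
begin

definition lam :: "'a \<Rightarrow> ('a l2 \<Rightarrow>\<^sub>L 'a l2)" where
  "lam g = comp_op (carrier G) (\<lambda>x. inv g \<otimes> x)"

definition rho :: "'a \<Rightarrow> ('a l2 \<Rightarrow>\<^sub>L 'a l2)" where
  "rho g = comp_op (carrier G) (\<lambda>x. x \<otimes> g)"

definition restr :: "'a set \<Rightarrow> ('a l2 \<Rightarrow>\<^sub>L 'a l2)" where
  "restr S = comp_op S (\<lambda>x. x)"

text \<open>
  The unit of the algebras below. The ambient space consists of functions on the whole type, so the
  translations \<open>lam\<close> and \<open>rho\<close> are unitary only on the range of \<open>Q\<close> and vanish on its complement.
\<close>

abbreviation Q :: "'a l2 \<Rightarrow>\<^sub>L 'a l2" where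
  "Q \<equiv> restr (carrier G)"

lemma bij_mult_left: "g \<in> carrier G \<Longrightarrow> bij_betw (\<lambda>x. g \<otimes> x) (carrier G) (carrier G)"
  by (rule bij_betw_byWitness[where f' = "\<lambda>x. inv g \<otimes> x"])
    (auto simp: m_assoc[symmetric])

lemma bij_mult_right: "g \<in> carrier G \<Longrightarrow> bij_betw (\<lambda>x. x \<otimes> g) (carrier G) (carrier G)"
  by (rule bij_betw_byWitness[where f' = "\<lambda>x. x \<otimes> inv g"]) (auto simp: m_assoc)

lemma coord_lam: "g \<in> carrier G \<Longrightarrow> coord (lam g f) x = (if x \<in> carrier G then coord f (inv g \<otimes> x) else 0)"
  unfolding lam_def by (rule coord_comp_op) (auto intro: bij_betw_imp_inj_on[OF bij_mult_left])

lemma coord_rho: "g \<in> carrier G \<Longrightarrow> coord (rho g f) x = (if x \<in> carrier G then coord f (x \<otimes> g) else 0)"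
  unfolding rho_def by (rule coord_comp_op) (auto intro: bij_betw_imp_inj_on[OF bij_mult_right])

lemma coord_restr: "coord (restr S f) x = (if x \<in> S then coord f x else 0)"
  unfolding restr_def by (rule coord_comp_op) auto

lemma clinear_group_ops:
  "g \<in> carrier G \<Longrightarrow> clinear_op (lam g)" "g \<in> carrier G \<Longrightarrow> clinear_op (rho g)" "clinear_op (restr S)"
  unfolding lam_def rho_def restr_def
  by (rule clinear_comp_op; auto intro: bij_betw_imp_inj_on[OF bij_mult_left] bij_betw_imp_inj_on[OF bij_mult_right])+

lemma adj_lam: "g \<in> carrier G \<Longrightarrow> adj (lam g) = lam (inv g)"
  unfolding lam_def
  by (rule adj_comp_op)
    (auto intro: bij_mult_left bij_betw_imp_inj_on[OF bij_mult_left] simp: m_assoc[symmetric])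

lemma adj_rho: "g \<in> carrier G \<Longrightarrow> adj (rho g) = rho (inv g)"
  unfolding rho_def
  by (rule adj_comp_op)
    (auto intro: bij_mult_right bij_betw_imp_inj_on[OF bij_mult_right] simp: m_assoc)

lemma proj_restr: "proj_op (restr S)"
proof -
  have "adj (restr S) = restr S"
    unfolding restr_def by (rule adj_comp_op) (auto simp: bij_betw_def)
  moreover have "restr S o\<^sub>L restr S = restr S"
    by (intro blinfun_eqI l2_eqI) (simp add: coord_restr)
  ultimately show ?thesis by (simp add: proj_op_def)
qed

lemma restr_basis: "restr S (basis x) = (if x \<in> S then basis x else 0)"
  by (rule l2_eqI) (auto simp: coord_restr coord_basis zero_l2.rep_eq)

lemma lam_mult: "g \<in> carrier G \<Longrightarrow> h \<in> carrier G \<Longrightarrow> lam g (lam h f) = lam (g \<otimes> h) f"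
  by (rule l2_eqI) (simp add: coord_lam inv_mult_group m_assoc)

lemma rho_mult: "g \<in> carrier G \<Longrightarrow> h \<in> carrier G \<Longrightarrow> rho g (rho h f) = rho (g \<otimes> h) f"
  by (rule l2_eqI) (simp add: coord_rho m_assoc)

lemma lam_rho: "g \<in> carrier G \<Longrightarrow> h \<in> carrier G \<Longrightarrow> lam g (rho h f) = rho h (lam g f)"
  by (rule l2_eqI) (simp add: coord_rho coord_lam m_assoc)

lemma lam_one: "lam \<one> = Q"
  by (intro blinfun_eqI l2_eqI) (simp add: coord_lam coord_restr)

lemma lam_basis:
  assumes "g \<in> carrier G" "x \<in> carrier G"
  shows "lam g (basis x) = basis (g \<otimes> x)"
proof (rule l2_eqI)
  fix y
  have "inv g \<otimes> y = x \<longleftrightarrow> y = g \<otimes> x" if "y \<in> carrier G" for y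
    using assms that inv_solve_left'[of x g y] by auto
  then show "coord (lam g (basis x)) y = coord (basis (g \<otimes> x)) y"
    using assms by (auto simp: coord_lam coord_basis)
qed

lemma rho_basis:
  assumes "g \<in> carrier G" "x \<in> carrier G"
  shows "rho g (basis x) = basis (x \<otimes> inv g)"
proof (rule l2_eqI)
  fix y
  have "y \<otimes> g = x \<longleftrightarrow> y = x \<otimes> inv g" if "y \<in> carrier G" for y
    using assms that inv_solve_right'[of x y g] by (metis inv_closed inv_inv inv_solve_right')
  then show "coord (rho g (basis x)) y = coord (basis (x \<otimes> inv g)) y"
    using assms by (auto simp: coord_rho coord_basis)
qed

text \<open>
  Commuting with these operators means being complex linear and commuting with \<open>\<lambda>(H)\<close>. The
  negative of \<open>mult_i\<close> is its adjoint and makes the set closed under adjoints.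
\<close>

definition symmetries :: "'a set \<Rightarrow> ('a l2 \<Rightarrow>\<^sub>L 'a l2) set" where
  "symmetries H = {mult_i, - mult_i} \<union> lam ` H"

abbreviation equivariant :: "'a set \<Rightarrow> ('a l2 \<Rightarrow>\<^sub>L 'a l2) set" where
  "equivariant H \<equiv> op_commutant (symmetries H)"

lemma adj_closed_symmetries:
  assumes "subgroup H G" shows "adj_closed (symmetries H)"
proof
  fix S assume "S \<in> symmetries H"
  then show "adj S \<in> symmetries H"
    using subgroup.mem_carrier[OF assms] subgroup.m_inv_closed[OF assms]
    by (auto simp: symmetries_def adj_mult_i adj_lam)
qed

lemma equivariantI:
  fixes T :: "'a l2 \<Rightarrow>\<^sub>L 'a l2"
  assumes "clinear_op T" "\<And>h f. h \<in> H \<Longrightarrow> lam h (T f) = T (lam h f)"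
  shows "T \<in> equivariant H"
  using assms unfolding op_commutant_def symmetries_def clinear_op_def
  by (auto intro!: blinfun_eqI simp: blinfun.bilinear_simps)

lemma equivariantD:
  fixes T :: "'a l2 \<Rightarrow>\<^sub>L 'a l2"
  assumes "T \<in> equivariant H"
  shows "clinear_op T" "h \<in> H \<Longrightarrow> lam h (T f) = T (lam h f)"
proof -
  have 1: "mult_i o\<^sub>L T = T o\<^sub>L mult_i" "h \<in> H \<Longrightarrow> lam h o\<^sub>L T = T o\<^sub>L lam h"
    using assms unfolding op_commutant_def symmetries_def by blast+
  show "clinear_op T" unfolding clinear_op_def
  proof
    fix f show "T (scaleC \<i> f) = scaleC \<i> (T f)"
      using comp_apply[OF 1(1), of f] by simp
  qed
  assume "h \<in> H" from comp_apply[OF 1(2)[OF this], of f] show "lam h (T f) = T (lam h f)" by simp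
qed

lemma equivariant_mono: "H \<subseteq> K \<Longrightarrow> equivariant K \<subseteq> equivariant H"
  unfolding op_commutant_def symmetries_def by blast

lemma rho_equivariant:
  assumes "g \<in> carrier G" "H \<subseteq> carrier G"
  shows "rho g \<in> equivariant H"
  using assms by (intro equivariantI clinear_group_ops) (auto simp: lam_rho)

lemma restr_equivariant:
  assumes "subgroup H G"
  shows "restr H \<in> equivariant H"
proof (rule equivariantI[OF clinear_group_ops(3)])
  fix h f assume h: "h \<in> H"
  interpret H: subgroup H G by fact
  have "inv h \<otimes> x \<in> H \<longleftrightarrow> x \<in> H" if "x \<in> carrier G" for x
    by (metis H.m_closed H.m_inv_closed H.mem_carrier h inv_closed inv_solve_left' that)
  then show "lam h (restr H f) = restr H (lam h f)"
    using h H.mem_carrier by (intro l2_eqI) (auto simp: coord_lam coord_restr)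
qed

text \<open>
  \<open>Q\<close> is \<open>\<lambda>(e)\<close>.
\<close>

lemma equivariant_comm_Q:
  fixes T :: "'a l2 \<Rightarrow>\<^sub>L 'a l2"
  assumes "subgroup H G" "T \<in> equivariant H"
  shows "Q o\<^sub>L T = T o\<^sub>L Q"
  using equivariantD(2)[OF assms(2) subgroup.one_closed[OF assms(1)]]
  by (intro blinfun_eqI) (simp add: lam_one)

section \<open>The trace of equivariant operators\<close>

definition transversal :: "'a set \<Rightarrow> 'a set \<Rightarrow> bool" where
  "transversal H R \<longleftrightarrow> finite R \<and> R \<subseteq> carrier G \<and> (\<Union>r\<in>R. H #> r) = carrier G \<and>
     (\<forall>r\<in>R. \<forall>s\<in>R. r \<noteq> s \<longrightarrow> (H #> r) \<inter> (H #> s) = {})"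

lemma transversal_exists:
  assumes H: "subgroup H G" and fin: "finite (rcosets H)"
  shows "\<exists>R. transversal H R \<and> card R = card (rcosets H)"
proof -
  interpret H: subgroup H G by fact
  have "\<exists>r\<in>carrier G. C = H #> r" if "C \<in> rcosets H" for C
    using that by (auto simp: RCOSETS_def)
  then obtain c where c: "\<And>C. C \<in> rcosets H \<Longrightarrow> c C \<in> carrier G \<and> C = H #> c C" by metis
  define R where "R = c ` (rcosets H)"
  have inj: "inj_on c (rcosets H)" by (rule inj_onI) (metis c)
  have im: "(\<lambda>r. H #> r) ` R = rcosets H" using c by (force simp: R_def)
  have "(\<Union>r\<in>R. H #> r) = carrier G"
    using rcosets_part_G[OF H] im by simp
  moreover have "(H #> r) \<inter> (H #> s) = {}" if "r \<in> R" "s \<in> R" "r \<noteq> s" for r s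
  proof -
    have "H #> r \<noteq> H #> s" using that c unfolding R_def by (metis imageE)
    moreover have "H #> r \<in> rcosets H" "H #> s \<in> rcosets H" using im that by blast+
    ultimately show ?thesis using rcos_disjoint[OF H] unfolding pairwise_def disjnt_def by blast
  qed
  moreover have "card R = card (rcosets H)" by (simp add: R_def card_image[OF inj])
  ultimately show ?thesis using fin c by (intro exI[of _ R]) (auto simp: transversal_def R_def)
qed

lemma transversal_carrier: "transversal (carrier G) {\<one>}"
  by (auto simp: transversal_def r_coset_def)

lemma norm_cosets:
  assumes H: "subgroup H G" and R: "transversal H R" and f: "Q f = f"
  shows "(norm f)\<^sup>2 = (\<Sum>r\<in>R. \<Sum>\<^sub>\<infinity>h\<in>H. (cmod (coord f (h \<otimes> r)))\<^sup>2)"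
proof -
  interpret H: subgroup H G by fact
  let ?k = "\<lambda>x. (cmod (coord f x))\<^sup>2"
  have s: "?k summable_on A" for A
    using norm_l2_has_sum[of f] by (meson has_sum_imp_summable subset_UNIV summable_on_subset)
  have z: "coord f x = 0" if "x \<notin> carrier G" for x
    using arg_cong[OF f, of "\<lambda>f. coord f x"] that by (simp add: coord_restr)
  have "(norm f)\<^sup>2 = infsum ?k (carrier G)"
    unfolding norm_l2_sq by (rule infsum_cong_neutral) (auto simp: z)
  also have "\<dots> = (\<Sum>r\<in>R. infsum ?k (H #> r))"
    using sum_infsum[of R ?k "\<lambda>r. H #> r"] R s by (simp add: transversal_def)
  also have "\<dots> = (\<Sum>r\<in>R. \<Sum>\<^sub>\<infinity>h\<in>H. ?k (h \<otimes> r))"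
  proof (rule sum.cong[OF refl])
    fix r assume "r \<in> R"
    then have r: "r \<in> carrier G" using R by (auto simp: transversal_def)
    have "H #> r = (\<lambda>h. h \<otimes> r) ` H" by (auto simp: r_coset_def)
    moreover have "inj_on (\<lambda>h. h \<otimes> r) H"
      using r by (intro inj_onI) auto
    ultimately show "infsum ?k (H #> r) = (\<Sum>\<^sub>\<infinity>h\<in>H. ?k (h \<otimes> r))"
      by (simp add: infsum_reindex comp_def)
  qed
  finally show ?thesis .
qed

text \<open>
  The trace of \<open>\<lambda>(H)'\<close> for which the projection onto \<open>l\<^sup>2(H)\<close> has trace \<open>1\<close>. On \<open>L(G)'\<close> it is the
  index of \<open>H\<close> times the normalized trace. For \<open>H = G\<close> it is the normalized trace itself.
\<close>

definition coset_trace :: "'a set \<Rightarrow> ('a l2 \<Rightarrow>\<^sub>L 'a l2) \<Rightarrow> real" where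
  "coset_trace R T = (\<Sum>r\<in>R. T (basis r) \<bullet> basis r)"

lemma coset_trace_add: "coset_trace R (S + T) = coset_trace R S + coset_trace R T"
  by (simp add: coset_trace_def blinfun.bilinear_simps inner_simps sum.distrib)

lemma coset_trace_diff: "coset_trace R (S - T) = coset_trace R S - coset_trace R T"
  by (simp add: coset_trace_def blinfun.bilinear_simps inner_simps sum_subtractf)

lemma coset_trace_adj_comp: "coset_trace R (adj V o\<^sub>L V) = (\<Sum>r\<in>R. (norm (V (basis r)))\<^sup>2)"
  unfolding coset_trace_def norm_adj_comp ..

lemma coset_trace_proj: "proj_op E \<Longrightarrow> coset_trace R E = (\<Sum>r\<in>R. (norm (E (basis r)))\<^sup>2)"
  unfolding coset_trace_def by (simp add: proj_op_inner(2))

text \<open>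
  Both sides are the sum of the squared absolute values of the matrix coefficients
  \<open>\<langle>V \<delta>\<^sub>r, \<delta>\<^sub>h\<^sub>s\<rangle>\<close> over \<open>r, s\<close> in the transversal and \<open>h \<in> H\<close>. Equivariance moves \<open>h\<close> to the other side as
  \<open>h\<^sup>-\<^sup>1\<close>.
\<close>

lemma coset_trace_comm:
  assumes H: "subgroup H G" and R: "transversal H R" and V: "V \<in> equivariant H" and QV: "Q o\<^sub>L V = V"
  shows "coset_trace R (adj V o\<^sub>L V) = coset_trace R (V o\<^sub>L adj V)"
proof -
  interpret H: subgroup H G by fact
  interpret adj_closed "symmetries H" by (rule adj_closed_symmetries[OF H])
  have W: "adj V \<in> equivariant H" using V by (rule commutant_adj)
  have "V o\<^sub>L Q = V" using equivariant_comm_Q[OF H V] QV by simp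
  then have "adj (V o\<^sub>L Q) = adj V" by (rule arg_cong)
  then have QW: "Q o\<^sub>L adj V = adj V" using proj_restr by (simp add: proj_op_def)
  have flip: "cmod (coord (V (basis r)) (h \<otimes> s)) = cmod (coord (adj V (basis s)) (inv h \<otimes> r))"
    if "h \<in> H" "r \<in> carrier G" "s \<in> carrier G" for h r s
  proof -
    have "coord (V (basis r)) (h \<otimes> s) = cinner (V (basis r)) (lam h (basis s))"
      using that by (simp add: lam_basis cinner_basis_right H.mem_carrier)
    also have "\<dots> = cinner (basis r) (lam h (adj V (basis s)))"
      using cinner_adj_right[OF equivariantD(1)[OF V]] equivariantD(2)[OF W that(1)] by simp
    also have "\<dots> = cinner (lam (inv h) (basis r)) (adj V (basis s))"
      using cinner_adj_right[OF clinear_group_ops(1), of "inv h" "basis r" "adj V (basis s)"] that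
      by (simp add: adj_lam H.mem_carrier)
    also have "\<dots> = cnj (coord (adj V (basis s)) (inv h \<otimes> r))"
      using that cinner_cnj[of "basis (inv h \<otimes> r)"]
      by (simp add: lam_basis cinner_basis_right H.mem_carrier)
    finally show ?thesis by simp
  qed
  have inv: "bij_betw (\<lambda>h. inv h) H H"
    by (rule bij_betw_byWitness[where f' = "\<lambda>h. inv h"]) (auto simp: H.mem_carrier)
  have RG: "R \<subseteq> carrier G" using R by (simp add: transversal_def)
  have "coset_trace R (adj V o\<^sub>L V) = (\<Sum>r\<in>R. \<Sum>s\<in>R. \<Sum>\<^sub>\<infinity>h\<in>H. (cmod (coord (V (basis r)) (h \<otimes> s)))\<^sup>2)"
    unfolding coset_trace_adj_comp
    by (intro sum.cong refl norm_cosets[OF H R]) (simp add: comp_apply[OF QV])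
  also have "\<dots> = (\<Sum>r\<in>R. \<Sum>s\<in>R. \<Sum>\<^sub>\<infinity>h\<in>H. (cmod (coord (adj V (basis s)) (inv h \<otimes> r)))\<^sup>2)"
    using RG by (intro sum.cong refl infsum_cong) (auto simp: flip subset_iff)
  also have "\<dots> = (\<Sum>r\<in>R. \<Sum>s\<in>R. \<Sum>\<^sub>\<infinity>h\<in>H. (cmod (coord (adj V (basis s)) (h \<otimes> r)))\<^sup>2)"
    by (intro sum.cong refl infsum_reindex_bij_betw[OF inv])
  also have "\<dots> = (\<Sum>s\<in>R. \<Sum>r\<in>R. \<Sum>\<^sub>\<infinity>h\<in>H. (cmod (coord (adj V (basis s)) (h \<otimes> r)))\<^sup>2)"
    by (rule sum.swap)
  also have "\<dots> = coset_trace R (adj (adj V) o\<^sub>L adj V)"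
    unfolding coset_trace_adj_comp
    by (intro sum.cong refl norm_cosets[OF H R, symmetric]) (simp add: comp_apply[OF QW])
  finally show ?thesis by simp
qed

lemma coset_trace_index:
  assumes "transversal H R" "T \<in> equivariant (carrier G)"
  shows "coset_trace R T = real (card R) * (T (basis \<one>) \<bullet> basis \<one>)"
proof -
  have "T (basis r) \<bullet> basis r = T (basis \<one>) \<bullet> basis \<one>" if r: "r \<in> R" for r
  proof -
    have r': "r \<in> carrier G" using assms r by (auto simp: transversal_def)
    then have "T (basis r) \<bullet> basis r = lam r (T (basis \<one>)) \<bullet> lam r (basis \<one>)"
      using equivariantD(2)[OF assms(2) r', of "basis \<one>"] by (simp add: lam_basis)
    also have "\<dots> = T (basis \<one>) \<bullet> adj (lam r) (lam r (basis \<one>))" by (simp add: adj_right)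
    also have "\<dots> = T (basis \<one>) \<bullet> basis \<one>" using r' by (simp add: adj_lam lam_basis m_assoc[symmetric])
    finally show ?thesis .
  qed
  then show ?thesis by (simp add: coset_trace_def)
qed

text \<open>
  Trace \<open>0\<close> means that \<open>E\<close> kills the \<open>\<delta>\<^sub>r\<close>, and every \<open>\<delta>\<^sub>x\<close> is a translate of one of them by an
  element of \<open>H\<close>.
\<close>

lemma coset_trace_faithful:
  assumes H: "subgroup H G" and R: "transversal H R" and E: "E \<in> equivariant H" "proj_op E"
    and EQ: "E o\<^sub>L Q = E" and tr: "coset_trace R E \<le> 0"
  shows "E = 0"
proof (rule clinear_op_zeroI[OF equivariantD(1)[OF E(1)]])
  interpret H: subgroup H G by fact
  have fin: "finite R" "R \<subseteq> carrier G" using R by (auto simp: transversal_def)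
  have "(\<Sum>r\<in>R. (norm (E (basis r)))\<^sup>2) = 0"
    using tr unfolding coset_trace_proj[OF E(2)] by (intro antisym sum_nonneg) auto
  then have 0: "E (basis r) = 0" if "r \<in> R" for r
    using that fin by (simp add: sum_nonneg_eq_0_iff)
  fix x
  show "E (basis x) = 0"
  proof (cases "x \<in> carrier G")
    case True
    then have "x \<in> (\<Union>r\<in>R. H #> r)" using R unfolding transversal_def by blast
    then obtain r h where rh: "r \<in> R" "h \<in> H" "x = h \<otimes> r"
      unfolding r_coset_def by blast
    then have "E (basis x) = lam h (E (basis r))"
      using equivariantD(2)[OF E(1)] fin by (auto simp: lam_basis H.mem_carrier)
    then show ?thesis using 0 rh by (simp add: blinfun.zero_right)
  next
    case False
    then show ?thesis using comp_apply[OF EQ, of "basis x"] by (simp add: restr_basis blinfun.zero_right)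
  qed
qed

end

section \<open>Ergodicity and comparison of projections\<close>

lemma span_closure_invariant:
  fixes A :: "'h::real_normed_vector \<Rightarrow>\<^sub>L 'h"
  assumes "\<And>x. x \<in> S \<Longrightarrow> A x \<in> S" "x \<in> closure (span S)"
  shows "A x \<in> closure (span S)"
proof -
  have "A ` span S = span (A ` S)"
    by (rule linear_span_image[symmetric, OF bounded_linear.linear[OF blinfun.bounded_linear_right]])
  also have "\<dots> \<subseteq> span S" using assms(1) by (intro span_mono) auto
  finally have "A ` closure (span S) \<subseteq> closure (span S)"
    by (intro image_closure_subset linear_continuous_on blinfun.bounded_linear_right
        subset_trans[OF _ closure_subset] closed_closure)
  then show ?thesis using assms(2) by blast
qed

context group
begin

lemma icc_subgroup_class_infinite:
  assumes "subgroup H G" "icc_group (G\<lparr>carrier := H\<rparr>)" "x \<in> H" "x \<noteq> \<one>"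
  shows "infinite ((\<lambda>k. k \<otimes> x \<otimes> inv k) ` H)"
proof -
  have "{k \<otimes> x \<otimes> inv\<^bsub>G\<lparr>carrier := H\<rparr>\<^esub> k | k. k \<in> H} = (\<lambda>k. k \<otimes> x \<otimes> inv k) ` H"
    using m_inv_consistent[OF assms(1)] by force
  then show ?thesis using assms by (auto simp: icc_group_def)
qed

text \<open>
  A square-summable function takes a nonzero value only finitely often, but by invariance its value
  at \<open>x \<noteq> e\<close> is taken on an infinite conjugacy class.
\<close>

lemma conj_invariant_scalar:
  assumes H: "subgroup H G" and icc: "icc_group (G\<lparr>carrier := H\<rparr>)"
    and supp: "\<And>x. x \<notin> H \<Longrightarrow> coord f x = 0"
    and inv: "\<And>k x. k \<in> H \<Longrightarrow> x \<in> H \<Longrightarrow> coord f (k \<otimes> x \<otimes> inv k) = coord f x"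
  shows "f = scaleC (coord f \<one>) (basis \<one>)"
proof (rule basis_eq_scaleC, rule ext)
  fix x
  have "coord f x = 0" if x: "x \<in> H" "x \<noteq> \<one>"
  proof (rule ccontr)
    assume nz: "coord f x \<noteq> 0"
    define d where "d = (cmod (coord f x))\<^sup>2"
    have d: "d > 0" using nz by (simp add: d_def)
    obtain n :: nat where n: "(norm f)\<^sup>2 / d < real n" using reals_Archimedean2 by blast
    obtain F where F: "F \<subseteq> (\<lambda>k. k \<otimes> x \<otimes> inv k) ` H" "finite F" "card F = n"
      using infinite_arbitrarily_large[OF icc_subgroup_class_infinite[OF H icc x]] by blast
    have "(\<Sum>y\<in>F. (cmod (coord f y))\<^sup>2) = (\<Sum>y\<in>F. d)"
      using F(1) inv x(1) by (intro sum.cong) (auto simp: d_def)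
    then have "real n * d \<le> (norm f)\<^sup>2" using norm_l2_finite_sum_le[OF F(2), of f] F(3) by simp
    then show False using n d by (simp add: field_simps)
  qed
  then show "coord f x = (if x = \<one> then coord f \<one> else 0)" using supp by auto
qed

text \<open>
  The closed span \<open>M\<close> of the vectors \<open>T q x\<close> with \<open>T\<close> in the algebra is the central support of \<open>q\<close>:
  its projection commutes with the algebra and with \<open>\<lambda>(H)\<close>. The algebra contains all right
  translations \<open>\<rho>(g)\<close> and the projection onto \<open>l\<^sup>2(H)\<close>. So the image \<open>\<zeta>\<close> of \<open>\<delta>\<^sub>e\<close> is supported in
  \<open>H\<close>, is invariant under conjugation by \<open>H\<close>, and determines the projection; it follows that
  the projection is a scalar.
\<close>

lemma equivariant_ergodic:
  assumes H: "subgroup H G" and icc: "icc_group (G\<lparr>carrier := H\<rparr>)"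
    and p: "p \<in> equivariant H" "p o\<^sub>L Q = p" and q: "q \<in> equivariant H" "Q o\<^sub>L q = q"
    and orth: "\<And>T. T \<in> equivariant H \<Longrightarrow> p o\<^sub>L (T o\<^sub>L q) = 0"
  shows "p = 0 \<or> q = 0"
proof -
  interpret H: subgroup H G by fact
  interpret CH: adj_closed "symmetries H" by (rule adj_closed_symmetries[OF H])
  define F where "F = equivariant H \<union> symmetries H"
  interpret F: adj_closed F
    by standard (auto simp: F_def intro: CH.commutant_adj CH.adj_mem)
  define S where "S = {blinfun_apply T (q x) | T x. T \<in> equivariant H}"
  define M where "M = closure (span S)"
  have M: "subspace M" "closed M" by (auto simp: M_def intro: subspace_closure)
  have SM: "S \<subseteq> M" unfolding M_def by (meson closure_subset order_trans span_superset)
  have inv: "A x \<in> M" if A: "A \<in> F" and x: "x \<in> M" for A x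
  proof -
    have "A y \<in> S" if "y \<in> S" for y
    proof -
      from that obtain T z where T: "T \<in> equivariant H" "y = blinfun_apply T (q z)" unfolding S_def by blast
      show ?thesis
      proof (cases "A \<in> equivariant H")
        case True
        have "A y = (A o\<^sub>L T) (q z)" using T(2) by simp
        then show ?thesis unfolding S_def using CH.commutant_alg(7)[OF True T(1)] by fast
      next
        case False
        then have "A \<in> symmetries H" using A by (simp add: F_def)
        from CH.commutantD[OF this T(1), of "q z"] CH.commutantD[OF this q(1), of z]
        have "A y = T (q (A z))" using T(2) by simp
        then show ?thesis unfolding S_def using T(1) by blast
      qed
    qed
    then show ?thesis using x unfolding M_def by (rule span_closure_invariant)
  qed
  define P where "P = orth_proj M"
  have PF: "P \<in> op_commutant F" unfolding P_def by (rule F.commutant_orth_proj[OF M inv])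
  have P: "P \<in> equivariant H"
    using PF unfolding F_def op_commutant_def by blast
  have pP: "proj_op P" unfolding P_def by (rule proj_op_orth_proj[OF M])
  have comm: "A (P x) = P (A x)" if "A \<in> F" for A x
    using F.commutantD[OF that PF] .
  define \<zeta> where "\<zeta> = P (basis \<one>)"
  have "restr H \<zeta> = \<zeta>"
    using comm[of "restr H" "basis \<one>"] restr_equivariant[OF H] by (simp add: \<zeta>_def F_def restr_basis)
  then have supp: "coord \<zeta> x = 0" if "x \<notin> H" for x
    using arg_cong[of _ _ "\<lambda>f. coord f x"] that by (metis coord_restr)
  have conj: "coord \<zeta> (k \<otimes> x \<otimes> inv k) = coord \<zeta> x" if k: "k \<in> H" and x: "x \<in> H" for k x
  proof -
    have kk: "inv k \<in> H" "inv k \<in> carrier G" "k \<in> carrier G" using k by auto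
    have "lam (inv k) (rho (inv k) \<zeta>) = P (lam (inv k) (rho (inv k) (basis \<one>)))"
      using comm[of "rho (inv k)"] comm[of "lam (inv k)"] rho_equivariant[OF kk(2) H.subset] kk
      by (simp add: \<zeta>_def F_def symmetries_def)
    also have "lam (inv k) (rho (inv k) (basis \<one>)) = basis \<one>"
      using kk by (simp add: rho_basis lam_basis)
    finally have "coord (lam (inv k) (rho (inv k) \<zeta>)) x = coord \<zeta> x" by (simp add: \<zeta>_def)
    then show ?thesis using kk x by (simp add: coord_lam coord_rho)
  qed
  define c where "c = coord \<zeta> \<one>"
  have \<zeta>: "\<zeta> = scaleC c (basis \<one>)"
    unfolding c_def by (rule conj_invariant_scalar[OF H icc supp conj])
  \<comment> \<open>Right translation carries the value at \<open>\<delta>\<^sub>e\<close> to all of \<open>G\<close>, not only to \<open>H\<close>.\<close>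
  have Pb: "P (basis g) = scaleC c (basis g)" if g: "g \<in> carrier G" for g
  proof -
    have "P (basis g) = rho (inv g) \<zeta>"
      using comm[of "rho (inv g)" "basis \<one>"] rho_equivariant[of "inv g" H] g H.subset
      by (simp add: \<zeta>_def F_def rho_basis)
    then show ?thesis using g by (simp add: \<zeta> clinear_op_scaleC[OF clinear_group_ops(2)] rho_basis)
  qed
  have "scaleC (c * c) (basis \<one>) = scaleC c (basis \<one>)"
  proof -
    have "P (P (basis \<one>)) = P (basis \<one>)" by (rule proj_op_inner(3)[OF pP])
    then have "scaleC c (scaleC c (basis \<one>)) = scaleC c (basis \<one>)"
      by (simp add: Pb clinear_op_scaleC[OF equivariantD(1)[OF P]])
    moreover have "scaleC c (scaleC c (basis \<one>)) = scaleC (c * c) (basis \<one>)"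
      by (rule l2_eqI) (simp add: scaleC.rep_eq)
    ultimately show ?thesis by simp
  qed
  from arg_cong[OF this, of "\<lambda>f. coord f \<one>"] have "c * c = c"
    by (simp add: scaleC.rep_eq coord_basis)
  then consider "c = 0" | "c = 1" by auto
  then show ?thesis
  proof cases
    case 1
    have "P o\<^sub>L Q = 0"
      by (rule clinear_op_zeroI)
        (auto simp: restr_basis Pb 1 blinfun.zero_right clinear_op_comp equivariantD(1)[OF P]
          clinear_group_ops scaleC.rep_eq zero_l2.rep_eq intro!: l2_eqI)
    moreover have "P (q x) = q x" for x
    proof -
      have "q x \<in> S" unfolding S_def using CH.commutant_alg(1)
        by (intro CollectI exI[of _ id_blinfun] exI[of _ x]) simp
      then show ?thesis unfolding P_def using SM by (intro orth_proj_eqI[OF M]) auto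
    qed
    ultimately have "q x = 0" for x
      using comp_apply[OF q(2), of x] comp_apply[of P Q 0 "q x"] by simp
    then show ?thesis by (auto intro: blinfun_eqI)
  next
    case 2
    have PQ: "P o\<^sub>L Q = Q"
      by (rule clinear_op_eqI)
        (auto simp: restr_basis Pb 2 blinfun.zero_right clinear_op_comp equivariantD(1)[OF P]
          clinear_group_ops scaleC.rep_eq intro!: l2_eqI)
    have "M \<subseteq> {x. p x = 0}"
    proof -
      have "p y = 0" if y: "y \<in> S" for y
      proof -
        from y obtain T z where T: "T \<in> equivariant H" "y = blinfun_apply T (q z)" unfolding S_def by blast
        show ?thesis using comp_apply[OF orth[OF T(1)], of z] T(2) by simp
      qed
      then have "S \<subseteq> {x. p x = 0}" by blast
      moreover have "subspace {x. p x = 0}"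
        by (auto simp: subspace_def blinfun.bilinear_simps)
      moreover have "closed {x. p x = 0}"
        by (intro closed_Collect_eq linear_continuous_on blinfun.bounded_linear_right continuous_on_const)
      ultimately show ?thesis unfolding M_def by (intro closure_minimal span_minimal)
    qed
    then have "p (P x) = 0" for x using orth_proj_in[OF M] unfolding P_def by blast
    then have "p (Q x) = 0" for x using comp_apply[OF PQ, of x] by metis
    then have "p x = 0" for x using comp_apply[OF p(2), of x] by simp
    then show ?thesis by (auto intro: blinfun_eqI)
  qed
qed

text \<open>
  Order the partial isometries from below \<open>p\<close> to below \<open>q\<close> by extension and take one, \<open>V\<close>, that
  cannot be enlarged in trace. If both remainders \<open>p - V\<^sup>*V\<close> and \<open>q - V V\<^sup>*\<close> were nonzero, some
  element of the algebra would connect them by ergodicity, and the partial isometry in its polar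
  decomposition could be added to \<open>V\<close>. So one remainder is \<open>0\<close>, and if it is the second one, then
  the trace inequality forces the first to be \<open>0\<close> as well.
\<close>

theorem comparison:
  assumes H: "subgroup H G" and icc: "icc_group (G\<lparr>carrier := H\<rparr>)" and R: "transversal H R"
    and p: "p \<in> equivariant H" "proj_op p" "Q o\<^sub>L p = p"
    and q: "q \<in> equivariant H" "proj_op q" "Q o\<^sub>L q = q"
    and le: "coset_trace R p \<le> coset_trace R q"
  shows "\<exists>V\<in>equivariant H. adj V o\<^sub>L V = p \<and> partial_isometry V \<and> q o\<^sub>L V = V"
proof -
  interpret H: subgroup H G by fact
  interpret CH: adj_closed "symmetries H" by (rule adj_closed_symmetries[OF H])
  have fin: "finite R" "R \<subseteq> carrier G" using R by (auto simp: transversal_def)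
  have pQ: "p o\<^sub>L Q = p" "q o\<^sub>L Q = q"
    using equivariant_comm_Q[OF H p(1)] equivariant_comm_Q[OF H q(1)] p q by simp_all
  have pp: "p o\<^sub>L p = p" "adj p = p" "q o\<^sub>L q = q" "adj q = q" using p q by (auto simp: proj_op_def)
  define X where "X = {V \<in> equivariant H. partial_isometry V \<and> V o\<^sub>L p = V \<and> q o\<^sub>L V = V}"
  define r where "r = (\<lambda>V W. V \<in> X \<and> W \<in> X \<and> V = W o\<^sub>L (adj V o\<^sub>L V))"
  define \<phi> where "\<phi> = (\<lambda>V. coset_trace R (adj V o\<^sub>L V))"
  have Xpi: "partial_isometry V" if "V \<in> X" for V using that by (simp add: X_def)
  have "\<exists>V\<in>X. \<forall>W\<in>X. r V W \<longrightarrow> \<phi> W = \<phi> V"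
  proof (rule greedy_maximal[where B = "real (card R)" and ?x0.0 = 0])
    show "0 \<in> X" by (simp add: X_def CH.commutant_alg partial_isometry_def proj_op_def comp_algebra)
    show "r V V" if "V \<in> X" for V
      using partial_isometry_comp[OF Xpi[OF that]] that by (simp add: r_def)
    show "r U W" if a: "r U V" and b: "r V W" for U V W
    proof -
      have "(adj V o\<^sub>L V) o\<^sub>L (adj U o\<^sub>L U) = adj U o\<^sub>L U"
        using a Xpi by (intro partial_isometry_extends) (auto simp: r_def)
      moreover have "U = V o\<^sub>L (adj U o\<^sub>L U)" "V = W o\<^sub>L (adj V o\<^sub>L V)" using a b by (auto simp: r_def)
      ultimately have "U = W o\<^sub>L (adj U o\<^sub>L U)" by (metis comp_assoc)
      then show ?thesis using a b by (simp add: r_def)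
    qed
    show "\<phi> V \<le> real (card R)" if "V \<in> X" for V
    proof -
      have "\<phi> V \<le> (\<Sum>x\<in>R. 1)"
        unfolding \<phi>_def coset_trace_adj_comp
      proof (rule sum_mono)
        fix x
        have "norm (V (basis x)) \<le> 1" using partial_isometry_norm_le[OF Xpi[OF that], of "basis x"] by simp
        then show "(norm (V (basis x)))\<^sup>2 \<le> 1" by (simp add: power_le_one)
      qed
      then show ?thesis by simp
    qed
    show "\<phi> V \<le> \<phi> W" if "V \<in> X" "W \<in> X" "r V W" for V W
      unfolding \<phi>_def coset_trace_adj_comp
    proof (intro sum_mono power_mono)
      fix x
      have VW: "V = W o\<^sub>L (adj V o\<^sub>L V)" using that by (simp add: r_def)
      have "(adj W o\<^sub>L W) o\<^sub>L (adj V o\<^sub>L V) = adj V o\<^sub>L V"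
        using that Xpi VW by (intro partial_isometry_extends) auto
      then have "(adj V o\<^sub>L V) o\<^sub>L (adj W o\<^sub>L W) = adj V o\<^sub>L V"
        using Xpi that by (intro proj_op_diff(2)) (auto simp: partial_isometry_def)
      then have "norm ((adj V o\<^sub>L V) (basis x)) = norm ((adj V o\<^sub>L V) ((adj W o\<^sub>L W) (basis x)))"
        by (metis blinfun_apply_blinfun_compose)
      also have "\<dots> \<le> norm ((adj W o\<^sub>L W) (basis x))"
        using Xpi that by (intro proj_op_norm_le) (auto simp: partial_isometry_def)
      finally show "norm (V (basis x)) \<le> norm (W (basis x))"
        using partial_isometry_norm[OF Xpi] that by metis
    qed simp
    show "\<exists>W\<in>X. \<forall>n. r (f n) W" if fX: "\<And>n. f n \<in> X" and fr: "\<And>n. r (f n) (f (Suc n))" for f :: "nat \<Rightarrow> _"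
    proof -
      have "f n = f (Suc n) o\<^sub>L (adj (f n) o\<^sub>L f n)" for n using fr[of n] by (simp add: r_def)
      from partial_isometry_chain_limit[of f, OF Xpi[OF fX] this]
      obtain W where W: "partial_isometry W" "\<And>x. (\<lambda>n. f n x) \<longlonglongrightarrow> W x"
        "\<And>n. f n = W o\<^sub>L (adj (f n) o\<^sub>L f n)" by blast
      have fc: "f n \<in> equivariant H" "f n o\<^sub>L p = f n" "q o\<^sub>L f n = f n" for n
        using fX[of n] by (auto simp: X_def)
      have "W \<in> equivariant H" by (rule CH.commutant_strong_limit[OF fc(1) W(2)])
      moreover have "W o\<^sub>L p = W"
      proof (rule blinfun_eqI)
        fix x
        have "(\<lambda>n. f n x) \<longlonglongrightarrow> W (p x)" using W(2)[of "p x"] comp_apply[OF fc(2)] by simp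
        then have "W (p x) = W x" by (rule LIMSEQ_unique[OF _ W(2)])
        then show "(W o\<^sub>L p) x = W x" by simp
      qed
      moreover have "q o\<^sub>L W = W"
      proof (rule blinfun_eqI)
        fix x
        have "(\<lambda>n. q (f n x)) \<longlonglongrightarrow> q (W x)"
          by (intro bounded_linear.tendsto[OF blinfun.bounded_linear_right] W(2))
        then have "(\<lambda>n. f n x) \<longlonglongrightarrow> q (W x)" using comp_apply[OF fc(3)] by simp
        then have "q (W x) = W x" by (rule LIMSEQ_unique[OF _ W(2)])
        then show "(q o\<^sub>L W) x = W x" by simp
      qed
      ultimately have "W \<in> X" using W(1) by (simp add: X_def)
      then show ?thesis unfolding r_def using W(3) fX by blast
    qed
  qed
  then obtain V where VX: "V \<in> X" and max: "\<And>W. W \<in> X \<Longrightarrow> r V W \<Longrightarrow> \<phi> W = \<phi> V" by blast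
  define E F where "E = adj V o\<^sub>L V" and "F = V o\<^sub>L adj V"
  have V: "V \<in> equivariant H" "partial_isometry V" "V o\<^sub>L p = V" "q o\<^sub>L V = V"
    using VX by (auto simp: X_def)
  have V': "adj V \<in> equivariant H" using V(1) by (rule CH.commutant_adj)
  have "adj (V o\<^sub>L p) = adj V" "adj (q o\<^sub>L V) = adj V" using V(3,4) by simp_all
  then have Vad: "p o\<^sub>L adj V = adj V" "adj V o\<^sub>L q = adj V" using pp by simp_all
  have E: "proj_op E" "E \<in> equivariant H" "p o\<^sub>L E = E" "V o\<^sub>L E = V"
    using V partial_isometry_comp[OF V(2)] CH.commutant_alg(7)[OF V' V(1)] Vad
    by (auto simp: E_def partial_isometry_def comp_assoc[symmetric])
  have F: "proj_op F" "F \<in> equivariant H" "q o\<^sub>L F = F" "F o\<^sub>L V = V"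
    using V partial_isometry_final[OF V(2)] partial_isometry_final_proj[OF V(2)]
      CH.commutant_alg(7)[OF V(1) V']
    by (auto simp: F_def comp_assoc[symmetric])
  have "adj (F o\<^sub>L V) = adj V" "adj (V o\<^sub>L E) = adj V" using F(4) E(4) by simp_all
  then have VF: "adj V o\<^sub>L F = adj V" "E o\<^sub>L adj V = adj V" using F(1) E(1) by (simp_all add: proj_op_def)
  define p0 q0 where "p0 = p - E" and "q0 = q - F"
  have p0: "proj_op p0" "p0 o\<^sub>L E = 0" "p0 \<in> equivariant H" "p o\<^sub>L p0 = p0"
    using proj_op_diff[OF E(1) p(2) E(3)] CH.commutant_alg(4)[OF p(1) E(2)] by (auto simp: p0_def)
  have q0: "proj_op q0" "q0 \<in> equivariant H" "q o\<^sub>L q0 = q0"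
    using proj_op_diff[OF F(1) q(2) F(3)] CH.commutant_alg(4)[OF q(1) F(2)] by (auto simp: q0_def)
  have p0p: "p0 o\<^sub>L p = p0" using proj_op_diff(2)[OF E(1) p(2) E(3)] pp by (simp add: p0_def comp_algebra)
  have "p0 = 0 \<or> q0 = 0"
  proof (rule ccontr)
    assume neg: "\<not> (p0 = 0 \<or> q0 = 0)"
    have "q0 o\<^sub>L Q = q0"
      using equivariant_comm_Q[OF H F(2)] pQ F(3) q(3) proj_op_diff(2)[OF F(1) q(2) F(3)]
      by (simp add: q0_def comp_algebra) (metis comp_assoc)
    moreover have "Q o\<^sub>L p0 = p0" using p0(4) p(3) by (metis comp_assoc)
    ultimately obtain T where T: "T \<in> equivariant H" "q0 o\<^sub>L (T o\<^sub>L p0) \<noteq> 0"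
      using equivariant_ergodic[OF H icc q0(2) _ p0(3)] neg by blast
    define x where "x = q0 o\<^sub>L (T o\<^sub>L p0)"
    have "x \<in> equivariant H" unfolding x_def by (intro CH.commutant_alg q0 T p0)
    from CH.polar_decomposition[OF this] obtain U where U: "U \<in> equivariant H" "partial_isometry U"
      "\<And>A :: 'a l2 \<Rightarrow>\<^sub>L 'a l2. x o\<^sub>L A = 0 \<Longrightarrow> U o\<^sub>L A = 0" "\<And>A :: 'a l2 \<Rightarrow>\<^sub>L 'a l2. A o\<^sub>L x = 0 \<Longrightarrow> A o\<^sub>L U = 0"
      "\<And>y. norm (x y) \<le> norm x * norm (U y)" by blast
    have "x o\<^sub>L (id_blinfun - p0) = 0" "(id_blinfun - q0) o\<^sub>L x = 0"
      using p0(1) q0(1) by (simp_all add: x_def comp_algebra comp_assoc[symmetric] proj_op_def)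
        (simp add: comp_assoc)
    then have "U o\<^sub>L (id_blinfun - p0) = 0" "(id_blinfun - q0) o\<^sub>L U = 0" using U(3,4) by blast+
    then have Up: "U o\<^sub>L p0 = U" "q0 o\<^sub>L U = U" by (simp_all add: comp_algebra)
    have "adj V o\<^sub>L q0 = 0" using Vad(2) VF by (simp add: q0_def comp_algebra)
    then have 1: "adj V o\<^sub>L U = 0" using Up(2) by (metis comp_assoc comp_algebra(9))
    have "p0 o\<^sub>L adj V = 0" using Vad(1) VF(2) by (simp add: p0_def comp_algebra)
    then have 2: "U o\<^sub>L adj V = 0" using Up(1) by (metis comp_assoc comp_algebra(10))
    have "adj (adj V o\<^sub>L U) = 0" "adj (U o\<^sub>L adj V) = 0" using 1 2 by simp_all
    then have 3: "adj U o\<^sub>L V = 0" "V o\<^sub>L adj U = 0" by simp_all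
    define W where "W = V + U"
    have EW: "adj W o\<^sub>L W = E + (adj U o\<^sub>L U)"
      unfolding W_def E_def by (rule partial_isometry_sum(1)[OF 1 3(1) 3(2) 2])
    have "E o\<^sub>L (adj U o\<^sub>L U) = adj V o\<^sub>L ((V o\<^sub>L adj U) o\<^sub>L U)" by (simp add: E_def comp_assoc)
    then have EU: "E o\<^sub>L (adj U o\<^sub>L U) = 0" using 3 by (simp add: comp_algebra)
    have "U o\<^sub>L p = U" "q o\<^sub>L U = U" using p0p q0(3) Up by (metis comp_assoc)+
    then have "W o\<^sub>L p = W" "q o\<^sub>L W = W" using V(3,4) by (simp_all add: W_def comp_algebra)
    moreover have "partial_isometry W"
      using proj_op_add(1)[OF E(1) _ EU] U(2) by (simp add: partial_isometry_def EW)
    ultimately have "W \<in> X" using CH.commutant_alg(3)[OF V(1) U(1)] by (simp add: X_def W_def)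
    moreover
    have "U o\<^sub>L E = 0" using p0(2) Up(1) by (metis comp_assoc comp_algebra(10))
    then have "V = W o\<^sub>L (adj V o\<^sub>L V)" using E(4) by (simp add: W_def comp_algebra flip: E_def)
    ultimately have "r V W" unfolding r_def using VX by blast
    with \<open>W \<in> X\<close> have "\<phi> W = \<phi> V" using max by blast
    then have "coset_trace R (adj U o\<^sub>L U) = 0"
      unfolding \<phi>_def EW coset_trace_add by (simp add: E_def)
    moreover have "p0 o\<^sub>L Q = p0" using p0p pQ(1) by (metis comp_assoc)
    then have "(adj U o\<^sub>L U) o\<^sub>L Q = adj U o\<^sub>L U" using Up(1) by (metis comp_assoc)
    ultimately have "adj U o\<^sub>L U = 0"
      using CH.commutant_alg(7)[OF CH.commutant_adj[OF U(1)] U(1)] U(2)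
      by (intro coset_trace_faithful[OF H R]) (auto simp: partial_isometry_def)
    then have "norm (U y) = 0" for y using partial_isometry_norm[OF U(2), of y] by simp
    then have "norm (x y) \<le> 0" for y using U(5)[of y] by simp
    then have "x = 0" by (intro blinfun_eqI) simp
    then show False using T by (simp add: x_def)
  qed
  moreover have "p0 = 0" if "q0 = 0"
  proof (rule coset_trace_faithful[OF H R p0(3) p0(1)])
    show "p0 o\<^sub>L Q = p0" using p0p pQ(1) by (metis comp_assoc)
    have "Q o\<^sub>L V = V" using V(4) q(3) by (metis comp_assoc)
    then have "coset_trace R E = coset_trace R F"
      unfolding E_def F_def by (rule coset_trace_comm[OF H R V(1)])
    then show "coset_trace R p0 \<le> 0" using le that by (simp add: p0_def q0_def coset_trace_diff)
  qed
  ultimately have "E = p" by (auto simp: p0_def)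
  then show ?thesis using V by (auto simp: E_def)
qed

end

section \<open>Projections of prescribed trace\<close>

text \<open>
  The elements are chosen one after the other, each outside the finite bad sets of its
  predecessors.
\<close>

lemma infinite_spread_set:
  assumes "infinite C" "\<And>b. finite (bad b)"
  shows "\<exists>A. finite A \<and> card A = n \<and> A \<subseteq> C \<and> (\<forall>a\<in>A. \<forall>b\<in>A. a \<noteq> b \<longrightarrow> a \<notin> bad b \<or> b \<notin> bad a)"
proof (induction n)
  case 0
  show ?case by (intro exI[of _ "{}"]) auto
next
  case (Suc n)
  then obtain A where A: "finite A" "card A = n" "A \<subseteq> C"
    "\<forall>a\<in>A. \<forall>b\<in>A. a \<noteq> b \<longrightarrow> a \<notin> bad b \<or> b \<notin> bad a" by auto
  have "finite (A \<union> (\<Union>b\<in>A. bad b))" using A(1) assms(2) by blast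
  then have "infinite (C - (A \<union> (\<Union>b\<in>A. bad b)))" using assms(1) by (rule Diff_infinite_finite)
  then obtain a where "a \<in> C - (A \<union> (\<Union>b\<in>A. bad b))" using infinite_imp_nonempty by blast
  then show ?case using A by (intro exI[of _ "insert a A"]) auto
qed

context group
begin

lemma mult_i_equivariant: "H \<subseteq> carrier G \<Longrightarrow> mult_i \<in> equivariant H"
  by (rule equivariantI) (auto simp: clinear_op_def clinear_op_scaleC[OF clinear_group_ops(1)])

lemma trace_pos:
  assumes "e \<in> equivariant (carrier G)" "proj_op e" "Q o\<^sub>L e = e" "e \<noteq> 0"
  shows "e (basis \<one>) \<bullet> basis \<one> > 0"
proof (rule ccontr)
  assume "\<not> ?thesis"
  then have "coset_trace {\<one>} e \<le> 0" by (simp add: coset_trace_def)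
  moreover have "e o\<^sub>L Q = e" using equivariant_comm_Q[OF subgroup_self assms(1)] assms(3) by simp
  ultimately show False
    using coset_trace_faithful[OF subgroup_self transversal_carrier assms(1,2)] assms(4) by blast
qed

text \<open>
  The real and imaginary parts of \<open>e T e\<close> are self-adjoint, hence real multiples of \<open>e\<close>.
\<close>

lemma minimal_projection_complex_scalar:
  fixes e T :: "'a l2 \<Rightarrow>\<^sub>L 'a l2"
  assumes e: "e \<in> equivariant (carrier G)" "proj_op e" "e \<noteq> 0"
    and min: "\<And>P. P \<in> equivariant (carrier G) \<Longrightarrow> proj_op P \<Longrightarrow> e o\<^sub>L P = P \<Longrightarrow> P \<noteq> 0 \<Longrightarrow> P = e"
    and T: "T \<in> equivariant (carrier G)"
  shows "\<exists>c. \<forall>f. e (T (e f)) = scaleC c (e f)"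
proof -
  interpret C: adj_closed "symmetries (carrier G)" by (rule adj_closed_symmetries[OF subgroup_self])
  define A where "A = e o\<^sub>L (T o\<^sub>L e)"
  have ee: "e o\<^sub>L e = e" "adj e = e" using e by (auto simp: proj_op_def)
  have A: "A \<in> equivariant (carrier G)" "adj A \<in> equivariant (carrier G)"
    unfolding A_def by (intro C.commutant_alg C.commutant_adj e T)+
  have eA: "e o\<^sub>L A = A" "e o\<^sub>L adj A = adj A"
    by (simp_all add: A_def ee comp_assoc) (simp_all add: ee flip: comp_assoc)
  have i: "mult_i \<in> equivariant (carrier G)" by (rule mult_i_equivariant) simp
  have ei: "e o\<^sub>L mult_i = mult_i o\<^sub>L e" "A o\<^sub>L mult_i = mult_i o\<^sub>L A" "adj A o\<^sub>L mult_i = mult_i o\<^sub>L adj A"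
    using equivariantD(1)[OF e(1)] equivariantD(1)[OF A(1)] equivariantD(1)[OF A(2)]
    by (auto simp: clinear_op_def intro!: blinfun_eqI)
  have "\<exists>a. A + adj A = a *\<^sub>R e"
    by (rule C.minimal_projection_scalar[OF e min])
      (use A eA in \<open>auto simp: comp_algebra add.commute intro: C.commutant_alg\<close>)
  then obtain a where a: "A + adj A = a *\<^sub>R e" by blast
  define B where "B = mult_i o\<^sub>L (A - adj A)"
  have "\<exists>b. B = b *\<^sub>R e"
  proof (rule C.minimal_projection_scalar[OF e min])
    show "B \<in> equivariant (carrier G)" unfolding B_def by (intro C.commutant_alg i A)
    show "adj B = B" using ei by (simp add: B_def adj_mult_i comp_algebra)
    have "e o\<^sub>L B = mult_i o\<^sub>L (e o\<^sub>L (A - adj A))" unfolding B_def by (metis ei(1) comp_assoc)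
    then show "e o\<^sub>L B = B" using eA by (simp add: B_def comp_algebra)
  qed
  then obtain b where b: "B = b *\<^sub>R e" by blast
  have "A f = scaleC (Complex (a / 2) (- b / 2)) (e f)" for f
  proof (rule l2_eqI)
    fix x
    have "coord (A f + adj A f) x = complex_of_real a * coord (e f) x"
      using arg_cong[OF a, of "\<lambda>T. coord (T f) x"] by (simp add: blinfun.bilinear_simps scaleR_l2.rep_eq)
    moreover have "coord (scaleC \<i> (A f) - scaleC \<i> (adj A f)) x = complex_of_real b * coord (e f) x"
      using arg_cong[OF b, of "\<lambda>T. coord (T f) x"] by (simp add: B_def blinfun.bilinear_simps scaleR_l2.rep_eq)
    ultimately have 1: "coord (A f) x + coord (adj A f) x = complex_of_real a * coord (e f) x"
      "\<i> * coord (A f) x - \<i> * coord (adj A f) x = complex_of_real b * coord (e f) x"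
      by (simp_all add: plus_l2.rep_eq minus_l2.rep_eq scaleC.rep_eq)
    have d: "coord (A f) x - coord (adj A f) x = - (\<i> * (complex_of_real b * coord (e f) x))"
      unfolding 1(2)[symmetric] by (simp add: right_diff_distrib)
    have "2 * coord (A f) x = (coord (A f) x + coord (adj A f) x) + (coord (A f) x - coord (adj A f) x)"
      by simp
    also have "\<dots> = (complex_of_real a - \<i> * complex_of_real b) * coord (e f) x"
      unfolding 1(1) d by (simp add: algebra_simps)
    finally have "2 * coord (A f) x = (complex_of_real a - \<i> * complex_of_real b) * coord (e f) x" .
    moreover have "complex_of_real a - \<i> * complex_of_real b = 2 * Complex (a / 2) (- b / 2)"
      by (simp add: complex_eq_iff)
    ultimately show "coord (A f) x = coord (scaleC (Complex (a / 2) (- b / 2)) (e f)) x"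
      by (simp add: scaleC.rep_eq)
  qed
  then show ?thesis by (auto simp: A_def)
qed

text \<open>
  Suppose that \<open>e\<close> is minimal, and let \<open>\<eta> = e \<delta>\<^sub>e\<close> and \<open>t = \<langle>\<eta>, \<delta>\<^sub>e\<rangle>\<close>. Then \<open>e \<rho>(g) e = (\<eta>(g) / t) e\<close>.
  The vectors \<open>v\<^sub>a = \<rho>(a) e \<delta>\<^sub>a\<close> (that is, \<open>\<rho>(a) e \<rho>(a)\<^sup>* \<delta>\<^sub>e\<close>) have squared norm \<open>t\<close>, inner product
  \<open>t\<close> with \<open>\<delta>\<^sub>e\<close> and inner products \<open>|\<eta>(b\<^sup>-\<^sup>1a)|\<^sup>2 / t\<close> with each other. As \<open>\<eta>\<close> is square-summable and
  \<open>G\<close> is infinite, one can find \<open>n\<close> of them with mutual inner products at most \<open>t\<^sup>2 / 2\<close>. Their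
  sum \<open>w\<close> satisfies \<open>n t = \<langle>w, \<delta>\<^sub>e\<rangle> \<le> \<parallel>w\<parallel>\<close> and \<open>\<parallel>w\<parallel>\<^sup>2 \<le> n t + n\<^sup>2 t\<^sup>2 / 2\<close>, so \<open>n t \<le> 2\<close>, which is
  false for large \<open>n\<close>.
\<close>

lemma no_minimal_projection:
  fixes e :: "'a l2 \<Rightarrow>\<^sub>L 'a l2"
  assumes inf: "infinite (carrier G)"
    and e: "e \<in> equivariant (carrier G)" "proj_op e" "Q o\<^sub>L e = e" "e \<noteq> 0"
  shows "\<exists>P\<in>equivariant (carrier G). proj_op P \<and> e o\<^sub>L P = P \<and> P \<noteq> 0 \<and> P \<noteq> e"
proof (rule ccontr)
  assume "\<not> ?thesis"
  then have min: "\<And>P. P \<in> equivariant (carrier G) \<Longrightarrow> proj_op P \<Longrightarrow> e o\<^sub>L P = P \<Longrightarrow> P \<noteq> 0 \<Longrightarrow> P = e"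
    by blast
  note cl = equivariantD(1)[OF e(1)]
  have self: "cinner (e f) g = cinner f (e g)" for f g
    using cinner_adj_right[OF cl] e(2) by (simp add: proj_op_def)
  have idem: "e (e f) = e f" for f using proj_op_inner(3)[OF e(2)] .
  have lam_adj: "cinner (lam g f) h = cinner f (lam (inv g) h)"
    and rho_adj: "cinner (rho g f) h = cinner f (rho (inv g) h)" if "g \<in> carrier G" for g f h
    using cinner_adj_right[OF clinear_group_ops(1)[OF that]]
      cinner_adj_right[OF clinear_group_ops(2)[OF that]] adj_lam[OF that] adj_rho[OF that] by simp_all
  define \<eta> where "\<eta> = e (basis \<one>)"
  define t where "t = \<eta> \<bullet> basis \<one>"
  have t: "t > 0" unfolding t_def \<eta>_def by (rule trace_pos[OF e])
  have e\<eta>: "e \<eta> = \<eta>" by (simp add: \<eta>_def idem)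
  have eb: "e (basis g) = lam g \<eta>" if "g \<in> carrier G" for g
    using equivariantD(2)[OF e(1) that, of "basis \<one>"] that by (simp add: \<eta>_def lam_basis)
  have sym: "coord \<eta> (inv g) = cnj (coord \<eta> g)" if g: "g \<in> carrier G" for g
  proof -
    have "coord \<eta> g = cinner (basis \<one>) (lam g \<eta>)"
      using eb[OF g] self[of "basis \<one>" "basis g"] by (simp add: \<eta>_def cinner_basis_right)
    also have "\<dots> = cnj (coord (lam g \<eta>) \<one>)"
      using cinner_cnj[of "basis \<one>"] by (simp add: cinner_basis_right)
    finally show ?thesis using g by (simp add: coord_lam)
  qed
  have \<eta>1: "coord \<eta> \<one> = complex_of_real t"
    using sym[of \<one>] by (auto simp: complex_eq_iff t_def inner_basis)
  \<comment> \<open>Since \<open>\<eta>(x\<^sup>-\<^sup>1)\<close> is the conjugate of \<open>\<eta>(x)\<close>, the substitution \<open>x \<mapsto> x\<^sup>-\<^sup>1\<close> turns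
    \<open>\<langle>\<rho>(g) \<eta>, \<eta>\<rangle>\<close> into \<open>\<langle>\<eta>, \<lambda>(g) \<eta>\<rangle> = (e \<eta>)(g)\<close>.\<close>
  have coeff: "cinner (rho g \<eta>) \<eta> = coord \<eta> g" if g: "g \<in> carrier G" for g
  proof -
    have bij: "bij_betw (\<lambda>x. inv x) (carrier G) (carrier G)"
      by (rule bij_betw_byWitness[where f' = "\<lambda>x. inv x"]) auto
    have "coord \<eta> g = cinner \<eta> (lam g \<eta>)"
      using eb[OF g] self[of \<eta> "basis g"] e\<eta> by (simp add: cinner_basis_right)
    also have "\<dots> = (\<Sum>\<^sub>\<infinity>y. if y \<in> carrier G then coord \<eta> y * cnj (coord \<eta> (inv g \<otimes> y)) else 0)"
      unfolding cinner_def ell2_inner_def using g by (intro infsum_cong) (simp add: coord_lam)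
    also have "\<dots> = (\<Sum>\<^sub>\<infinity>x. if x \<in> carrier G then coord \<eta> (inv x) * cnj (coord \<eta> (inv g \<otimes> inv x)) else 0)"
      by (rule infsum_support[OF bij, symmetric])
    also have "\<dots> = cinner (rho g \<eta>) \<eta>"
      unfolding cinner_def ell2_inner_def
    proof (rule infsum_cong)
      fix x
      show "(if x \<in> carrier G then coord \<eta> (inv x) * cnj (coord \<eta> (inv g \<otimes> inv x)) else 0)
        = coord (rho g \<eta>) x * cnj (coord \<eta> x)"
        using g sym[of x] sym[of "x \<otimes> g"]
        by (cases "x \<in> carrier G") (simp_all add: coord_rho inv_mult_group[symmetric] mult.commute)
    qed
    finally show ?thesis by simp
  qed
  have corner: "e (rho g (e f)) = scaleC (coord \<eta> g / t) (e f)" if g: "g \<in> carrier G" for g f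
  proof -
    obtain c where c: "\<And>f. e (rho g (e f)) = scaleC c (e f)"
      using minimal_projection_complex_scalar[OF e(1,2,4) min rho_equivariant[OF g]] by blast
    have "coord \<eta> g = cinner (e (rho g (e (basis \<one>)))) (basis \<one>)"
      using coeff[OF g] self[of "rho g \<eta>" "basis \<one>"] by (simp add: \<eta>_def)
    also have "\<dots> = c * complex_of_real t"
      unfolding c by (simp add: cinner_basis_right scaleC.rep_eq \<eta>1 flip: \<eta>_def)
    finally have "c = coord \<eta> g / t" using t by (simp add: field_simps)
    then show ?thesis using c by simp
  qed
  define v where "v = (\<lambda>a. rho a (e (basis a)))"
  have v1: "v a \<bullet> basis \<one> = t" if a: "a \<in> carrier G" for a
  proof -
    have "cinner (v a) (basis \<one>) = cinner (e (basis a)) (basis a)"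
      using a by (simp add: v_def rho_adj rho_basis)
    also have "\<dots> = coord (lam a \<eta>) a" using eb[OF a] by (simp add: cinner_basis_right)
    also have "\<dots> = complex_of_real t" using a \<eta>1 by (simp add: coord_lam)
    finally show ?thesis by (simp flip: Re_cinner)
  qed
  have vv: "v a \<bullet> v b = (cmod (coord \<eta> (inv b \<otimes> a)))\<^sup>2 / t"
    if a: "a \<in> carrier G" and b: "b \<in> carrier G" for a b
  proof -
    let ?k = "inv b \<otimes> a"
    have k: "?k \<in> carrier G" "inv ?k = inv a \<otimes> b" using a b by (auto simp: inv_mult_group)
    have "cinner (v a) (v b) = cinner (rho (inv b) (rho a (e (basis a)))) (e (basis b))"
      using rho_adj[of "inv b" "v a" "e (basis b)"] b by (simp add: v_def)
    also have "\<dots> = cinner (e (rho ?k (e (basis a)))) (basis b)"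
      using a b by (simp add: rho_mult self)
    also have "\<dots> = coord \<eta> ?k / t * coord (lam a \<eta>) b"
      using corner[OF k(1), of "basis a"] eb[OF a] by (simp add: scaleC.rep_eq cinner_basis_right)
    also have "coord (lam a \<eta>) b = cnj (coord \<eta> ?k)"
      using sym[OF k(1)] k(2) a b by (simp add: coord_lam)
    also have "coord \<eta> ?k / t * cnj (coord \<eta> ?k) = complex_of_real ((cmod (coord \<eta> ?k))\<^sup>2 / t)"
      by (simp add: complex_norm_square del: of_real_power)
    finally show ?thesis by (simp flip: Re_cinner)
  qed
  \<comment> \<open>The threshold \<open>t\<^sup>3 / 2\<close> is the bound \<open>t\<^sup>2 / 2\<close> for the inner products, multiplied by \<open>t\<close>.\<close>
  define B where "B = {g. (cmod (coord \<eta> g))\<^sup>2 > t ^ 3 / 2}"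
  have finB: "finite B"
  proof (rule ccontr)
    assume "infinite B"
    obtain n :: nat where n: "(norm \<eta>)\<^sup>2 / (t ^ 3 / 2) < real n" using reals_Archimedean2 by blast
    obtain F where F: "F \<subseteq> B" "finite F" "card F = n"
      using infinite_arbitrarily_large[OF \<open>infinite B\<close>] by blast
    have "real n * (t ^ 3 / 2) = (\<Sum>x\<in>F. t ^ 3 / 2)" using F by simp
    also have "\<dots> \<le> (\<Sum>x\<in>F. (cmod (coord \<eta> x))\<^sup>2)"
      using F by (intro sum_mono) (auto simp: B_def)
    also have "\<dots> \<le> (norm \<eta>)\<^sup>2" by (rule norm_l2_finite_sum_le[OF F(2)])
    finally show False using n t by (simp add: field_simps)
  qed
  obtain n :: nat where n: "2 / t < real n" using reals_Archimedean2 by blast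
  define bad where "bad = (\<lambda>b. (\<lambda>k. b \<otimes> k) ` B)"
  have "\<And>b. finite (bad b)" using finB by (simp add: bad_def)
  from infinite_spread_set[where bad = bad and n = n, OF inf this] obtain A where A: "finite A" "card A = n"
    "A \<subseteq> carrier G" "\<forall>a\<in>A. \<forall>b\<in>A. a \<noteq> b \<longrightarrow> a \<notin> bad b \<or> b \<notin> bad a"
    by (elim exE conjE) (rule that)
  have small: "v a \<bullet> v b \<le> t\<^sup>2 / 2" if ab: "a \<in> A" "b \<in> A" "a \<noteq> b" for a b
  proof -
    have c: "a \<in> carrier G" "b \<in> carrier G" using ab A by auto
    have half: "v a \<bullet> v b \<le> t\<^sup>2 / 2" if "a \<notin> bad b" "a \<in> carrier G" "b \<in> carrier G" for a b
    proof -
      have "inv b \<otimes> a \<notin> B"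
      proof
        assume "inv b \<otimes> a \<in> B"
        then have "b \<otimes> (inv b \<otimes> a) \<in> bad b" by (simp add: bad_def)
        then show False using that by (simp add: m_assoc[symmetric])
      qed
      then have "(cmod (coord \<eta> (inv b \<otimes> a)))\<^sup>2 \<le> t ^ 3 / 2" by (simp add: B_def)
      then have "(cmod (coord \<eta> (inv b \<otimes> a)))\<^sup>2 / t \<le> t ^ 3 / 2 / t"
        using t by (intro divide_right_mono) auto
      then show ?thesis using vv that t by (simp add: power3_eq_cube power2_eq_square)
    qed
    from A(4)[rule_format, OF ab] have "a \<notin> bad b \<or> b \<notin> bad a" .
    then show ?thesis using half[of a b] half[of b a] c by (auto simp: inner_commute)
  qed
  have diag: "v a \<bullet> v a = t" if "a \<in> A" for a
    using vv[of a a] A(3) that t \<eta>1 by (auto simp: power2_eq_square)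
  define w where "w = (\<Sum>a\<in>A. v a)"
  have "real n * t = w \<bullet> basis \<one>"
    using A by (simp add: w_def inner_sum_left v1 subset_iff)
  also have "\<dots> \<le> norm w" using norm_cauchy_schwarz[of w "basis \<one>"] by simp
  finally have "(real n * t)\<^sup>2 \<le> (norm w)\<^sup>2" using t by (intro power_mono) auto
  also have "(norm w)\<^sup>2 = (\<Sum>a\<in>A. \<Sum>b\<in>A. v a \<bullet> v b)"
    unfolding w_def power2_norm_eq_inner inner_sum_left inner_sum_right by (rule sum.swap)
  also have "\<dots> \<le> (\<Sum>a\<in>A. \<Sum>b\<in>A. (if a = b then t else 0) + t\<^sup>2 / 2)"
    using small diag t by (intro sum_mono) auto
  also have "\<dots> = real n * t + real n * real n * (t\<^sup>2 / 2)"
    using A(1,2) by (simp add: sum.distrib algebra_simps)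
  also have "real n * real n * (t\<^sup>2 / 2) = (real n * t)\<^sup>2 / 2"
    by (simp add: power2_eq_square)
  finally have "(real n * t) * (real n * t) \<le> (real n * t) * 2"
    unfolding power2_eq_square by linarith
  moreover have "real n > 0" by (rule less_trans[OF _ n]) (use t in simp)
  then have "real n * t > 0" using t by simp
  ultimately have "real n * t \<le> 2" by (rule mult_left_le_imp_le)
  then show False using n t by (simp add: field_simps)
qed

text \<open>
  Take a projection \<open>r\<close> of trace at most \<open>\<alpha>\<close> that cannot be enlarged. If its trace were smaller than
  \<open>\<alpha>\<close>, all nonzero projections below \<open>1 - r\<close> would have trace above the gap \<open>\<alpha> - \<tau>(r)\<close>. One
  whose trace is within this gap of the infimum could then not be split any further, contradicting
  \<open>no_minimal_projection\<close>.
\<close>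

lemma projection_of_trace:
  assumes inf: "infinite (carrier G)" and \<alpha>: "0 \<le> \<alpha>" "\<alpha> \<le> 1"
  shows "\<exists>r\<in>equivariant (carrier G). proj_op r \<and> Q o\<^sub>L r = r \<and> r (basis \<one>) \<bullet> basis \<one> = \<alpha>"
proof -
  interpret C: adj_closed "symmetries (carrier G)" by (rule adj_closed_symmetries[OF subgroup_self])
  define \<tau> where "\<tau> = (\<lambda>r :: 'a l2 \<Rightarrow>\<^sub>L 'a l2. r (basis \<one>) \<bullet> basis \<one>)"
  have \<tau>_add: "\<tau> (r + s) = \<tau> r + \<tau> s" "\<tau> (r - s) = \<tau> r - \<tau> s" for r s
    by (simp_all add: \<tau>_def blinfun.bilinear_simps inner_simps)
  define D where "D = {r \<in> equivariant (carrier G). proj_op r \<and> Q o\<^sub>L r = r}"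
  have pos: "\<tau> r \<ge> 0" "r \<noteq> 0 \<Longrightarrow> \<tau> r > 0" if "r \<in> D" for r
    using that proj_op_inner(2)[of r "basis \<one>"] trace_pos[of r] by (auto simp: D_def \<tau>_def)
  define X where "X = {r \<in> D. \<tau> r \<le> \<alpha>}"
  define rel where "rel = (\<lambda>r s. r \<in> X \<and> s \<in> X \<and> s o\<^sub>L r = r)"
  have Xp: "proj_op r" "r o\<^sub>L r = r" "adj r = r" if "r \<in> X" for r
    using that by (auto simp: X_def D_def proj_op_def)
  have "\<exists>r\<in>X. \<forall>s\<in>X. rel r s \<longrightarrow> \<tau> s = \<tau> r"
  proof (rule greedy_maximal[where B = \<alpha> and ?x0.0 = 0])
    show "0 \<in> X" using \<alpha>
      by (simp add: X_def D_def \<tau>_def proj_op_def comp_algebra C.commutant_alg)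
    show "rel r r" if "r \<in> X" for r using Xp[OF that] that by (simp add: rel_def)
    show "rel r u" if "rel r s" "rel s u" for r s u
      using that unfolding rel_def by (metis comp_assoc)
    show "\<tau> r \<le> \<alpha>" if "r \<in> X" for r using that by (simp add: X_def)
    show "\<tau> r \<le> \<tau> s" if "r \<in> X" "s \<in> X" "rel r s" for r s
    proof -
      have "proj_op (s - r)"
        using that Xp by (intro proj_op_diff(1)) (auto simp: rel_def)
      then have "\<tau> (s - r) \<ge> 0" unfolding \<tau>_def by (simp add: proj_op_inner(2))
      then show ?thesis by (simp add: \<tau>_add)
    qed
    show "\<exists>W\<in>X. \<forall>n. rel (f n) W" if fX: "\<And>n. f n \<in> X" and fr: "\<And>n. rel (f n) (f (Suc n))"
      for f :: "nat \<Rightarrow> 'a l2 \<Rightarrow>\<^sub>L 'a l2"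
    proof -
      have ff: "adj (f n) o\<^sub>L f n = f n" for n using Xp[OF fX[of n]] by simp
      have pi: "partial_isometry (f n)" for n using Xp[OF fX] by (simp add: partial_isometry_def ff)
      have ch: "f n = f (Suc n) o\<^sub>L (adj (f n) o\<^sub>L f n)" for n
        using fr[of n] unfolding ff by (simp add: rel_def)
      obtain W :: "'a l2 \<Rightarrow>\<^sub>L 'a l2" where W: "\<And>x. (\<lambda>n. f n x) \<longlonglongrightarrow> W x" "\<And>n. f n = W o\<^sub>L f n"
        using partial_isometry_chain_limit[of f, OF pi ch] unfolding ff by blast
      have fD: "f n \<in> equivariant (carrier G)" "Q o\<^sub>L f n = f n" "\<tau> (f n) \<le> \<alpha>" for n
        using fX[of n] by (auto simp: X_def D_def)
      have "W \<in> equivariant (carrier G)" by (rule C.commutant_strong_limit[OF fD(1) W(1)])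
      moreover have lim: "S (W x) = W x" if S: "\<And>n. S o\<^sub>L f n = f n" for S :: "'a l2 \<Rightarrow>\<^sub>L 'a l2" and x
      proof -
        have "(\<lambda>n. S (f n x)) \<longlonglongrightarrow> S (W x)"
          by (intro bounded_linear.tendsto[OF blinfun.bounded_linear_right] W(1))
        then have "(\<lambda>n. f n x) \<longlonglongrightarrow> S (W x)" using comp_apply[OF S] by simp
        then show ?thesis by (rule LIMSEQ_unique[OF _ W(1)])
      qed
      have "W o\<^sub>L W = W" "Q o\<^sub>L W = W"
        using lim[of W] W(2) lim[of Q] fD(2) by (auto intro!: blinfun_eqI)
      moreover have "adj W = W"
      proof (rule adj_eqI)
        fix x y
        have "f n x \<bullet> y = x \<bullet> f n y" for n using proj_op_inner(1)[OF Xp(1)[OF fX]] .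
        moreover have "(\<lambda>n. f n x \<bullet> y) \<longlonglongrightarrow> W x \<bullet> y" "(\<lambda>n. x \<bullet> f n y) \<longlonglongrightarrow> x \<bullet> W y"
          by (intro tendsto_inner tendsto_const W(1))+
        ultimately show "W x \<bullet> y = x \<bullet> W y" using LIMSEQ_unique by simp
      qed
      moreover have "\<tau> W \<le> \<alpha>"
      proof (rule LIMSEQ_le_const2)
        show "(\<lambda>n. \<tau> (f n)) \<longlonglongrightarrow> \<tau> W" unfolding \<tau>_def by (intro tendsto_inner tendsto_const W(1))
      qed (use fD(3) in blast)
      ultimately have "W \<in> X" by (simp add: X_def D_def proj_op_def)
      then show ?thesis unfolding rel_def using fX W(2) by metis
    qed
  qed
  then obtain r where rX: "r \<in> X" and max: "\<And>s. s \<in> X \<Longrightarrow> rel r s \<Longrightarrow> \<tau> s = \<tau> r" by blast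
  have r: "r \<in> equivariant (carrier G)" "proj_op r" "Q o\<^sub>L r = r" using rX by (auto simp: X_def D_def)
  have "\<tau> r = \<alpha>"
  proof (rule ccontr)
    assume "\<tau> r \<noteq> \<alpha>"
    then have lt: "\<tau> r < \<alpha>" using rX by (auto simp: X_def)
    define Y where "Y = {f \<in> D. f \<noteq> 0 \<and> (Q - r) o\<^sub>L f = f}"
    have QC: "Q \<in> equivariant (carrier G)" by (rule restr_equivariant[OF subgroup_self])
    have Qr: "proj_op (Q - r)" "Q o\<^sub>L (Q - r) = Q - r" "r o\<^sub>L (Q - r) = 0"
      using proj_op_diff[OF r(2) proj_restr r(3)] by auto
    have "\<tau> Q = 1" by (simp add: \<tau>_def restr_basis power2_norm_eq_inner[symmetric])
    then have "\<tau> (Q - r) \<noteq> 0" using lt \<alpha> by (simp add: \<tau>_add)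
    then have "Q - r \<noteq> 0" by (auto simp: \<tau>_def)
    then have Yne: "Q - r \<in> Y"
      using Qr C.commutant_alg(4)[OF QC r(1)] by (auto simp: Y_def D_def proj_op_def)
    have big: "\<tau> f > \<alpha> - \<tau> r" if f: "f \<in> Y" for f
    proof (rule ccontr)
      assume neg: "\<not> \<tau> f > \<alpha> - \<tau> r"
      have f': "f \<in> equivariant (carrier G)" "proj_op f" "Q o\<^sub>L f = f" "(Q - r) o\<^sub>L f = f"
        using f by (auto simp: Y_def D_def)
      have rf: "r o\<^sub>L f = 0" using Qr(3) f'(4) by (metis comp_assoc comp_algebra(9))
      from proj_op_add[OF r(2) f'(2) this]
      have "r + f \<in> X" "f o\<^sub>L r = 0"
        using C.commutant_alg(3)[OF r(1) f'(1)] r f' neg by (auto simp: X_def D_def comp_algebra \<tau>_add)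
      moreover have "r o\<^sub>L r = r" using r(2) by (simp add: proj_op_def)
      ultimately have "rel r (r + f)" using rX by (simp add: rel_def comp_algebra)
      from max[OF \<open>r + f \<in> X\<close> this] have "\<tau> f = 0" by (simp add: \<tau>_add)
      then show False using pos(2)[of f] f by (auto simp: Y_def)
    qed
    define m where "m = Inf (\<tau> ` Y)"
    have bdd: "bdd_below (\<tau> ` Y)" using pos(1) by (intro bdd_belowI2[where m = 0]) (auto simp: Y_def)
    have ml: "m \<le> \<tau> f" if "f \<in> Y" for f unfolding m_def using bdd that by (intro cInf_lower) auto
    have "\<exists>x\<in>\<tau> ` Y. x < m + (\<alpha> - \<tau> r)"
    proof (rule cInf_lessD)
      show "\<tau> ` Y \<noteq> {}" using Yne by blast
      show "Inf (\<tau> ` Y) < m + (\<alpha> - \<tau> r)" using lt unfolding m_def by simp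
    qed
    then obtain f where f: "f \<in> Y" "\<tau> f < m + (\<alpha> - \<tau> r)" by blast
    have f': "f \<in> equivariant (carrier G)" "proj_op f" "Q o\<^sub>L f = f" "f \<noteq> 0" "(Q - r) o\<^sub>L f = f"
      using f by (auto simp: Y_def D_def)
    from no_minimal_projection[OF inf f'(1-4)] obtain P where
      P: "P \<in> equivariant (carrier G)" "proj_op P" "f o\<^sub>L P = P" "P \<noteq> 0" "P \<noteq> f" by blast
    have "Q o\<^sub>L P = P" "(Q - r) o\<^sub>L P = P" using P(3) f'(3,5) by (metis comp_assoc)+
    then have PY: "P \<in> Y" using P by (simp add: Y_def D_def)
    have fP: "f o\<^sub>L (f - P) = f - P" "proj_op (f - P)" using proj_op_diff[OF P(2) f'(2) P(3)] by auto
    have "Q o\<^sub>L (f - P) = f - P" "(Q - r) o\<^sub>L (f - P) = f - P"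
      using fP(1) f'(3,5) by (metis comp_assoc)+
    then have "f - P \<in> Y" using P(5) fP C.commutant_alg(4)[OF f'(1) P(1)] by (auto simp: Y_def D_def)
    from big[OF this] ml[OF PY] f(2) show False by (simp add: \<tau>_add)
  qed
  then show ?thesis using r by (auto simp: \<tau>_def)
qed

end

context group
begin

section \<open>Frame operators that are bounded below on the subgroup\<close>

lemma basis_outside:
  assumes "x \<notin> carrier G" "g \<in> carrier G"
  shows "lam g (basis x) = 0"
  using assms by (intro l2_eqI) (auto simp: coord_lam coord_basis zero_l2.rep_eq)

text \<open>
  An operator of the form \<open>\<delta>\<^sub>x \<mapsto> \<lambda>(x) \<xi>\<close> commutes with left translations; it suffices to check this
  on the basis vectors.
\<close>

lemma equivariant_basisI:
  fixes T :: "'a l2 \<Rightarrow>\<^sub>L 'a l2"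
  assumes T: "clinear_op T" "\<And>x. x \<in> carrier G \<Longrightarrow> T (basis x) = lam x \<xi>"
    "\<And>x. x \<notin> carrier G \<Longrightarrow> T (basis x) = 0"
  shows "T \<in> equivariant (carrier G)"
proof (rule equivariantI[OF T(1)])
  fix g f assume g: "g \<in> carrier G"
  have "lam g o\<^sub>L T = T o\<^sub>L lam g"
  proof (rule clinear_op_eqI)
    fix x
    show "(lam g o\<^sub>L T) (basis x) = (T o\<^sub>L lam g) (basis x)"
      using T(2,3) g by (cases "x \<in> carrier G")
        (simp_all add: lam_mult lam_basis basis_outside blinfun.zero_right)
  qed (intro clinear_op_comp clinear_group_ops g T(1))+
  from comp_apply[OF this, of f] show "lam g (T f) = T (lam g f)" by simp
qed

lemma norm_lam:
  assumes "g \<in> carrier G" "Q f = f"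
  shows "norm (lam g f) = norm f"
proof -
  have "(norm (lam g f))\<^sup>2 = f \<bullet> adj (lam g) (lam g f)"
    by (simp add: power2_norm_eq_inner adj_right)
  also have "\<dots> = (norm f)\<^sup>2"
    using assms by (simp add: adj_lam lam_mult lam_one power2_norm_eq_inner)
  finally show ?thesis by simp
qed

text \<open>
  A transversal of the right cosets meets \<open>H\<close> at most once.
\<close>

lemma coset_trace_restr_le_one:
  assumes H: "subgroup H G" and R: "transversal H R"
  shows "coset_trace R (restr H) \<le> 1"
proof -
  interpret H: subgroup H G by fact
  have RG: "finite R" "R \<subseteq> carrier G" using R by (auto simp: transversal_def)
  have "card (R \<inter> H) \<le> 1"
  proof (rule ccontr)
    assume "\<not> ?thesis"
    then obtain r s where rs: "r \<in> R" "r \<in> H" "s \<in> R" "s \<in> H" "r \<noteq> s"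
      using RG by (metis IntE card_le_Suc0_iff_eq finite_Int One_nat_def)
    then have "H #> r = H" "H #> s = H" using RG coset_join2 H by auto
    then have "\<one> \<in> (H #> r) \<inter> (H #> s)" by simp
    then show False using R rs unfolding transversal_def by blast
  qed
  moreover have "coset_trace R (restr H) = real (card (R \<inter> H))"
  proof -
    have "coset_trace R (restr H) = (\<Sum>r\<in>R. if r \<in> H then 1 else 0)"
      unfolding coset_trace_proj[OF proj_restr] by (intro sum.cong) (auto simp: restr_basis)
    also have "\<dots> = real (card (R \<inter> H))" using RG by (simp add: sum.If_cases)
    finally show ?thesis .
  qed
  ultimately show ?thesis by simp
qed

text \<open>
  For \<open>W\<close> with these properties, \<open>W \<delta>\<^sub>e\<close> is a Parseval frame vector for \<open>p\<close>, and the orbit of it under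
  \<open>H\<close> is a Riesz sequence. Inside the proof, \<open>V\<close> embeds \<open>l\<^sup>2(H)\<close> into \<open>p\<close> with respect to \<open>H\<close>, \<open>T\<close> is
  its \<open>G\<close>-equivariant extension, \<open>U\<close> is the polar part of \<open>T\<close>, and \<open>U'\<close> embeds \<open>p - U U\<^sup>*\<close> into the
  orthogonal complement of the initial space of \<open>U\<close>.
\<close>

theorem frame_operator_exists:
  assumes icc: "icc_group G" and H: "subgroup H G" and iccH: "icc_group (G\<lparr>carrier := H\<rparr>)"
    and R: "transversal H R"
    and p: "p \<in> equivariant (carrier G)" "proj_op p" "Q o\<^sub>L p = p"
    and tr: "p (basis \<one>) \<bullet> basis \<one> \<ge> 1 / real (card R)" and card: "card R > 0"
  shows "\<exists>W\<in>equivariant (carrier G). partial_isometry W \<and> W o\<^sub>L adj W = p \<and>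
     p o\<^sub>L W = W \<and> W o\<^sub>L Q = W \<and> (\<exists>c>0. \<forall>f. restr H f = f \<longrightarrow> c * norm f \<le> norm (W f))"
proof -
  interpret H: subgroup H G by fact
  interpret C: adj_closed "symmetries (carrier G)" by (rule adj_closed_symmetries[OF subgroup_self])
  have RG: "finite R" "R \<subseteq> carrier G" using R by (auto simp: transversal_def)
  have pp: "p o\<^sub>L p = p" "adj p = p" using p by (auto simp: proj_op_def)
  have QQ: "Q o\<^sub>L Q = Q" "adj Q = Q" using proj_restr by (auto simp: proj_op_def)
  define q where "q = restr H"
  have q: "q \<in> equivariant H" "proj_op q" "Q o\<^sub>L q = q"
    using restr_equivariant[OF H] proj_restr H.subset
    by (auto simp: q_def coord_restr intro!: blinfun_eqI l2_eqI)
  have pH: "p \<in> equivariant H" using equivariant_mono[OF H.subset] p(1) by blast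
  have "coset_trace R q \<le> coset_trace R p"
  proof -
    have "1 \<le> coset_trace R p"
      using tr card unfolding coset_trace_index[OF R p(1)] by (simp add: field_simps)
    then show ?thesis using coset_trace_restr_le_one[OF H R] by (simp add: q_def)
  qed
  from comparison[OF H iccH R q pH p(2,3) this] obtain V where
    V: "V \<in> equivariant H" "adj V o\<^sub>L V = q" "partial_isometry V" "p o\<^sub>L V = V" by blast
  have Vq: "V o\<^sub>L q = V" using partial_isometry_comp[OF V(3)] V(2) by simp
  have Vout: "V (basis x) = 0" if "x \<notin> H" for x
    using comp_apply[OF Vq, of "basis x"] that by (simp add: q_def restr_basis blinfun.zero_right)
  define \<xi> where "\<xi> = V (basis \<one>)"
  have Vin: "V (basis h) = lam h \<xi>" if "h \<in> H" for h
    using equivariantD(2)[OF V(1) that, of "basis \<one>"] that by (simp add: \<xi>_def lam_basis H.mem_carrier)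
  \<comment> \<open>\<open>R\<close> represents the right cosets, so the inverses of its elements represent the left cosets. The
    summand of \<open>r\<close> is the copy of \<open>V\<close> on \<open>l\<^sup>2(r\<^sup>-\<^sup>1H)\<close>; exactly one summand acts on each \<open>\<delta>\<^sub>x\<close>.\<close>
  define T where "T = (\<Sum>r\<in>R. lam (inv r) o\<^sub>L (V o\<^sub>L lam r))"
  have Tf: "T f = (\<Sum>r\<in>R. lam (inv r) (V (lam r f)))" for f
    by (simp add: T_def blinfun.sum_left)
  have Tcl: "clinear_op T"
  proof -
    have "lam (inv r) (V (lam r (scaleC \<i> f))) = scaleC \<i> (lam (inv r) (V (lam r f)))" if "r \<in> R" for r f
      using that RG equivariantD(1)[OF V(1)] clinear_group_ops(1)[of r] clinear_group_ops(1)[of "inv r"]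
      by (auto simp: clinear_op_def)
    then show ?thesis
      by (simp add: clinear_op_def Tf linear_sum[OF bounded_linear.linear[OF bounded_linear_scaleC]])
  qed
  have Tin: "T (basis x) = lam x \<xi>" if x: "x \<in> carrier G" for x
  proof -
    have "inv x \<in> (\<Union>r\<in>R. H #> r)" using R x unfolding transversal_def by simp
    then obtain r h where rh: "r \<in> R" "h \<in> H" "inv x = h \<otimes> r" unfolding r_coset_def by blast
    have c: "r \<in> carrier G" "h \<in> carrier G" using rh RG H.mem_carrier by auto
    have "x = inv (h \<otimes> r)" using rh(3) x by (metis inv_inv)
    then have x': "x = inv r \<otimes> inv h" using c by (simp add: inv_mult_group)
    have rx: "r \<otimes> x = inv h" using c by (simp add: x' m_assoc[symmetric])
    have 0: "lam (inv s) (V (lam s (basis x))) = 0" if s: "s \<in> R" "s \<noteq> r" for s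
    proof -
      have sc: "s \<in> carrier G" using s RG by auto
      have "s \<otimes> x \<notin> H"
      proof
        assume "s \<otimes> x \<in> H"
        then have "inv (s \<otimes> x) \<in> H" by (rule H.m_inv_closed)
        moreover have "inv (s \<otimes> x) \<otimes> s = inv x" using sc x by (simp add: inv_mult_group m_assoc)
        ultimately have "inv x \<in> H #> s" unfolding r_coset_def by force
        moreover have "inv x \<in> H #> r" using rh unfolding r_coset_def by force
        ultimately show False using R s rh(1) unfolding transversal_def by blast
      qed
      then show ?thesis using sc x by (simp add: lam_basis Vout blinfun.zero_right)
    qed
    have "T (basis x) = lam (inv r) (V (lam r (basis x)))"
      unfolding Tf using RG(1) rh(1) 0 by (simp add: sum.remove)
    also have "\<dots> = lam (inv r) (lam (inv h) \<xi>)"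
      using Vin[of "inv h"] rh c x by (simp add: lam_basis rx)
    also have "\<dots> = lam x \<xi>" using c by (simp add: lam_mult x')
    finally show ?thesis .
  qed
  have Tout: "T (basis x) = 0" if "x \<notin> carrier G" for x
    unfolding Tf using that RG by (intro sum.neutral) (auto simp: basis_outside blinfun.zero_right)
  have T: "T \<in> equivariant (carrier G)" by (rule equivariant_basisI[OF Tcl Tin Tout])
  have "T o\<^sub>L q = V"
  proof (rule clinear_op_eqI)
    show "clinear_op (T o\<^sub>L q)" unfolding q_def by (intro clinear_op_comp Tcl clinear_group_ops)
    show "clinear_op V" by (rule equivariantD(1)[OF V(1)])
    show "(T o\<^sub>L q) (basis x) = V (basis x)" for x
      by (cases "x \<in> H") (simp_all add: q_def restr_basis Tin Vin Vout H.mem_carrier blinfun.zero_right)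
  qed
  then have Tiso: "norm (T f) = norm f" if "restr H f = f" for f
    using comp_apply[OF \<open>T o\<^sub>L q = V\<close>, of f] that partial_isometry_norm[OF V(3), of f] V(2)
    by (simp add: q_def)
  have pT: "p o\<^sub>L T = T"
  proof (rule blinfun_eqI)
    fix f
    have "p (lam (inv r) (V (lam r f))) = lam (inv r) (V (lam r f))" if "r \<in> R" for r
      using equivariantD(2)[OF p(1), of "inv r" "V (lam r f)"] comp_apply[OF V(4)] that RG by auto
    then show "(p o\<^sub>L T) f = T f" by (simp add: Tf blinfun.sum_right)
  qed
  have TQ: "T o\<^sub>L Q = T"
    by (rule clinear_op_eqI)
      (auto simp: restr_basis Tout blinfun.zero_right intro: clinear_op_comp Tcl clinear_group_ops)
  obtain U where U: "U \<in> equivariant (carrier G)" "partial_isometry U"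
    "\<And>A :: 'a l2 \<Rightarrow>\<^sub>L 'a l2. T o\<^sub>L A = 0 \<Longrightarrow> U o\<^sub>L A = 0"
    "\<And>A :: 'a l2 \<Rightarrow>\<^sub>L 'a l2. A o\<^sub>L T = 0 \<Longrightarrow> A o\<^sub>L U = 0"
    "\<And>y. norm (T y) \<le> norm T * norm (U y)"
    using C.polar_decomposition[OF T] by blast
  have "T o\<^sub>L (id_blinfun - Q) = 0" "(id_blinfun - p) o\<^sub>L T = 0" using pT TQ by (simp_all add: comp_algebra)
  from U(3)[OF this(1)] U(4)[OF this(2)] have UQ: "U o\<^sub>L Q = U" and pU: "p o\<^sub>L U = U"
    by (simp_all add: comp_algebra)
  have UC: "adj U \<in> equivariant (carrier G)" by (rule C.commutant_adj[OF U(1)])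
  define E F where "E = adj U o\<^sub>L U" and "F = U o\<^sub>L adj U"
  have "adj (U o\<^sub>L Q) = adj U" using UQ by (rule arg_cong)
  then have QU: "Q o\<^sub>L adj U = adj U" using QQ by simp
  have E: "E \<in> equivariant (carrier G)" "proj_op E" "Q o\<^sub>L E = E"
    using C.commutant_alg(7)[OF UC U(1)] U(2) QU
    by (auto simp: E_def partial_isometry_def comp_assoc[symmetric])
  have F: "F \<in> equivariant (carrier G)" "proj_op F" "p o\<^sub>L F = F"
    using C.commutant_alg(7)[OF U(1) UC] partial_isometry_final_proj[OF U(2)] pU
    by (auto simp: F_def comp_assoc[symmetric])
  define p1 q1 where "p1 = p - F" and "q1 = Q - E"
  have QC: "Q \<in> equivariant (carrier G)" by (rule restr_equivariant[OF subgroup_self])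
  have p1: "p1 \<in> equivariant (carrier G)" "proj_op p1" "p o\<^sub>L p1 = p1"
    using proj_op_diff[OF F(2) p(2) F(3)] C.commutant_alg(4)[OF p(1) F(1)] by (auto simp: p1_def)
  have Qp1: "Q o\<^sub>L p1 = p1" using p1(3) p(3) by (metis comp_assoc)
  have q1: "q1 \<in> equivariant (carrier G)" "proj_op q1" "Q o\<^sub>L q1 = q1"
    using proj_op_diff[OF E(2) proj_restr E(3)] C.commutant_alg(4)[OF QC E(1)] by (auto simp: q1_def)
  have "coset_trace {\<one>} p1 \<le> coset_trace {\<one>} q1"
  proof -
    have "Q o\<^sub>L U = U" using pU p(3) by (metis comp_assoc)
    from coset_trace_comm[OF subgroup_self transversal_carrier U(1) this]
    have "coset_trace {\<one>} E = coset_trace {\<one>} F" by (simp add: E_def F_def)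
    moreover have "coset_trace {\<one>} p \<le> 1"
      using proj_op_norm_le[OF p(2), of "basis \<one>"]
      by (simp add: coset_trace_proj[OF p(2)] power_le_one)
    moreover have "coset_trace {\<one>} Q = 1" by (simp add: coset_trace_proj[OF proj_restr] restr_basis)
    ultimately show ?thesis by (simp add: p1_def q1_def coset_trace_diff)
  qed
  moreover have "icc_group (G\<lparr>carrier := carrier G\<rparr>)" using icc by simp
  ultimately obtain U' where U': "U' \<in> equivariant (carrier G)" "adj U' o\<^sub>L U' = p1" "partial_isometry U'"
    "q1 o\<^sub>L U' = U'"
    using comparison[OF subgroup_self _ transversal_carrier p1(1,2) Qp1 q1] by blast
  have U'p: "U' o\<^sub>L p1 = U'" using partial_isometry_comp[OF U'(3)] U'(2) by simp
  have "U o\<^sub>L q1 = 0" using UQ partial_isometry_comp[OF U(2)] by (simp add: q1_def E_def comp_algebra)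
  then have z1: "U o\<^sub>L U' = 0" using U'(4) by (metis comp_assoc comp_algebra(9))
  have "p1 o\<^sub>L U = 0" using pU partial_isometry_final[OF U(2)] by (simp add: p1_def F_def comp_algebra)
  then have z2: "U' o\<^sub>L U = 0" using U'p by (metis comp_assoc comp_algebra(10))
  have "adj (U o\<^sub>L U') = 0" "adj (U' o\<^sub>L U) = 0" using z1 z2 by simp_all
  then have z3: "adj U' o\<^sub>L adj U = 0" "adj U o\<^sub>L adj U' = 0" by simp_all
  \<comment> \<open>The initial spaces of \<open>U\<close> and \<open>U'\<^sup>*\<close> are orthogonal, and so are the final ones.\<close>
  define W where "W = U + adj U'"
  have WW: "W o\<^sub>L adj W = p"
    using partial_isometry_sum(2)[of U "adj U'"] z1 z2 z3 U'(2) by (simp add: W_def p1_def F_def)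
  have W2: "adj W o\<^sub>L W = E + (U' o\<^sub>L adj U')"
    using partial_isometry_sum(1)[of U "adj U'"] z1 z2 z3 by (simp add: W_def E_def)
  have WU: "norm (U f) \<le> norm (W f)" for f
  proof -
    have "(norm (W f))\<^sup>2 = (adj W o\<^sub>L W) f \<bullet> f" by (rule norm_adj_comp[symmetric])
    also have "\<dots> = (norm (U f))\<^sup>2 + (norm (adj U' f))\<^sup>2"
      using norm_adj_comp[of U f] norm_adj_comp[of "adj U'" f]
      unfolding W2 E_def by (simp add: blinfun.add_left inner_add_left)
    finally have "(norm (U f))\<^sup>2 \<le> (norm (W f))\<^sup>2" by simp
    then show ?thesis by (rule power2_le_imp_le) simp
  qed
  have WC: "W \<in> equivariant (carrier G)"
    unfolding W_def by (intro C.commutant_alg U(1) C.commutant_adj U'(1))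
  have "partial_isometry (adj W)" using p(2) by (simp add: partial_isometry_def WW)
  then have Wpi: "partial_isometry W" using partial_isometry_adj by fastforce
  have pW: "p o\<^sub>L W = W" using partial_isometry_final[OF Wpi] by (simp add: WW)
  then have "Q o\<^sub>L W = W" using p(3) by (metis comp_assoc)
  then have WQ: "W o\<^sub>L Q = W" using equivariant_comm_Q[OF subgroup_self WC] by simp
  \<comment> \<open>The summand \<open>1\<close> only avoids division by \<open>0\<close>.\<close>
  define c where "c = 1 / (norm T + 1)"
  have c: "c > 0" by (simp add: c_def add_nonneg_pos)
  have "c * norm f \<le> norm (W f)" if f: "restr H f = f" for f
  proof -
    have "norm f \<le> norm T * norm (U f)" using Tiso[OF f] U(5)[of f] by simp
    also have "\<dots> \<le> (norm T + 1) * norm (W f)" using WU by (intro mult_mono) auto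
    finally have "norm f \<le> (norm T + 1) * norm (W f)" .
    moreover have "norm T + 1 > 0" using norm_ge_zero[of T] by linarith
    ultimately show ?thesis by (simp add: c_def pos_divide_le_eq mult.commute)
  qed
  with c WC WW Wpi pW WQ show ?thesis by blast
qed

text \<open>
  Index the orbit by the sets of all \<open>x\<close> with \<open>x\<^sup>-\<^sup>1 \<in> H r\<close>, which are the left cosets \<open>r\<^sup>-\<^sup>1H\<close>. A
  combination of basis vectors from such a set is moved into \<open>l\<^sup>2(H)\<close> by \<open>\<lambda>(r)\<close>, without changing its
  norm or that of its image under \<open>B\<close>.
\<close>

lemma riesz_cosets:
  assumes H: "subgroup H G" and R: "transversal H R" and B: "B \<in> equivariant (carrier G)"
    and bd: "\<And>f. norm (B f) \<le> norm f"
    and c: "c > 0" "\<And>f. restr H f = f \<Longrightarrow> c * norm f \<le> norm (B f)"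
  shows "finite_union_of_riesz_sequences (carrier G) (\<lambda>g. coord (B (basis g)))"
proof -
  interpret H: subgroup H G by fact
  have RG: "finite R" "R \<subseteq> carrier G" using R by (auto simp: transversal_def)
  define S where "S = (\<lambda>r. {x \<in> carrier G. inv x \<in> H #> r})"
  have "partition_on (carrier G) (S ` R)"
  proof (rule partition_onI)
    show "\<Union> (S ` R) = carrier G"
    proof
      show "carrier G \<subseteq> \<Union> (S ` R)"
      proof
        fix x assume x: "x \<in> carrier G"
        then have "inv x \<in> (\<Union>r\<in>R. H #> r)" using R unfolding transversal_def by simp
        then show "x \<in> \<Union> (S ` R)" using x by (auto simp: S_def)
      qed
    qed (auto simp: S_def)
    show "disjnt A B" if "A \<in> S ` R" "B \<in> S ` R" "A \<noteq> B" for A B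
    proof -
      from that obtain r s where rs: "r \<in> R" "s \<in> R" "A = S r" "B = S s" "r \<noteq> s" by blast
      then have "(H #> r) \<inter> (H #> s) = {}" using R unfolding transversal_def by blast
      then show ?thesis using rs by (auto simp: disjnt_def S_def)
    qed
    show "{} \<notin> S ` R"
    proof
      assume "{} \<in> S ` R"
      then obtain r where r: "r \<in> R" "S r = {}" by auto
      have "r \<in> carrier G" using r RG by auto
      then have "inv r \<in> S r" using rcos_self[OF _ H] by (simp add: S_def)
      then show False using r by simp
    qed
  qed
  moreover have "riesz_sequence (S r) (\<lambda>g. coord (B (basis g)))" if r: "r \<in> R" for r
    unfolding riesz_sequence_def
  proof (intro exI conjI allI impI)
    show "c\<^sup>2 > 0" using c(1) by simp
    show "(1::real) > 0" by simp
    fix F and a :: "'a \<Rightarrow> complex" assume F: "finite F \<and> F \<subseteq> S r"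
    define y where "y = (\<Sum>i\<in>F. scaleC (a i) (basis i))"
    have rc: "r \<in> carrier G" using r RG by auto
    have coord_sum: "coord (\<Sum>i\<in>F. k i) x = (\<Sum>i\<in>F. coord (k i) x)" for k x
      using F[THEN conjunct1] by (induction F rule: finite_induct) (simp_all add: zero_l2.rep_eq plus_l2.rep_eq)
    have cy: "coord y x = (if x \<in> F then a x else 0)" for x
      using F by (simp add: y_def coord_sum scaleC.rep_eq coord_basis if_distrib cong: if_cong)
    have ny: "(norm y)\<^sup>2 = (\<Sum>i\<in>F. (cmod (a i))\<^sup>2)"
    proof -
      have "(norm y)\<^sup>2 = (\<Sum>\<^sub>\<infinity>x\<in>F. (cmod (a x))\<^sup>2)"
        unfolding norm_l2_sq by (rule infsum_cong_neutral) (auto simp: cy)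
      then show ?thesis using F by simp
    qed
    have Qy: "Q y = y" using F by (intro l2_eqI) (auto simp: coord_restr cy S_def)
    have By: "B y = (\<Sum>i\<in>F. scaleC (a i) (B (basis i)))"
      by (simp add: y_def blinfun.sum_right clinear_op_scaleC[OF equivariantD(1)[OF B]])
    have "(\<lambda>x. \<Sum>i\<in>F. a i * coord (B (basis i)) x) = coord (B y)"
      by (rule ext) (simp add: By coord_sum scaleC.rep_eq)
    then have nB: "ell2_norm (\<lambda>x. \<Sum>i\<in>F. a i * coord (B (basis i)) x) = norm (B y)"
      by (simp add: norm_l2_def)
    show "(ell2_norm (\<lambda>x. \<Sum>i\<in>F. a i * coord (B (basis i)) x))\<^sup>2 \<le> 1 * (\<Sum>i\<in>F. (cmod (a i))\<^sup>2)"
      unfolding nB ny[symmetric] using bd by (simp add: power_mono)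
    have "restr H (lam r y) = lam r y"
    proof (rule l2_eqI)
      fix x
      have "coord (lam r y) x = 0" if x: "x \<notin> H"
      proof (cases "x \<in> carrier G")
        case True
        have "inv r \<otimes> x \<notin> S r"
        proof
          assume "inv r \<otimes> x \<in> S r"
          then have "inv (inv r \<otimes> x) \<in> H #> r" by (simp add: S_def)
          then obtain h where h: "h \<in> H" "inv x \<otimes> r = h \<otimes> r"
            using True rc by (auto simp: inv_mult_group r_coset_def)
          then have "inv x = h" using True rc H.mem_carrier by simp
          then have "x \<in> H" using H.m_inv_closed[OF h(1)] True by auto
          then show False using x by simp
        qed
        then have "coord y (inv r \<otimes> x) = 0" using F cy by auto
        then show ?thesis using rc by (simp add: coord_lam)
      qed (use rc in \<open>simp add: coord_lam\<close>)
      then show "coord (restr H (lam r y)) x = coord (lam r y) x" by (simp add: coord_restr)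
    qed
    then have "c * norm (lam r y) \<le> norm (B (lam r y))" by (rule c(2))
    also have "B (lam r y) = lam r (B y)" using equivariantD(2)[OF B rc] by simp
    also have "norm (lam r (B y)) = norm (B y)"
    proof (rule norm_lam[OF rc])
      show "Q (B y) = B y"
        using comp_apply[OF equivariant_comm_Q[OF subgroup_self B], of y] Qy by simp
    qed
    finally have "c * norm y \<le> norm (B y)" using norm_lam[OF rc Qy] by simp
    then have "(c * norm y)\<^sup>2 \<le> (norm (B y))\<^sup>2" using c(1) by (intro power_mono) auto
    then show "c\<^sup>2 * (\<Sum>i\<in>F. (cmod (a i))\<^sup>2) \<le> (ell2_norm (\<lambda>x. \<Sum>i\<in>F. a i * coord (B (basis i)) x))\<^sup>2"
      unfolding nB ny[symmetric] by (simp add: power_mult_distrib)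
  qed
  ultimately show ?thesis
    unfolding finite_union_of_riesz_sequences_def using RG(1) by (intro exI[of _ "S ` R"]) auto
qed

end

section \<open>Compressing an orthonormal orbit\<close>

lemma riesz_sequence_cong:
  assumes "\<And>i. i \<in> S \<Longrightarrow> v i = w i"
  shows "riesz_sequence S v \<longleftrightarrow> riesz_sequence S w"
proof -
  have "(\<Sum>i\<in>F. c i * v i x) = (\<Sum>i\<in>F. c i * w i x)" if "F \<subseteq> S" for F c x
    using that assms by (intro sum.cong) auto
  then show ?thesis unfolding riesz_sequence_def by (simp cong: conj_cong)
qed

lemma finite_union_of_riesz_sequences_cong:
  assumes "\<And>i. i \<in> J \<Longrightarrow> v i = w i"
  shows "finite_union_of_riesz_sequences J v \<longleftrightarrow> finite_union_of_riesz_sequences J w"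
proof -
  have "riesz_sequence S v \<longleftrightarrow> riesz_sequence S w" if "partition_on J P" "S \<in> P" for P S
    using that assms partition_onD1[OF that(1)] by (intro riesz_sequence_cong) auto
  then show ?thesis unfolding finite_union_of_riesz_sequences_def by blast
qed

lemma cinner_zero_left: "cinner 0 g = 0"
  by (simp add: cinner_def ell2_inner_def zero_l2.rep_eq)

lemma cinner_sum_left: "cinner (\<Sum>i\<in>F. k i) g = (\<Sum>i\<in>F. cinner (k i) g)"
  by (induction F rule: infinite_finite_induct) (simp_all add: cinner_add_left cinner_zero_left)

lemma bessel:
  assumes F: "finite F" and on: "\<And>i j. i \<in> F \<Longrightarrow> j \<in> F \<Longrightarrow> cinner (e i) (e j) = (if i = j then 1 else 0)"
  shows "(\<Sum>i\<in>F. (cmod (cinner f (e i)))\<^sup>2) \<le> (norm f)\<^sup>2"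
proof -
  define s where "s = (\<Sum>i\<in>F. (cmod (cinner f (e i)))\<^sup>2)"
  define w where "w = (\<Sum>i\<in>F. scaleC (cinner f (e i)) (e i))"
  have we: "cinner w (e j) = cinner f (e j)" if "j \<in> F" for j
  proof -
    have "cinner w (e j) = (\<Sum>i\<in>F. if i = j then cinner f (e i) else 0)"
      unfolding w_def cinner_sum_left by (intro sum.cong) (auto simp: cinner_scaleC_left on that)
    then show ?thesis using F that by simp
  qed
  have ws: "cinner w g = complex_of_real s" if "\<And>i. i \<in> F \<Longrightarrow> cinner g (e i) = cinner f (e i)" for g
  proof -
    have "cinner w g = (\<Sum>i\<in>F. cinner f (e i) * cnj (cinner g (e i)))"
      unfolding w_def cinner_sum_left
      by (intro sum.cong refl) (simp add: cinner_scaleC_left cinner_cnj[of "e _" g])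
    also have "\<dots> = complex_of_real s"
      unfolding s_def of_real_sum
      by (intro sum.cong refl) (simp add: that complex_norm_square del: of_real_power)
    finally show ?thesis .
  qed
  have "w \<bullet> f = s" "(norm w)\<^sup>2 = s"
    using ws[of f] ws[OF we] by (simp_all add: power2_norm_eq_inner flip: Re_cinner)
  then have "(norm (f - w))\<^sup>2 = (norm f)\<^sup>2 - s"
    by (simp add: power2_norm_eq_inner inner_simps inner_commute)
  then show ?thesis unfolding s_def[symmetric] using zero_le_power2[of "norm (f - w)"] by linarith
qed

context group
begin

text \<open>
  \<open>u\<close> is obtained as the adjoint of \<open>D f = (g \<mapsto> \<langle>f, \<lambda>(g) \<psi>\<rangle>)\<close>, which takes values in \<open>l\<^sup>2\<close> and is
  bounded by Bessel's inequality.
\<close>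

lemma orthonormal_orbit_isometry:
  assumes on: "\<And>g h. g \<in> carrier G \<Longrightarrow> h \<in> carrier G \<Longrightarrow>
     cinner (lam g \<psi>) (lam h \<psi>) = (if g = h then 1 else 0)"
  shows "\<exists>u\<in>equivariant (carrier G). adj u o\<^sub>L u = Q \<and> (\<forall>g\<in>carrier G. u (basis g) = lam g \<psi>)"
proof -
  define D where "D = (\<lambda>f. Abs_l2 (\<lambda>g. if g \<in> carrier G then cinner f (lam g \<psi>) else 0))"
  have bd: "(\<Sum>g\<in>F. (cmod (if g \<in> carrier G then cinner f (lam g \<psi>) else 0))\<^sup>2) \<le> (norm f)\<^sup>2"
    if F: "finite F" for F f
  proof -
    have "(\<Sum>g\<in>F. (cmod (if g \<in> carrier G then cinner f (lam g \<psi>) else 0))\<^sup>2)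
        = (\<Sum>g\<in>F \<inter> carrier G. (cmod (cinner f (lam g \<psi>)))\<^sup>2)"
      using F by (intro sum.mono_neutral_cong_right) auto
    also have "\<dots> \<le> (norm f)\<^sup>2" using F on by (intro bessel) auto
    finally show ?thesis .
  qed
  have D: "coord (D f) g = (if g \<in> carrier G then cinner f (lam g \<psi>) else 0)" for f g
    using ell2_of_bounded_sums(1)[where I = UNIV, OF bd[of _ f]] by (simp add: D_def Abs_l2_inverse)
  have cscale: "cinner (r *\<^sub>R f) h = complex_of_real r * cinner f h" for r and f h :: "'a l2"
    by (simp add: complex_eq_iff Re_cinner Im_cinner)
  have "bounded_linear D"
  proof (rule bounded_linear_intro[where K = 1])
    show "D (f + g) = D f + D g" for f g by (rule l2_eqI) (simp add: D plus_l2.rep_eq cinner_add_left)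
    show "D (r *\<^sub>R f) = r *\<^sub>R D f" for r f by (rule l2_eqI) (simp add: D scaleR_l2.rep_eq cscale)
    show "norm (D f) \<le> norm f * 1" for f
    proof -
      have "coord (D f) = (\<lambda>g. if g \<in> carrier G then cinner f (lam g \<psi>) else 0)" by (rule ext) (rule D)
      then have "(norm (D f))\<^sup>2 \<le> (norm f)\<^sup>2"
        using ell2_of_bounded_sums(2)[where I = UNIV, OF bd[of _ f]] by (simp add: norm_l2_def)
      then show ?thesis by (auto intro: power2_le_imp_le)
    qed
  qed
  then have DB: "blinfun_apply (Blinfun D) = D" by (rule bounded_linear_Blinfun_apply)
  define u where "u = adj (Blinfun D)"
  have Dcl: "clinear_op (Blinfun D)"
    unfolding clinear_op_def DB by (intro allI l2_eqI) (simp add: D scaleC.rep_eq cinner_scaleC_left)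
  have adju: "adj u = Blinfun D" by (simp add: u_def)
  have ucl: "clinear_op u"
  proof -
    have "u (scaleC \<i> f) = scaleC \<i> (u f)" for f
    proof -
      have "(Blinfun D) o\<^sub>L mult_i = mult_i o\<^sub>L Blinfun D"
        using Dcl by (intro blinfun_eqI) (simp add: clinear_op_def)
      then have "adj (Blinfun D o\<^sub>L mult_i) = adj (mult_i o\<^sub>L Blinfun D)" by (rule arg_cong)
      then have "mult_i o\<^sub>L u = u o\<^sub>L mult_i" by (simp add: u_def adj_mult_i comp_algebra)
      from comp_apply[OF this, of f] show ?thesis by simp
    qed
    then show ?thesis by (simp add: clinear_op_def)
  qed
  have ub: "cinner (u (basis x)) f = (if x \<in> carrier G then cinner (lam x \<psi>) f else 0)" for x f
  proof -
    have "cinner (u (basis x)) f = cnj (coord (D f) x)"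
      using cinner_adj_right[OF ucl, of "basis x" f] cinner_cnj[of "basis x" "D f"]
      by (simp add: adju DB cinner_basis_right)
    then show ?thesis using cinner_cnj[of "lam x \<psi>" f] by (simp add: D)
  qed
  have ext: "f = g" if "\<And>h. cinner f h = cinner g h" for f g :: "'a l2"
    using that[of "basis _"] by (intro l2_eqI) (simp add: cinner_basis_right)
  have u1: "u (basis x) = lam x \<psi>" if "x \<in> carrier G" for x
    using that by (intro ext) (simp add: ub)
  have u0: "u (basis x) = 0" if "x \<notin> carrier G" for x
    using that by (intro ext) (simp add: ub cinner_zero_left)
  have "u \<in> equivariant (carrier G)" by (rule equivariant_basisI[OF ucl u1 u0])
  moreover have "adj u o\<^sub>L u = Q"
  proof (rule clinear_op_eqI)
    show "clinear_op (adj u o\<^sub>L u)" unfolding adju by (intro clinear_op_comp Dcl ucl)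
    show "clinear_op Q" by (rule clinear_group_ops)
    show "(adj u o\<^sub>L u) (basis x) = Q (basis x)" for x
    proof (rule l2_eqI)
      fix y
      show "coord ((adj u o\<^sub>L u) (basis x)) y = coord (Q (basis x)) y"
        using on[of x y] by (cases "x \<in> carrier G")
          (auto simp: adju DB D u1 u0 restr_basis coord_basis zero_l2.rep_eq cinner_zero_left)
    qed
  qed
  ultimately show ?thesis using u1 by blast
qed

text \<open>
  With \<open>W\<close> belonging to a projection \<open>e\<close> of trace \<open>\<alpha>\<close> and \<open>u\<close> the isometry \<open>\<delta>\<^sub>g \<mapsto> \<lambda>(g) \<psi>\<close>, the
  projection is \<open>u (W\<^sup>*W) u\<^sup>*\<close>. Two applications of the trace property give it the trace of \<open>e\<close>, and it
  maps \<open>\<lambda>(g) \<psi>\<close> to \<open>V \<delta>\<^sub>g\<close> with \<open>\<parallel>V f\<parallel> = \<parallel>W f\<parallel>\<close>.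
\<close>

theorem riesz_compression_exists:
  assumes icc: "icc_group G" and H: "subgroup H G" and iccH: "icc_group (G\<lparr>carrier := H\<rparr>)"
    and R: "transversal H R" and card: "card R > 0" and inf: "infinite (carrier G)"
    and \<alpha>: "1 / real (card R) \<le> \<alpha>" "\<alpha> \<le> 1"
    and on: "\<And>g h. g \<in> carrier G \<Longrightarrow> h \<in> carrier G \<Longrightarrow>
     cinner (lam g \<psi>) (lam h \<psi>) = (if g = h then 1 else 0)"
  shows "\<exists>p\<in>equivariant (carrier G). proj_op p \<and> Q o\<^sub>L p = p \<and> p (basis \<one>) \<bullet> basis \<one> = \<alpha> \<and>
     finite_union_of_riesz_sequences (carrier G) (\<lambda>g. coord (p (lam g \<psi>)))"
proof -
  interpret C: adj_closed "symmetries (carrier G)" by (rule adj_closed_symmetries[OF subgroup_self])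
  have "0 \<le> 1 / real (card R)" by simp
  then have "0 \<le> \<alpha>" using \<alpha> by linarith
  then obtain e where e: "e \<in> equivariant (carrier G)" "proj_op e" "Q o\<^sub>L e = e"
    "e (basis \<one>) \<bullet> basis \<one> = \<alpha>"
    using projection_of_trace[OF inf _ \<alpha>(2)] by blast
  obtain W c where W: "W \<in> equivariant (carrier G)" "partial_isometry W" "W o\<^sub>L adj W = e"
    "e o\<^sub>L W = W" "W o\<^sub>L Q = W" and c: "c > 0" "\<And>f. restr H f = f \<Longrightarrow> c * norm f \<le> norm (W f)"
    using frame_operator_exists[OF icc H iccH R e(1-3) _ card] e(4) \<alpha>(1) by auto
  obtain u where u: "u \<in> equivariant (carrier G)" "adj u o\<^sub>L u = Q"
    "\<And>g. g \<in> carrier G \<Longrightarrow> u (basis g) = lam g \<psi>"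
    using orthonormal_orbit_isometry[OF on] by blast
  have upi: "partial_isometry u" using u(2) proj_restr by (simp add: partial_isometry_def)
  have uQ: "u o\<^sub>L Q = u" using partial_isometry_comp[OF upi] u(2) by simp
  have Qu: "Q o\<^sub>L u = u" using equivariant_comm_Q[OF subgroup_self u(1)] uQ by simp
  define r where "r = adj W o\<^sub>L W"
  have r: "r \<in> equivariant (carrier G)" "proj_op r"
    using W by (auto simp: r_def partial_isometry_def intro: C.commutant_alg C.commutant_adj)
  have rQ: "r o\<^sub>L Q = r" using W(5) by (simp add: r_def comp_assoc)
  have Qr: "Q o\<^sub>L r = r" using equivariant_comm_Q[OF subgroup_self r(1)] rQ by simp
  have rr: "r o\<^sub>L r = r" "adj r = r" using r(2) by (auto simp: proj_op_def)
  define V where "V = u o\<^sub>L r"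
  have V: "V \<in> equivariant (carrier G)" unfolding V_def by (intro C.commutant_alg u r)
  have VV: "adj V o\<^sub>L V = r"
  proof -
    have "adj V o\<^sub>L V = r o\<^sub>L ((adj u o\<^sub>L u) o\<^sub>L r)" by (simp add: V_def rr comp_assoc)
    then show ?thesis by (simp add: u(2) Qr rr)
  qed
  then have Vpi: "partial_isometry V" using r(2) by (simp add: partial_isometry_def)
  define p where "p = V o\<^sub>L adj V"
  have QV: "Q o\<^sub>L V = V" using Qu unfolding V_def by (metis comp_assoc)
  have "p \<in> equivariant (carrier G)" unfolding p_def by (intro C.commutant_alg C.commutant_adj V)
  moreover have "proj_op p" unfolding p_def by (rule partial_isometry_final_proj[OF Vpi])
  moreover have "Q o\<^sub>L p = p" using QV unfolding p_def by (metis comp_assoc)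
  moreover have "p (basis \<one>) \<bullet> basis \<one> = \<alpha>"
  proof -
    have "Q o\<^sub>L W = W" using W(4) e(3) by (metis comp_assoc)
    then have "coset_trace {\<one>} p = coset_trace {\<one>} e"
      using coset_trace_comm[OF subgroup_self transversal_carrier V QV]
        coset_trace_comm[OF subgroup_self transversal_carrier W(1)]
      by (simp add: p_def VV r_def W(3))
    then show ?thesis using e(4) by (simp add: coset_trace_def)
  qed
  moreover have "finite_union_of_riesz_sequences (carrier G) (\<lambda>g. coord (p (lam g \<psi>)))"
  proof -
    have "norm (V f) = norm (W f)" for f
      using partial_isometry_norm[OF Vpi, of f] partial_isometry_norm[OF W(2), of f] VV r_def by metis
    then have riesz: "finite_union_of_riesz_sequences (carrier G) (\<lambda>g. coord (V (basis g)))"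
      using c partial_isometry_norm_le[OF Vpi] by (intro riesz_cosets[OF H R V _ c(1)]) auto
    have "p (lam g \<psi>) = V (basis g)" if g: "g \<in> carrier G" for g
    proof -
      have "adj V o\<^sub>L u = r" using Qr rQ by (simp add: V_def rr comp_assoc u(2))
      then have "adj V (lam g \<psi>) = r (basis g)" using comp_apply[of "adj V" u r "basis g"] u(3)[OF g] by simp
      moreover have "V o\<^sub>L r = V" by (simp add: V_def comp_assoc rr)
      ultimately show ?thesis using comp_apply[of V r V "basis g"] by (simp add: p_def)
    qed
    then have "finite_union_of_riesz_sequences (carrier G) (\<lambda>g. coord (p (lam g \<psi>))) \<longleftrightarrow>
        finite_union_of_riesz_sequences (carrier G) (\<lambda>g. coord (V (basis g)))"
      by (intro finite_union_of_riesz_sequences_cong) simp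
    then show ?thesis using riesz by blast
  qed
  ultimately show ?thesis by blast
qed

end

section \<open>Extensional operators and the group von Neumann algebra\<close>

context group
begin

text \<open>
  The operators that live on \<open>l\<^sup>2\<close> of the carrier. They correspond, by \<open>ext_op\<close>, to the elements of
  \<open>bounded_ops (carrier G)\<close>, and the following lemmas transport composition, adjoints and projections
  along this bijection.
\<close>

abbreviation corner :: "('a l2 \<Rightarrow>\<^sub>L 'a l2) \<Rightarrow> bool" where
  "corner T \<equiv> clinear_op T \<and> Q o\<^sub>L T = T \<and> T o\<^sub>L Q = T"

definition ext_op :: "('a l2 \<Rightarrow>\<^sub>L 'a l2) \<Rightarrow> ('a \<Rightarrow> complex) \<Rightarrow> ('a \<Rightarrow> complex)" where
  "ext_op T = (\<lambda>f\<in>ell2 (carrier G). coord (T (Abs_l2 f)))"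

lemma ell2_subset: "f \<in> ell2 I \<Longrightarrow> f \<in> ell2 UNIV"
  by (simp add: ell2_def)

lemma coord_Abs: "f \<in> ell2 I \<Longrightarrow> coord (Abs_l2 f) = f"
  by (simp add: Abs_l2_inverse ell2_subset)

lemma Abs_coord [simp]: "Abs_l2 (coord f) = f"
  by (rule coord_inverse)

lemma supported_iff: "Q f = f \<longleftrightarrow> coord f \<in> ell2 (carrier G)"
proof
  assume f: "Q f = f"
  have "coord f x = 0" if "x \<notin> carrier G" for x
    using arg_cong[OF f, of "\<lambda>f. coord f x"] that by (simp add: coord_restr)
  then show "coord f \<in> ell2 (carrier G)" using coord_ell2[of f] by (simp add: ell2_def)
qed (auto intro!: l2_eqI simp: coord_restr ell2_def)

lemma Q_Abs: "f \<in> ell2 (carrier G) \<Longrightarrow> Q (Abs_l2 f) = Abs_l2 f"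
  by (simp add: supported_iff coord_Abs)

lemma ext_op_coord:
  assumes "Q f = f" shows "ext_op T (coord f) = coord (T f)"
  using assms by (simp add: ext_op_def supported_iff)

lemma ext_op_apply: "f \<in> ell2 (carrier G) \<Longrightarrow> ext_op T f = coord (T (Abs_l2 f))"
  by (simp add: ext_op_def)

lemma corner_Q: "corner T \<Longrightarrow> Q (T f) = T f"
  using comp_apply by blast

lemma ell2_norm_Abs: "f \<in> ell2 I \<Longrightarrow> ell2_norm f = norm (Abs_l2 f)"
  by (simp add: norm_l2_def coord_Abs)

lemma ext_op_bounded:
  assumes T: "corner T"
  shows "ext_op T \<in> bounded_ops (carrier G)"
  unfolding bounded_ops_def mem_Collect_eq
proof (intro conjI ballI allI)
  show "ext_op T \<in> ell2 (carrier G) \<rightarrow>\<^sub>E ell2 (carrier G)"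
    using corner_Q[OF T] by (auto simp: ext_op_def supported_iff)
  show "ext_op T (\<lambda>x. a * f x + b * g x) = (\<lambda>x. a * ext_op T f x + b * ext_op T g x)"
    if f: "f \<in> ell2 (carrier G)" and g: "g \<in> ell2 (carrier G)" for f g a b
  proof -
    have m: "(\<lambda>x. a * f x + b * g x) \<in> ell2 (carrier G)" by (intro ell2_add ell2_scale f g)
    have "Abs_l2 (\<lambda>x. a * f x + b * g x) = scaleC a (Abs_l2 f) + scaleC b (Abs_l2 g)"
      by (rule l2_eqI) (simp add: coord_Abs[OF m] coord_Abs[OF f] coord_Abs[OF g] plus_l2.rep_eq scaleC.rep_eq)
    then show ?thesis using T
      by (simp add: ext_op_apply m f g blinfun.add_right clinear_op_scaleC plus_l2.rep_eq scaleC.rep_eq)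
  qed
  show "\<exists>C. \<forall>f\<in>ell2 (carrier G). ell2_norm (ext_op T f) \<le> C * ell2_norm f"
    by (intro exI[of _ "norm T"])
      (auto simp: ext_op_apply ell2_norm_Abs norm_blinfun simp flip: norm_l2_def)
qed

lemma bounded_op_is_ext_op:
  assumes p: "p \<in> bounded_ops (carrier G)"
  shows "\<exists>T. corner T \<and> p = ext_op T"
proof -
  let ?I = "carrier G"
  have pE: "p \<in> ell2 ?I \<rightarrow>\<^sub>E ell2 ?I" using p by (simp add: bounded_ops_def)
  have lin: "p (\<lambda>x. a * f x + b * g x) = (\<lambda>x. a * p f x + b * p g x)"
    if "f \<in> ell2 ?I" "g \<in> ell2 ?I" for f g a b
    using p that unfolding bounded_ops_def by blast
  obtain C where C: "\<And>f. f \<in> ell2 ?I \<Longrightarrow> ell2_norm (p f) \<le> C * ell2_norm f"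
    using p unfolding bounded_ops_def by blast
  have QI: "coord (Q f) \<in> ell2 ?I" for f
    using proj_op_inner(3)[OF proj_restr] by (simp flip: supported_iff)
  have pI: "p (coord (Q f)) \<in> ell2 ?I" for f using pE QI by auto
  define t where "t = (\<lambda>f. Abs_l2 (p (coord (Q f))))"
  have t: "coord (t f) = p (coord (Q f))" for f using coord_Abs[OF pI] by (simp add: t_def)
  have comb: "t (scaleC a f + scaleC b g) = scaleC a (t f) + scaleC b (t g)" for a b f g
  proof (rule l2_eqI)
    fix x
    have "coord (Q (scaleC a f + scaleC b g)) = (\<lambda>x. a * coord (Q f) x + b * coord (Q g) x)"
      by (rule ext) (simp add: coord_restr plus_l2.rep_eq scaleC.rep_eq)
    then show "coord (t (scaleC a f + scaleC b g)) x = coord (scaleC a (t f) + scaleC b (t g)) x"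
      by (simp add: t lin[OF QI QI] plus_l2.rep_eq scaleC.rep_eq)
  qed
  have one: "scaleC 1 f = f" and zero: "scaleC 0 f = 0" and of_real: "scaleC (complex_of_real r) f = r *\<^sub>R f"
    for f :: "'a l2" and r
    by (auto intro!: l2_eqI simp: scaleC.rep_eq zero_l2.rep_eq scaleR_l2.rep_eq)
  have "bounded_linear t"
  proof (rule bounded_linear_intro[where K = "\<bar>C\<bar>"])
    show "t (f + g) = t f + t g" for f g using comb[of 1 f 1 g] by (simp add: one)
    show "t (r *\<^sub>R f) = r *\<^sub>R t f" for r f
      using comb[of "complex_of_real r" f 0 f] by (simp add: zero of_real)
    show "norm (t f) \<le> norm f * \<bar>C\<bar>" for f
    proof -
      have "norm (t f) \<le> C * norm (Q f)" using C[OF QI[of f]] by (simp add: norm_l2_def t)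
      also have "\<dots> \<le> \<bar>C\<bar> * norm (Q f)" by (intro mult_right_mono) auto
      also have "\<dots> \<le> \<bar>C\<bar> * norm f" by (intro mult_left_mono proj_op_norm_le proj_restr) auto
      finally show ?thesis by (simp add: mult.commute)
    qed
  qed
  then have B: "blinfun_apply (Blinfun t) = t" by (rule bounded_linear_Blinfun_apply)
  have "clinear_op (Blinfun t)"
    unfolding clinear_op_def B using comb[of \<i> _ 0] by (simp add: zero)
  moreover have "Q o\<^sub>L Blinfun t = Blinfun t"
    by (intro blinfun_eqI) (simp add: B supported_iff t pI)
  moreover have "Blinfun t o\<^sub>L Q = Blinfun t"
  proof -
    have "t (Q f) = t f" for f using proj_op_inner(3)[OF proj_restr] by (simp add: t_def)
    then show ?thesis by (intro blinfun_eqI) (simp add: B)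
  qed
  moreover have "p = ext_op (Blinfun t)"
  proof
    fix f
    show "p f = ext_op (Blinfun t) f"
    proof (cases "f \<in> ell2 ?I")
      case True
      then show ?thesis by (simp add: ext_op_apply B t Q_Abs coord_Abs)
    next
      case False
      then show ?thesis using pE by (auto simp: ext_op_def PiE_def extensional_def)
    qed
  qed
  ultimately show ?thesis by blast
qed

lemma ext_op_inj:
  assumes "corner S" "corner T" "ext_op S = ext_op T"
  shows "S = T"
proof (rule blinfun_eqI)
  fix f
  have QQ: "Q (Q f) = Q f" by (rule proj_op_inner(3)[OF proj_restr])
  have "coord (S (Q f)) = coord (T (Q f))"
    using assms(3) ext_op_coord[OF QQ] by metis
  then have "S (Q f) = T (Q f)" by (simp add: coord_inject)
  then show "S f = T f" using assms(1,2) comp_apply[of S Q S f] comp_apply[of T Q T f] by simp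
qed

lemma ext_op_comp:
  assumes "corner T"
  shows "compose (ell2 (carrier G)) (ext_op S) (ext_op T) = ext_op (S o\<^sub>L T)"
proof
  fix f
  show "compose (ell2 (carrier G)) (ext_op S) (ext_op T) f = ext_op (S o\<^sub>L T) f"
  proof (cases "f \<in> ell2 (carrier G)")
    case True
    then show ?thesis
      by (simp add: compose_def ext_op_apply[OF True] ext_op_coord[OF corner_Q[OF assms]])
  next
    case False
    then show ?thesis by (simp add: compose_def ext_op_def)
  qed
qed

lemma corner_comp: "corner S \<Longrightarrow> corner T \<Longrightarrow> corner (S o\<^sub>L T)"
  using comp_assoc clinear_op_comp by metis

lemma ext_op_is_adjoint:
  assumes S: "corner S" and T: "corner T"
  shows "is_adjoint (carrier G) (ext_op T) (ext_op S) \<longleftrightarrow> adj T = S"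
proof
  assume a: "is_adjoint (carrier G) (ext_op T) (ext_op S)"
  have QQ: "adj Q = Q" "Q (Q f) = Q f" for f using proj_restr[of "carrier G"] proj_op_inner(3)[OF proj_restr]
    by (auto simp: proj_op_def)
  show "adj T = S"
  proof (rule adj_eqI)
    fix f g
    have "coord (Q f) \<in> ell2 (carrier G)" "coord (Q g) \<in> ell2 (carrier G)"
      using QQ by (auto simp flip: supported_iff)
    then have "cinner (T (Q f)) (Q g) = cinner (Q f) (S (Q g))"
      using a unfolding is_adjoint_def cinner_def by (auto simp: ext_op_apply)
    then have "T (Q f) \<bullet> Q g = Q f \<bullet> S (Q g)" by (simp flip: Re_cinner)
    moreover have "T (Q f) = T f" "S (Q g) = S g" using S T comp_apply by blast+
    moreover have "T f \<bullet> Q g = Q (T f) \<bullet> g" "Q f \<bullet> S g = f \<bullet> Q (S g)"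
      using proj_op_inner(1)[OF proj_restr] by auto
    ultimately show "T f \<bullet> g = f \<bullet> S g" using corner_Q S T by simp
  qed
next
  assume a: "adj T = S"
  show "is_adjoint (carrier G) (ext_op T) (ext_op S)"
    unfolding is_adjoint_def
  proof (intro ballI)
    fix f g assume f: "f \<in> ell2 (carrier G)" and g: "g \<in> ell2 (carrier G)"
    have "cinner (T (Abs_l2 f)) (Abs_l2 g) = cinner (Abs_l2 f) (S (Abs_l2 g))"
      using cinner_adj_right[of T] T a by simp
    then show "ell2_inner (ext_op T f) g = ell2_inner f (ext_op S g)"
      using f g by (simp add: cinner_def ext_op_apply coord_Abs)
  qed
qed

lemma ext_op_is_projection:
  assumes "corner P"
  shows "is_projection (carrier G) (ext_op P) \<longleftrightarrow> proj_op P"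
  unfolding is_projection_def proj_op_def ext_op_comp[OF assms] ext_op_is_adjoint[OF assms assms]
  using ext_op_inj[OF corner_comp[OF assms assms] assms] ext_op_bounded[OF assms] by metis

lemma left_regular_ext_op:
  assumes "g \<in> carrier G"
  shows "left_regular G g = ext_op (lam g)"
  unfolding left_regular_def ext_op_def
  by (rule restrict_ext) (auto simp: fun_eq_iff coord_lam[OF assms] coord_Abs)

lemma corner_lam: "g \<in> carrier G \<Longrightarrow> corner (lam g)"
  by (auto intro!: blinfun_eqI l2_eqI clinear_group_ops simp: coord_restr coord_lam)

lemma corner_Q_op: "corner Q"
  using proj_restr[of "carrier G"] clinear_group_ops(3) by (auto simp: proj_op_def)

lemma wot_open:
  assumes "f \<in> ell2 (carrier G)" "g \<in> ell2 (carrier G)" "open U"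
  shows "openin (weak_operator_topology (carrier G)) {T \<in> bounded_ops (carrier G). ell2_inner (T f) g \<in> U}"
  unfolding weak_operator_topology_def using assms by (intro topology_generated_by_Basis) blast

lemma topspace_wot: "topspace (weak_operator_topology (carrier G)) = bounded_ops (carrier G)"
proof
  show "bounded_ops (carrier G) \<subseteq> topspace (weak_operator_topology (carrier G))"
    using openin_subset[OF wot_open[OF ell2_zero ell2_zero open_UNIV]] by auto
  show "topspace (weak_operator_topology (carrier G)) \<subseteq> bounded_ops (carrier G)"
    unfolding weak_operator_topology_def topology_generated_by_topspace by auto
qed

lemma ell2_inner_ext:
  assumes "Q f = f" "Q f' = f'" "\<And>g. g \<in> ell2 (carrier G) \<Longrightarrow> ell2_inner (coord f) g = ell2_inner (coord f') g"
  shows "f = f'"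
proof (rule l2_eqI)
  fix x
  show "coord f x = coord f' x"
  proof (cases "x \<in> carrier G")
    case True
    then have "cinner f (basis x) = cinner f' (basis x)"
      using assms(3)[OF ell2_delta_mem] by (simp add: cinner_def basis.rep_eq)
    then show ?thesis by (simp add: cinner_basis_right)
  next
    case False
    then show ?thesis using assms(1,2)[unfolded supported_iff] by (simp add: ell2_def)
  qed
qed

text \<open>
  This form of the commutation relation involves \<open>T\<close> only through two matrix coefficients, which are
  continuous in the weak operator topology. It shows that the commutant of \<open>P\<close> is weakly closed.
\<close>

lemma commute_iff_weak:
  assumes T: "corner T" and P: "corner P" "adj P = P"
  shows "T o\<^sub>L P = P o\<^sub>L T \<longleftrightarrow> (\<forall>f\<in>ell2 (carrier G). \<forall>g\<in>ell2 (carrier G).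
     ell2_inner (ext_op T (ext_op P f)) g = ell2_inner (ext_op T f) (ext_op P g))"
proof -
  have QP: "Q (P f) = P f" "Q (T f) = T f" for f using corner_Q P T by blast+
  have 1: "ell2_inner (ext_op T (ext_op P f)) g = ell2_inner (coord (T (P (Abs_l2 f)))) g"
    if "f \<in> ell2 (carrier G)" for f g
    using that by (simp add: ext_op_apply ext_op_coord QP)
  have 2: "ell2_inner (ext_op T f) (ext_op P g) = ell2_inner (coord (P (T (Abs_l2 f)))) g"
    if "f \<in> ell2 (carrier G)" "g \<in> ell2 (carrier G)" for f g
  proof -
    have "cinner (T (Abs_l2 f)) (P (Abs_l2 g)) = cinner (P (T (Abs_l2 f))) (Abs_l2 g)"
      using cinner_adj_right[of P] P by simp
    then show ?thesis using that by (simp add: cinner_def ext_op_apply coord_Abs)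
  qed
  show ?thesis
  proof
    assume c: "T o\<^sub>L P = P o\<^sub>L T"
    have "T (P f) = P (T f)" for f using comp_apply[OF c, of f] by simp
    then show "\<forall>f\<in>ell2 (carrier G). \<forall>g\<in>ell2 (carrier G).
     ell2_inner (ext_op T (ext_op P f)) g = ell2_inner (ext_op T f) (ext_op P g)"
      by (simp add: 1 2)
  next
    assume *: "\<forall>f\<in>ell2 (carrier G). \<forall>g\<in>ell2 (carrier G).
     ell2_inner (ext_op T (ext_op P f)) g = ell2_inner (ext_op T f) (ext_op P g)"
    have "T (P (Abs_l2 f)) = P (T (Abs_l2 f))" if f: "f \<in> ell2 (carrier G)" for f
      by (rule ell2_inner_ext) (use QP * 1 2 f in auto)
    moreover have "coord (Q f) \<in> ell2 (carrier G)" for f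
      using proj_op_inner(3)[OF proj_restr] by (simp flip: supported_iff)
    ultimately have "T (P (Q f)) = P (T (Q f))" for f by (metis Abs_coord)
    then have "(T o\<^sub>L P) o\<^sub>L Q = (P o\<^sub>L T) o\<^sub>L Q" by (intro blinfun_eqI) simp
    then show "T o\<^sub>L P = P o\<^sub>L T" using T P by (simp add: comp_assoc)
  qed
qed

text \<open>
  Used to bound \<open>L(G)\<close> from above: a von Neumann algebra that contains \<open>\<lambda>(G)\<close> contains \<open>L(G)\<close>.
\<close>

lemma projection_commutant_vna:
  assumes P: "corner P" "adj P = P"
  shows "von_neumann_algebra (carrier G) (ext_op ` {T. corner T \<and> T o\<^sub>L P = P o\<^sub>L T})"
    (is "von_neumann_algebra _ ?M")
proof -
  let ?I = "carrier G" and ?C = "{T. corner T \<and> T o\<^sub>L P = P o\<^sub>L T}"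
  have sub: "?M \<subseteq> bounded_ops ?I" using ext_op_bounded by blast
  have idM: "(\<lambda>f\<in>ell2 ?I. f) \<in> ?M"
  proof -
    have "(\<lambda>f\<in>ell2 ?I. f) = ext_op Q"
      unfolding ext_op_def by (rule restrict_ext) (simp add: Q_Abs coord_Abs)
    moreover have "Q \<in> ?C" using corner_Q_op P by auto
    ultimately show ?thesis by blast
  qed
  have comb: "(\<lambda>f\<in>ell2 ?I. \<lambda>x. a * ext_op S f x + b * ext_op T f x) \<in> ?M"
    if S: "S \<in> ?C" and T: "T \<in> ?C" for S T a b
  proof -
    define m where "m = (\<lambda>c (S :: 'a l2 \<Rightarrow>\<^sub>L 'a l2). Re c *\<^sub>R S + Im c *\<^sub>R (mult_i o\<^sub>L S))"
    have m_apply: "m c S f = scaleC c (S f)" for c S f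
      by (simp add: m_def blinfun.bilinear_simps scaleC_alt[of c])
    have cl: "clinear_op S \<Longrightarrow> S (scaleC c f) = scaleC c (S f)" for S :: "'a l2 \<Rightarrow>\<^sub>L 'a l2" and c f
      by (rule clinear_op_scaleC)
    have comp: "S (P f) = P (S f)" "T (P f) = P (T f)" for f
      using S T comp_apply[of S P "P o\<^sub>L S" f] comp_apply[of T P "P o\<^sub>L T" f] by auto
    have PS: "Q (S f) = S f" "S (Q f) = S f" "Q (T f) = T f" "T (Q f) = T f" for f
      using S T comp_apply by blast+
    have cls: "clinear_op S" "clinear_op T" "clinear_op P" "clinear_op Q"
      using S T P corner_Q_op by auto
    have cm: "scaleC c (scaleC d f) = scaleC d (scaleC c f)" for c d and f :: "'a l2"
      by (rule l2_eqI) (simp add: scaleC.rep_eq)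
    have cadd: "scaleC c (f + g) = scaleC c f + scaleC c g" for c and f g :: "'a l2"
      by (rule l2_eqI) (simp add: scaleC.rep_eq plus_l2.rep_eq algebra_simps)
    define R where "R = m a S + m b T"
    have R: "R f = scaleC a (S f) + scaleC b (T f)" for f by (simp add: R_def blinfun.add_left m_apply)
    have "clinear_op R"
      unfolding clinear_op_def R using cls by (simp add: cl cm[of \<i>] cadd)
    moreover have "Q o\<^sub>L R = R" by (intro blinfun_eqI) (simp add: R cl[OF cls(4)] blinfun.add_right PS)
    moreover have "R o\<^sub>L Q = R" by (intro blinfun_eqI) (simp add: R PS)
    moreover have "R o\<^sub>L P = P o\<^sub>L R"
      by (intro blinfun_eqI) (simp add: R comp cl[OF cls(3)] blinfun.add_right)
    ultimately have "R \<in> ?C" by simp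
    moreover have "(\<lambda>f\<in>ell2 ?I. \<lambda>x. a * ext_op S f x + b * ext_op T f x) = ext_op R"
      unfolding ext_op_def[of R]
      by (rule restrict_ext) (simp add: ext_op_apply R plus_l2.rep_eq scaleC.rep_eq fun_eq_iff)
    ultimately show ?thesis by blast
  qed
  have comp: "compose (ell2 ?I) (ext_op S) (ext_op T) \<in> ?M" if "S \<in> ?C" "T \<in> ?C" for S T
  proof -
    have c: "S o\<^sub>L P = P o\<^sub>L S" "T o\<^sub>L P = P o\<^sub>L T" using that by blast+
    have "(S o\<^sub>L T) o\<^sub>L P = (S o\<^sub>L P) o\<^sub>L T" by (simp only: comp_assoc c(2))
    also have "\<dots> = P o\<^sub>L (S o\<^sub>L T)" by (simp only: c(1) comp_assoc)
    finally have "S o\<^sub>L T \<in> ?C" using that corner_comp by blast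
    moreover have "compose (ell2 ?I) (ext_op S) (ext_op T) = ext_op (S o\<^sub>L T)"
      using that by (intro ext_op_comp) blast
    ultimately show ?thesis by blast
  qed
  have adjM: "S \<in> ?M" if T: "T \<in> ?C" and S: "S \<in> bounded_ops ?I" "is_adjoint ?I (ext_op T) S" for S T
  proof -
    obtain S' where S': "corner S'" "S = ext_op S'" using bounded_op_is_ext_op[OF S(1)] by blast
    then have "adj T = S'" using ext_op_is_adjoint[of S' T] S(2) T by blast
    moreover have "T o\<^sub>L P = P o\<^sub>L T" using T by blast
    then have "adj (T o\<^sub>L P) = adj (P o\<^sub>L T)" by (rule arg_cong)
    ultimately have "S' o\<^sub>L P = P o\<^sub>L S'" by (simp only: adj_comp P(2))
    then show ?thesis using S' by blast
  qed
  have closed: "closedin (weak_operator_topology ?I) ?M"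
    unfolding closedin_def topspace_wot
  proof (intro conjI sub)
    have M_iff: "S \<in> ?M \<longleftrightarrow> (\<forall>f\<in>ell2 ?I. \<forall>g\<in>ell2 ?I.
        ell2_inner (S (ext_op P f)) g = ell2_inner (S f) (ext_op P g))" if S: "S \<in> bounded_ops ?I" for S
    proof -
      obtain S' where S': "corner S'" "S = ext_op S'" using bounded_op_is_ext_op[OF S] by blast
      have "S \<in> ?M \<longleftrightarrow> S' o\<^sub>L P = P o\<^sub>L S'" using S' ext_op_inj by blast
      then show ?thesis using commute_iff_weak[OF S'(1) P] S'(2) by simp
    qed
    \<comment> \<open>If the two coefficients differ at \<open>S\<close>, they still differ on a weak neighbourhood of \<open>S\<close>.\<close>
    show "openin (weak_operator_topology ?I) (bounded_ops ?I - ?M)"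
    proof (subst openin_subopen, intro ballI)
      fix S assume SM: "S \<in> bounded_ops ?I - ?M"
      then have S: "S \<in> bounded_ops ?I" by (rule DiffD1)
      have "S \<notin> ?M" using SM by (intro notI) (erule DiffD2)
      then have "\<not> (\<forall>f\<in>ell2 ?I. \<forall>g\<in>ell2 ?I.
        ell2_inner (S (ext_op P f)) g = ell2_inner (S f) (ext_op P g))" by (simp only: M_iff[OF S] not_False_eq_True)
      then obtain f g where fg: "f \<in> ell2 ?I" "g \<in> ell2 ?I"
        "ell2_inner (S (ext_op P f)) g \<noteq> ell2_inner (S f) (ext_op P g)" by blast
      have Pm: "ext_op P f \<in> ell2 ?I" "ext_op P g \<in> ell2 ?I"
        using ext_op_bounded[OF P(1)] fg by (auto simp: bounded_ops_def)
      obtain U V where UV: "open U" "open V" "ell2_inner (S (ext_op P f)) g \<in> U"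
        "ell2_inner (S f) (ext_op P g) \<in> V" "U \<inter> V = {}"
        using hausdorff[OF fg(3)] by blast
      let ?A = "{T \<in> bounded_ops ?I. ell2_inner (T (ext_op P f)) g \<in> U} \<inter>
                {T \<in> bounded_ops ?I. ell2_inner (T f) (ext_op P g) \<in> V}"
      have "openin (weak_operator_topology ?I) ?A"
        using fg Pm UV by (intro openin_Int wot_open) auto
      moreover have "S \<in> ?A" using S UV by blast
      moreover have "?A \<subseteq> bounded_ops ?I - ?M"
      proof
        fix T assume T: "T \<in> ?A"
        then have "ell2_inner (T (ext_op P f)) g \<noteq> ell2_inner (T f) (ext_op P g)"
          using UV(5) by (metis (lifting) IntD1 IntD2 disjoint_iff mem_Collect_eq)
        moreover have Tb: "T \<in> bounded_ops ?I" using T by simp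
        ultimately have "T \<notin> ?M" using fg(1,2) by (simp only: M_iff[OF Tb]) blast
        then show "T \<in> bounded_ops ?I - ?M" using Tb by (rule DiffI[rotated])
      qed
      ultimately show "\<exists>T. openin (weak_operator_topology ?I) T \<and> S \<in> T \<and> T \<subseteq> bounded_ops ?I - ?M"
        by blast
    qed
  qed
  show ?thesis
    unfolding von_neumann_algebra_def
    using sub idM comb comp adjM closed by auto
qed

text \<open>
  For projections, commuting with \<open>L(G)\<close> is the same as commuting with \<open>\<lambda>(G)\<close>: the operators that commute
  with \<open>P\<close> form a von Neumann algebra, and it contains \<open>L(G)\<close> as soon as it contains \<open>\<lambda>(G)\<close>.
\<close>

lemma commutant_projection_iff:
  assumes P: "corner P" "proj_op P"
  shows "ext_op P \<in> group_vna_commutant G \<longleftrightarrow> P \<in> equivariant (carrier G)"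
proof
  let ?I = "carrier G"
  assume p: "ext_op P \<in> group_vna_commutant G"
  show "P \<in> equivariant ?I"
  proof (rule equivariantI)
    fix h f assume h: "h \<in> carrier G"
    have "left_regular G h \<in> group_vna G"
      using h unfolding group_vna_def vn_generated_def by blast
    then have "compose (ell2 ?I) (ext_op P) (ext_op (lam h)) = compose (ell2 ?I) (ext_op (lam h)) (ext_op P)"
      using p left_regular_ext_op[OF h] unfolding group_vna_commutant_def commutant_def by auto
    then have "ext_op (P o\<^sub>L lam h) = ext_op (lam h o\<^sub>L P)"
      using ext_op_comp[OF corner_lam[OF h]] ext_op_comp[OF P(1)] by simp
    then have "P o\<^sub>L lam h = lam h o\<^sub>L P"
      by (intro ext_op_inj corner_comp P(1) corner_lam h)
    from comp_apply[OF this, of f] show "lam h (P f) = P (lam h f)" by simp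
  qed (use P in blast)
next
  let ?I = "carrier G"
  assume e: "P \<in> equivariant ?I"
  let ?M = "ext_op ` {T. corner T \<and> T o\<^sub>L P = P o\<^sub>L T}"
  have "left_regular G ` carrier G \<subseteq> ?M"
  proof
    fix T assume "T \<in> left_regular G ` carrier G"
    then obtain g where g: "g \<in> carrier G" "T = ext_op (lam g)" using left_regular_ext_op by blast
    have "lam g o\<^sub>L P = P o\<^sub>L lam g" using equivariantD(2)[OF e g(1)] by (intro blinfun_eqI) simp
    then show "T \<in> ?M" using g corner_lam by blast
  qed
  moreover have "von_neumann_algebra ?I ?M"
    using P by (intro projection_commutant_vna) (auto simp: proj_op_def)
  ultimately have "group_vna G \<subseteq> ?M" unfolding group_vna_def vn_generated_def by blast
  moreover have "compose (ell2 ?I) (ext_op P) T = compose (ell2 ?I) T (ext_op P)" if "T \<in> ?M" for T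
    using that ext_op_comp P(1) by auto
  ultimately show "ext_op P \<in> group_vna_commutant G"
    unfolding group_vna_commutant_def commutant_def using ext_op_bounded[OF P(1)] by blast
qed

lemma equivariant_corner:
  assumes "P \<in> equivariant (carrier G)" "Q o\<^sub>L P = P"
  shows "corner P"
  using equivariant_comm_Q[OF subgroup_self assms(1)] equivariantD(1)[OF assms(1)] assms(2) by simp

lemma commutant_trace_ext_op:
  "commutant_trace G (ext_op P) = cinner (P (basis \<one>)) (basis \<one>)"
proof -
  have "ell2_delta \<one> = coord (basis \<one> :: 'a l2)" by (simp add: basis.rep_eq)
  moreover have "Q (basis \<one>) = basis \<one>" by (simp add: restr_basis)
  ultimately show ?thesis unfolding commutant_trace_def using ext_op_coord by (simp add: cinner_def)
qed

end

section \<open>Parseval frames that are finite unions of Riesz sequences\<close>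

theorem proposition3p8:
  fixes G :: "('a, 'b) monoid_scheme" and H :: "'a set" and N :: nat
  assumes "icc_group G"
    and "countable (carrier G)"
    and "subgroup H G"
    and "icc_group (G\<lparr>carrier := H\<rparr>)"
    and "card (rcosets\<^bsub>G\<^esub> H) = N" and "N > 0"
  shows
    "(\<forall>p'. p' \<in> group_vna_commutant G \<and> is_projection (carrier G) p' \<and>
           Re (commutant_trace G p') \<ge> 1 / real N \<longrightarrow>
        (let K = p' ` ell2 (carrier G);
             \<pi> = subrepresentation (left_regular G) K
         in \<exists>\<eta>. parseval_frame_vector G \<pi> K \<eta> \<and>
                finite_union_of_riesz_sequences (carrier G) (\<lambda>g. \<pi> g \<eta>)))
     \<and>
     (\<forall>\<psi> \<alpha>. onb_vector G (left_regular G) (ell2 (carrier G)) \<psi> \<and>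
             1 > \<alpha> \<and> \<alpha> \<ge> 1 / real N \<longrightarrow>
        (\<exists>p'. p' \<in> group_vna_commutant G \<and> is_projection (carrier G) p' \<and>
              commutant_trace G p' = complex_of_real \<alpha> \<and>
              finite_union_of_riesz_sequences (carrier G) (\<lambda>g. p' (left_regular G g \<psi>))))"
proof -
  interpret group G using assms(1) by (simp add: icc_group_def)
  interpret C: adj_closed "symmetries (carrier G)" by (rule adj_closed_symmetries[OF subgroup_self])
  have fin: "finite (rcosets\<^bsub>G\<^esub> H)" using assms(5,6) by (metis card_gt_0_iff)
  obtain R where R: "transversal H R" "card R = N"
    using transversal_exists[OF assms(3) fin] assms(5) by auto
  show ?thesis
  proof (intro conjI allI impI)
    fix p' assume "p' \<in> group_vna_commutant G \<and> is_projection (carrier G) p' \<and>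
           Re (commutant_trace G p') \<ge> 1 / real N"
    then have p': "p' \<in> group_vna_commutant G" "is_projection (carrier G) p'"
      "Re (commutant_trace G p') \<ge> 1 / real N" by auto
    obtain P where P: "corner P" "p' = ext_op P"
      using bounded_op_is_ext_op p'(2) unfolding is_projection_def by blast
    have pP: "proj_op P" using ext_op_is_projection[OF P(1)] P(2) p'(2) by simp
    have PC: "P \<in> equivariant (carrier G)" using commutant_projection_iff[OF P(1) pP] p'(1) P(2) by simp
    have "P (basis \<one>\<^bsub>G\<^esub>) \<bullet> basis \<one>\<^bsub>G\<^esub> \<ge> 1 / real (card R)"
      using p'(3) R(2) by (simp add: P(2) commutant_trace_ext_op Re_cinner)
    then obtain W c where W: "W \<in> equivariant (carrier G)" "partial_isometry W" "W o\<^sub>L adj W = P"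
      "P o\<^sub>L W = W" "W o\<^sub>L Q = W" and c: "c > 0" "\<And>f. restr H f = f \<Longrightarrow> c * norm f \<le> norm (W f)"
      using frame_operator_exists[OF assms(1,3,4) R(1) PC pP] P(1) R(2) assms(6) by auto
    define K where "K = p' ` ell2 (carrier G)"
    define \<pi> where "\<pi> = subrepresentation (left_regular G) K"
    define \<eta> where "\<eta> = coord (W (basis \<one>\<^bsub>G\<^esub>))"
    have QP: "Q (P f) = P f" for f by (rule corner_Q[OF P(1)])
    have K: "f \<in> K \<longleftrightarrow> (\<exists>F. P F = F \<and> f = coord F)" for f
    proof
      assume "f \<in> K"
      then obtain h where "h \<in> ell2 (carrier G)" "f = p' h" by (auto simp: K_def)
      then have "f = coord (P (Abs_l2 h))" by (simp add: P(2) ext_op_apply)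
      then show "\<exists>F. P F = F \<and> f = coord F" using proj_op_inner(3)[OF pP] by blast
    next
      assume "\<exists>F. P F = F \<and> f = coord F"
      then obtain F where F: "P F = F" "f = coord F" by blast
      then have QF: "Q F = F" using QP by metis
      then have "f = p' (coord F)" using F ext_op_coord[OF QF] P(2) by simp
      then show "f \<in> K" using QF unfolding K_def supported_iff by blast
    qed
    have WK: "coord (W f) \<in> K" for f using comp_apply[OF W(4)] K by blast
    have orbit: "\<pi> g \<eta> = coord (W (basis g))" if g: "g \<in> carrier G" for g
    proof -
      have QW: "Q (W f) = W f" for f using QP comp_apply[OF W(4), of f] by metis
      have "\<pi> g \<eta> = ext_op (lam g) (coord (W (basis \<one>\<^bsub>G\<^esub>)))"
        using WK by (simp add: \<pi>_def subrepresentation_def \<eta>_def left_regular_ext_op[OF g])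
      also have "\<dots> = coord (lam g (W (basis \<one>\<^bsub>G\<^esub>)))" by (rule ext_op_coord[OF QW])
      also have "\<dots> = coord (W (basis g))"
        using equivariantD(2)[OF W(1) g, of "basis \<one>\<^bsub>G\<^esub>"] g by (simp add: lam_basis)
      finally show ?thesis .
    qed
    have "parseval_frame_vector G \<pi> K \<eta>"
      unfolding parseval_frame_vector_def parseval_frame_def
    proof (intro conjI ballI)
      show "\<eta> \<in> K" unfolding \<eta>_def by (rule WK)
      show "\<pi> g \<eta> \<in> K" if "g \<in> carrier G" for g using orbit[OF that] WK by simp
      fix f assume "f \<in> K"
      then obtain F where F: "P F = F" "f = coord F" using K by blast
      have QW: "Q o\<^sub>L adj W = adj W"
      proof -
        have "adj (W o\<^sub>L Q) = adj W" using W(5) by (rule arg_cong)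
        then show ?thesis using proj_restr[of "carrier G"] by (simp add: proj_op_def)
      qed
      have z: "coord (adj W F) x = 0" if "x \<notin> carrier G" for x
        using arg_cong[OF comp_apply[OF QW, of F], of "\<lambda>f. coord f x"] that by (simp add: coord_restr)
      have "(norm (adj W F))\<^sup>2 = (norm F)\<^sup>2"
        using norm_adj_comp[of "adj W" F] W(3) F(1) by (simp add: power2_norm_eq_inner)
      then have "((\<lambda>x. (cmod (coord (adj W F) x))\<^sup>2) has_sum (norm F)\<^sup>2) UNIV"
        using norm_l2_has_sum[of "adj W F"] by simp
      moreover have "((\<lambda>x. (cmod (coord (adj W F) x))\<^sup>2) has_sum (norm F)\<^sup>2) UNIV \<longleftrightarrow>
          ((\<lambda>x. (cmod (coord (adj W F) x))\<^sup>2) has_sum (norm F)\<^sup>2) (carrier G)"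
        by (rule has_sum_cong_neutral) (auto simp: z)
      ultimately have "((\<lambda>x. (cmod (coord (adj W F) x))\<^sup>2) has_sum (norm F)\<^sup>2) (carrier G)"
        by blast
      moreover have "cmod (ell2_inner f (\<pi> g \<eta>)) = cmod (coord (adj W F) g)" if g: "g \<in> carrier G" for g
      proof -
        have "clinear_op (adj W)" using equivariantD(1)[OF C.commutant_adj[OF W(1)]] .
        from cinner_adj_right[OF this, of F "basis g"]
        have "coord (adj W F) g = cinner F (W (basis g))" by (simp add: cinner_basis_right)
        then show ?thesis using orbit[OF g] F(2) by (simp add: cinner_def)
      qed
      ultimately show "((\<lambda>i. (cmod (ell2_inner f (\<pi> i \<eta>)))\<^sup>2) has_sum (ell2_norm f)\<^sup>2) (carrier G)"
        by (subst has_sum_cong[where g = "\<lambda>x. (cmod (coord (adj W F) x))\<^sup>2"])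
          (simp_all add: F(2) norm_l2_def)
    qed
    moreover have "finite_union_of_riesz_sequences (carrier G) (\<lambda>g. \<pi> g \<eta>)"
    proof -
      have "finite_union_of_riesz_sequences (carrier G) (\<lambda>g. coord (W (basis g)))"
        using c partial_isometry_norm_le[OF W(2)] by (intro riesz_cosets[OF assms(3) R(1) W(1) _ c(1)]) auto
      moreover have "finite_union_of_riesz_sequences (carrier G) (\<lambda>g. \<pi> g \<eta>) \<longleftrightarrow>
          finite_union_of_riesz_sequences (carrier G) (\<lambda>g. coord (W (basis g)))"
        by (intro finite_union_of_riesz_sequences_cong orbit)
      ultimately show ?thesis by blast
    qed
    ultimately show "let K = p' ` ell2 (carrier G);
             \<pi> = subrepresentation (left_regular G) K
         in \<exists>\<eta>. parseval_frame_vector G \<pi> K \<eta> \<and>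
                finite_union_of_riesz_sequences (carrier G) (\<lambda>g. \<pi> g \<eta>)"
      unfolding Let_def \<pi>_def K_def by blast
  next
    fix \<psi> \<alpha> assume "onb_vector G (left_regular G) (ell2 (carrier G)) \<psi> \<and> 1 > \<alpha> \<and> \<alpha> \<ge> 1 / real N"
    then have onb: "onb_vector G (left_regular G) (ell2 (carrier G)) \<psi>" and \<alpha>: "\<alpha> < 1" "1 / real N \<le> \<alpha>" by auto
    \<comment> \<open>A finite ICC group is trivial and has no proper subgroup, whereas \<open>1 / N \<le> \<alpha> < 1\<close> gives \<open>N > 1\<close>.\<close>
    have inf: "infinite (carrier G)"
    proof
      assume f: "finite (carrier G)"
      have triv: "g = \<one>\<^bsub>G\<^esub>" if "g \<in> carrier G" for g
      proof (rule ccontr)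
        assume "g \<noteq> \<one>\<^bsub>G\<^esub>"
        then have "infinite ((\<lambda>k. k \<otimes>\<^bsub>G\<^esub> g \<otimes>\<^bsub>G\<^esub> inv\<^bsub>G\<^esub> k) ` carrier G)"
          using that assms(1) by (intro icc_subgroup_class_infinite subgroup_self) auto
        then show False using f by blast
      qed
      then have "rcosets\<^bsub>G\<^esub> H \<subseteq> {H #>\<^bsub>G\<^esub> \<one>\<^bsub>G\<^esub>}" by (auto simp: RCOSETS_def)
      then have "N \<le> 1" using assms(5) card_mono[of "{H #>\<^bsub>G\<^esub> \<one>\<^bsub>G\<^esub>}" "rcosets\<^bsub>G\<^esub> H"] by simp
      then have "N = 1" using assms(6) by simp
      then show False using \<alpha> by simp
    qed
    have \<psi>: "\<psi> \<in> ell2 (carrier G)" using onb by (simp add: onb_vector_def)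
    define \<Psi> where "\<Psi> = Abs_l2 \<psi>"
    have \<Psi>: "Q \<Psi> = \<Psi>" "coord \<Psi> = \<psi>" using Q_Abs[OF \<psi>] coord_Abs[OF \<psi>] by (auto simp: \<Psi>_def)
    have orbit: "left_regular G g \<psi> = coord (lam g \<Psi>)" if "g \<in> carrier G" for g
      using left_regular_ext_op[OF that] ext_op_coord[OF \<Psi>(1)] \<Psi>(2) by simp
    have on: "cinner (lam g \<Psi>) (lam h \<Psi>) = (if g = h then 1 else 0)"
      if "g \<in> carrier G" "h \<in> carrier G" for g h
      using onb that by (simp add: onb_vector_def orthonormal_basis_def cinner_def orbit)
    have b: "card R > 0" "1 / real (card R) \<le> \<alpha>" "\<alpha> \<le> 1" using \<alpha> R(2) assms(6) by auto
    obtain P where P: "P \<in> equivariant (carrier G)" "proj_op P" "Q o\<^sub>L P = P"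
      "P (basis \<one>\<^bsub>G\<^esub>) \<bullet> basis \<one>\<^bsub>G\<^esub> = \<alpha>"
      "finite_union_of_riesz_sequences (carrier G) (\<lambda>g. coord (P (lam g \<Psi>)))"
      using riesz_compression_exists[OF assms(1,3,4) R(1) b(1) inf b(2,3) on] by blast
    have cP: "corner P" by (rule equivariant_corner[OF P(1,3)])
    have "commutant_trace G (ext_op P) = complex_of_real \<alpha>"
    proof -
      have "cinner (P (basis \<one>\<^bsub>G\<^esub>)) (basis \<one>\<^bsub>G\<^esub>) = cinner (P (basis \<one>\<^bsub>G\<^esub>)) (P (basis \<one>\<^bsub>G\<^esub>))"
        using cinner_adj_right[of P "P (basis \<one>\<^bsub>G\<^esub>)" "basis \<one>\<^bsub>G\<^esub>"] cP P(2) proj_op_inner(3)[OF P(2)]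
        by (simp add: proj_op_def)
      also have "\<dots> = complex_of_real \<alpha>"
        unfolding cinner_self using P(4) proj_op_inner(2)[OF P(2), of "basis \<one>\<^bsub>G\<^esub>"] by simp
      finally show ?thesis by (simp add: commutant_trace_ext_op)
    qed
    moreover have "finite_union_of_riesz_sequences (carrier G) (\<lambda>g. ext_op P (left_regular G g \<psi>))"
    proof -
      have "ext_op P (left_regular G g \<psi>) = coord (P (lam g \<Psi>))" if g: "g \<in> carrier G" for g
        unfolding orbit[OF g] by (rule ext_op_coord[OF corner_Q[OF corner_lam[OF g]]])
      then have "finite_union_of_riesz_sequences (carrier G) (\<lambda>g. ext_op P (left_regular G g \<psi>)) \<longleftrightarrow>
          finite_union_of_riesz_sequences (carrier G) (\<lambda>g. coord (P (lam g \<Psi>)))"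
        by (intro finite_union_of_riesz_sequences_cong)
      then show ?thesis using P(5) by blast
    qed
    ultimately show "\<exists>p'. p' \<in> group_vna_commutant G \<and> is_projection (carrier G) p' \<and>
              commutant_trace G p' = complex_of_real \<alpha> \<and>
              finite_union_of_riesz_sequences (carrier G) (\<lambda>g. p' (left_regular G g \<psi>))"
      using commutant_projection_iff[OF cP P(2)] ext_op_is_projection[OF cP] P(1,2) by blast
  qed
qed

end
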